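(* There is a finite subset $S$ such that for $\omega\in(\frac12,\frac32)\setminus S$ (and $\epsilon\geq 0$ sufficiently small) there exists a normal form transformation of the form $$g=f+K(f,f),$$ $$K(f,f)=\sum_{k+\ell\neq0}\Big[\hat K_1(k,\ell)\hat f(k)\hat f(\ell)+\hat K_2(k,\ell)\hat f(k)\overline{\hat f(-\ell)}+\hat K_2(\ell,k)\overline{\hat f(-k)}\hat f(\ell)+\hat K_3(k,\ell)\overline{\hat f(-k)}\,\overline{\hat f(-\ell)}\Big]e^{i(k+\ell)x},$$ with coefficients satisfying $\hat K_j(k,\ell)=\hat K_j(\ell,k)$ for $j=1,3$, that transforms the equation $$f_t=L_\epsilon f-i\tilde{\mathcal N}_2$$ into an equation with a cubic nonlinearity $$g_t=L_\epsilon g+\mathcal{O}(\|g\|_s^3),\qquad(s\ge1),$$ where $$L_\epsilon f=-if_{xx}+\epsilon(-\alpha f+f_{xx})-2i\omega^2(f+\bar f),\qquad \tilde{\mathcal N}_2=2\omega\left[2(|f|^2-\langle|f|^2\rangle)+(f^2-\langle f^2\rangle)\right].$$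
   Context: $f=f(t,x)$ is complex valued, $2\pi$-periodic and even in $x$, with zero spatial mean: $\langle f\rangle=0$, where $\langle f\rangle=\frac1{2\pi}\int_0^{2\pi}f\,dx$; $f=\sum_{k\ne0}\hat f(k)e^{ikx}$, and the sum defining $K$ is over nonzero integers $k,\ell$ with $k+\ell\neq0$. $\alpha>0$ is a constant and $\epsilon$ is the perturbation parameter. $\|\cdot\|_s$ is the Sobolev $H^s$ norm on $2\pi$-periodic functions; $\mathcal{O}(\|g\|_s^3)$ denotes a term whose $H^s$ norm is bounded by a constant times $\|g\|_s^3$ for $g$ small in $H^s$. *)

theory Defs
  imports "HOL-Analysis.Analysis"
begin

definition mean :: "(real \<Rightarrow> complex) \<Rightarrow> complex" where
  "mean u = (LBINT x:{0..2*pi}. u x) / (2 * pi)"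

definition fourier :: "(real \<Rightarrow> complex) \<Rightarrow> int \<Rightarrow> complex" where
  "fourier u k = mean (\<lambda>x. u x * cis (- (of_int k * x)))"

definition sobolev_norm :: "real \<Rightarrow> (real \<Rightarrow> complex) \<Rightarrow> real" where
  "sobolev_norm s u = sqrt (\<Sum>\<^sub>\<infinity>k. (1 + (of_int k)\<^sup>2) powr s * (cmod (fourier u k))\<^sup>2)"

definition sobolev :: "real \<Rightarrow> (real \<Rightarrow> complex) set" where
  "sobolev s = {u. u \<in> borel_measurable borel \<and> (\<forall>x. u (x + 2 * pi) = u x) \<and>
     set_integrable lborel {0..2*pi} (\<lambda>x. (cmod (u x))\<^sup>2) \<and>
     (\<lambda>k. (1 + (of_int k)\<^sup>2) powr s * (cmod (fourier u k))\<^sup>2) summable_on UNIV}"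

definition even_sobolev0 :: "real \<Rightarrow> (real \<Rightarrow> complex) set" where
  "even_sobolev0 s = {u \<in> sobolev s. (\<forall>x. u (- x) = u x) \<and> mean u = 0}"

text \<open>
  Fourier coefficients of $L_\epsilon u$. For $u \in H^s$ with $s < 2$ the second
  derivative is only a distribution, so $u_{xx}$ enters through its coefficients
  $(ik)^2 \hat u(k)$.
\<close>

definition L_hat :: "real \<Rightarrow> real \<Rightarrow> real \<Rightarrow> (real \<Rightarrow> complex) \<Rightarrow> int \<Rightarrow> complex" where
  "L_hat \<alpha> \<omega> \<epsilon> u k =
     (let u_hat = fourier u k; u_xx_hat = (\<i> * of_int k)\<^sup>2 * fourier u k
      in - \<i> * u_xx_hat + \<epsilon> * (- \<alpha> * u_hat + u_xx_hat)
         - 2 * \<i> * \<omega>\<^sup>2 * (u_hat + fourier (\<lambda>x. cnj (u x)) k))"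

definition N2 :: "real \<Rightarrow> (real \<Rightarrow> complex) \<Rightarrow> real \<Rightarrow> complex" where
  "N2 \<omega> u x = 2 * \<omega> *
     (2 * ((cmod (u x))\<^sup>2 - mean (\<lambda>y. (cmod (u y))\<^sup>2)) + ((u x)\<^sup>2 - mean (\<lambda>y. (u y)\<^sup>2)))"

text \<open>
  \<open>solves \<alpha> \<omega> \<epsilon> P s I f\<close>: the curve \<open>f\<close> lies in $C(I; H^s)$, with even zero-mean
  values, and $f_t = L_\epsilon f + P(f)$ holds on the time interval \<open>I\<close> in the sense of
  periodic distributions, i.e. Fourier mode by Fourier mode.
\<close>

definition solves ::
  "real \<Rightarrow> real \<Rightarrow> real \<Rightarrow> ((real \<Rightarrow> complex) \<Rightarrow> real \<Rightarrow> complex) \<Rightarrow> real \<Rightarrow> real set \<Rightarrow>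
   (real \<Rightarrow> real \<Rightarrow> complex) \<Rightarrow> bool" where
  "solves \<alpha> \<omega> \<epsilon> P s I f \<longleftrightarrow>
     (\<forall>t\<in>I. f t \<in> even_sobolev0 s) \<and>
     (\<forall>t\<in>I. ((\<lambda>\<tau>. sobolev_norm s (\<lambda>x. f \<tau> x - f t x)) \<longlongrightarrow> 0) (at t within I)) \<and>
     (\<forall>t\<in>I. \<forall>k. ((\<lambda>\<tau>. fourier (f \<tau>) k) has_vector_derivative
                   (L_hat \<alpha> \<omega> \<epsilon> (f t) k + fourier (P (f t)) k)) (at t within I))"

definition modes :: "(int \<times> int) set" where
  "modes = {(k, l). k \<noteq> 0 \<and> l \<noteq> 0 \<and> k + l \<noteq> 0}"

type_synonym kernel = "int \<Rightarrow> int \<Rightarrow> complex"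

definition K_coeff ::
  "kernel \<Rightarrow> kernel \<Rightarrow> kernel \<Rightarrow> (real \<Rightarrow> complex) \<Rightarrow> int \<times> int \<Rightarrow> complex" where
  "K_coeff K1 K2 K3 u = (\<lambda>(k, l).
       K1 k l * fourier u k * fourier u l
     + K2 k l * fourier u k * cnj (fourier u (- l))
     + K2 l k * cnj (fourier u (- k)) * fourier u l
     + K3 k l * cnj (fourier u (- k)) * cnj (fourier u (- l)))"

definition K_form ::
  "kernel \<Rightarrow> kernel \<Rightarrow> kernel \<Rightarrow> (real \<Rightarrow> complex) \<Rightarrow> real \<Rightarrow> complex" where
  "K_form K1 K2 K3 u x =
     (\<Sum>\<^sub>\<infinity>(k, l)\<in>modes. K_coeff K1 K2 K3 u (k, l) * cis (of_int (k + l) * x))"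

definition normal_form ::
  "kernel \<Rightarrow> kernel \<Rightarrow> kernel \<Rightarrow> (real \<Rightarrow> complex) \<Rightarrow> real \<Rightarrow> complex" where
  "normal_form K1 K2 K3 u x = u x + K_form K1 K2 K3 u x"

end

theory Submission imports Defs begin

text \<open>
  On even functions the Fourier coefficients \<open>a\<close> of a solution satisfy
  \<open>a\<^sub>k' = c\<^sub>k a\<^sub>k - i \<theta> cnj a\<^sub>k + n\<^sub>k\<close> with \<open>\<theta> = 2 \<omega>\<^sup>2\<close>, and the quadratic terms cancel exactly if, for
  every pair of modes, the quadruple of kernel values solves a real-linear equation in
  \<open>\<complex>\<^sup>4\<close>. Its operator is a sum of three commuting operators; at \<open>\<epsilon> = 0\<close> their
  squares are the scalars \<open>j\<^sup>2 (2 \<theta> - j\<^sup>2)\<close> for \<open>j = k + l, k, l\<close>, so it is invertible off the zeros of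
  a nonzero polynomial in \<open>\<theta>\<close>. All but finitely many pairs are handled, uniformly in
  \<open>\<epsilon>\<close>, by diagonal dominance; the finitely many others give the exceptional set and
  the bound on \<open>\<epsilon>\<close>. Hence the kernels are bounded and \<open>K\<close> is a bounded quadratic map of
  \<open>H\<^sup>s\<close>, close to zero a perturbation of the identity. The remainder is then
  \<open>R(g) = K(n, f) + K(f, n)\<close>, where \<open>f\<close> is the unique small preimage of \<open>g\<close>.
\<close>

section \<open>The homological equation\<close>

text \<open>The obstacle is the loss of two derivatives: a solution is merely continuous in time
  with values in H^s, so Lf need not lie in H^s and the chain rule for K(f,f) has no direct meaning
  there. But \<open>solves\<close> tests the equation one Fourier mode at a time, and in a fixed
  output mode m the series for K(Lf,f) + K(f,Lf) still converges absolutely: along k + l = m two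
  derivatives on one factor become one on each, at the price of a factor that grows with m. The
  remainder contains no derivatives at all, so bounded kernels suffice for the cubic estimate. The
  real parts of the linear symbols also grow with the modes, so a fixed \<epsilon> is not a small
  perturbation for all pairs at once; the estimate for large modes therefore uses imaginary parts
  only. Finally, \<open>sobolev\<close> consists of functions and the nonlinearity is built from
  pointwise products, so the passage to sequences rests on the uniqueness theorem for Fourier
  coefficients of integrable functions.\<close>

text \<open>A quadruple \<open>(p, q, r, z)\<close> stands for the form
  \<open>p a\<^sub>k a\<^sub>l + q a\<^sub>k cnj a\<^sub>l + r cnj a\<^sub>k a\<^sub>l + z cnj a\<^sub>k cnj a\<^sub>l\<close>. The operators below describe
  how the linear flow acts on it through the output mode \<open>k + l\<close> and through the two inputs.\<close>

type_synonym coeffs = "complex \<times> complex \<times> complex \<times> complex"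

definition lin_symbol :: "real \<Rightarrow> real \<Rightarrow> real \<Rightarrow> int \<Rightarrow> complex" where
  "lin_symbol \<alpha> \<theta> \<epsilon> k = Complex (- \<epsilon> * (\<alpha> + (of_int k)\<^sup>2)) ((of_int k)\<^sup>2 - \<theta>)"

text \<open>Conjugating a form reverses its quadruple: (p, q, r, z) becomes (cnj z, cnj r, cnj q,
  cnj p). This is what makes the equation only real-linear.\<close>

definition out_op :: "real \<Rightarrow> complex \<Rightarrow> coeffs \<Rightarrow> coeffs" where
  "out_op \<theta> c = (\<lambda>(p, q, r, z). (c * p - \<i> * \<theta> * cnj z, c * q - \<i> * \<theta> * cnj r,
      c * r - \<i> * \<theta> * cnj q, c * z - \<i> * \<theta> * cnj p))"

text \<open>The transposed action: the flow turns a_k into c a_k - i \<theta> cnj a_k and cnj a_k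
  into cnj c cnj a_k + i \<theta> a_k, so the old r contributes to the new p, the old z to the new
  q, and conversely.\<close>

definition in1_op :: "real \<Rightarrow> complex \<Rightarrow> coeffs \<Rightarrow> coeffs" where
  "in1_op \<theta> c = (\<lambda>(p, q, r, z). (c * p + \<i> * \<theta> * r, c * q + \<i> * \<theta> * z,
      cnj c * r - \<i> * \<theta> * p, cnj c * z - \<i> * \<theta> * q))"

definition in2_op :: "real \<Rightarrow> complex \<Rightarrow> coeffs \<Rightarrow> coeffs" where
  "in2_op \<theta> c = (\<lambda>(p, q, r, z). (c * p + \<i> * \<theta> * q, cnj c * q - \<i> * \<theta> * p,
      c * r + \<i> * \<theta> * z, cnj c * z - \<i> * \<theta> * r))"

definition hom_op :: "real \<Rightarrow> real \<Rightarrow> real \<Rightarrow> int \<Rightarrow> int \<Rightarrow> coeffs \<Rightarrow> coeffs" where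
  "hom_op \<alpha> \<theta> \<epsilon> k l v = out_op \<theta> (lin_symbol \<alpha> \<theta> \<epsilon> (k + l)) v
     - in1_op \<theta> (lin_symbol \<alpha> \<theta> \<epsilon> k) v - in2_op \<theta> (lin_symbol \<alpha> \<theta> \<epsilon> l) v"

definition swap_coeffs :: "coeffs \<Rightarrow> coeffs" where
  "swap_coeffs = (\<lambda>(p, q, r, z). (p, r, q, z))"

lemmas op_defs = out_op_def in1_op_def in2_op_def

lemma hom_op_swap: "hom_op \<alpha> \<theta> \<epsilon> l k (swap_coeffs v) = swap_coeffs (hom_op \<alpha> \<theta> \<epsilon> k l v)"
  by (cases v) (simp add: hom_op_def op_defs swap_coeffs_def algebra_simps)

lemma hom_op_minus: "hom_op \<alpha> \<theta> \<epsilon> (- k) (- l) = hom_op \<alpha> \<theta> \<epsilon> k l"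
proof -
  have "lin_symbol \<alpha> \<theta> \<epsilon> (- k - l) = lin_symbol \<alpha> \<theta> \<epsilon> (k + l)"
    using power2_minus[of "real_of_int (k + l)"] by (simp add: lin_symbol_def)
  then show ?thesis
    by (simp add: fun_eq_iff hom_op_def lin_symbol_def)
qed

lemma linear_hom_op: "linear (hom_op \<alpha> \<theta> \<epsilon> k l)"
  by (rule linearI) (auto simp: hom_op_def op_defs algebra_simps scaleR_conv_of_real)

text \<open>Conjugation leaves the real part of a symbol unchanged, so \<epsilon> contributes a
  scalar: -(\<alpha> + (k+l)^2) + (\<alpha> + k^2) + (\<alpha> + l^2) = \<alpha> - 2kl. It is
  unbounded over the modes, hence perturbation in \<epsilon> can serve finitely many pairs
  only.\<close>

lemma hom_op_eps:
  "hom_op \<alpha> \<theta> \<epsilon> k l v = hom_op \<alpha> \<theta> 0 k l v + (\<epsilon> * (\<alpha> - 2 * of_int (k * l))) *\<^sub>R v"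
proof -
  have *: "lin_symbol \<alpha> \<theta> \<epsilon> j = lin_symbol \<alpha> \<theta> 0 j - of_real (\<epsilon> * (\<alpha> + (of_int j)\<^sup>2))" for j
    by (simp add: lin_symbol_def complex_eq_iff)
  show ?thesis
    by (cases v) (simp add: hom_op_def op_defs * scaleR_conv_of_real, 
      simp add: algebra_simps power2_eq_square)
qed

subsection \<open>Solvability of the homological equation\<close>

definition sq_symbol :: "real \<Rightarrow> int \<Rightarrow> real" where
  "sq_symbol \<theta> k = (of_int k)\<^sup>2 * (2 * \<theta> - (of_int k)\<^sup>2)"

text \<open>On a null vector x = y + z. Squaring with commuting operators gives A = B + C + 2yz, and
  squaring again eliminates yz: (A - B - C)^2 = 4BC. The hypothesis thus says that no signed sum of
  square roots of A, B and C vanishes.\<close>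

lemma hom_op_0_inj:
  assumes "(sq_symbol \<theta> (k + l) - sq_symbol \<theta> k - sq_symbol \<theta> l)\<^sup>2 \<noteq> 4 * sq_symbol \<theta> k * sq_symbol \<theta> l"
  shows "inj (hom_op \<alpha> \<theta> 0 k l)"
proof -
  define r where "r j = (of_int j)\<^sup>2 - \<theta>" for j :: int
  have sym: "lin_symbol \<alpha> \<theta> 0 j = \<i> * of_real (r j)" for j
    by (simp add: lin_symbol_def r_def complex_eq_iff)
  have sq: "sq_symbol \<theta> j = \<theta>\<^sup>2 - (r j)\<^sup>2" for j
    by (simp add: sq_symbol_def r_def power2_eq_square algebra_simps)
  define x where "x = out_op \<theta> (\<i> * of_real (r (k + l)))"
  define y where "y = in1_op \<theta> (\<i> * of_real (r k))"
  define z where "z = in2_op \<theta> (\<i> * of_real (r l))"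
  define A B C where "A = sq_symbol \<theta> (k + l)" and "B = sq_symbol \<theta> k" and "C = sq_symbol \<theta> l"
  \<comment> \<open>For imaginary c the mixed terms carry the factor c + cnj c = 0, which leaves c^2
    + \<theta>^2.\<close>
  have xx: "x (x v) = A *\<^sub>R v" for v
    by (cases v) (simp add: x_def A_def op_defs sq scaleR_conv_of_real power2_eq_square algebra_simps)
  have yy: "y (y v) = B *\<^sub>R v" for v
    by (cases v) (simp add: y_def B_def op_defs sq scaleR_conv_of_real power2_eq_square algebra_simps)
  have zz: "z (z v) = C *\<^sub>R v" for v
    by (cases v) (simp add: z_def C_def op_defs sq scaleR_conv_of_real power2_eq_square algebra_simps)
  have xy: "x (y v) = y (x v)" and xz: "x (z v) = z (x v)" and yz: "y (z v) = z (y v)" for v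
    by (cases v; simp add: x_def y_def z_def op_defs algebra_simps)+
  have lin: "linear x" "linear y" "linear z"
    by (rule linearI; auto simp: x_def y_def z_def op_defs algebra_simps scaleR_conv_of_real)+
  note add = lin[THEN linear_add] lin[THEN linear_scale]
  have "v = 0" if "hom_op \<alpha> \<theta> 0 k l v = 0" for v
  proof -
    have xv: "x v = y v + z v"
      using that by (simp add: hom_op_def sym x_def y_def z_def algebra_simps)
    have "A *\<^sub>R v = y (x v) + z (x v)"
      by (metis xx xv xy xz add(1))
    also have "\<dots> = B *\<^sub>R v + C *\<^sub>R v + 2 *\<^sub>R y (z v)"
      by (simp add: xv add yy zz yz scaleR_2)
    finally have 1: "2 *\<^sub>R y (z v) = (A - B - C) *\<^sub>R v"
      by (simp add: algebra_simps)
    have "(A - B - C)\<^sup>2 *\<^sub>R v = (A - B - C) *\<^sub>R (2 *\<^sub>R y (z v))"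
      by (simp add: 1 power2_eq_square)
    also have "\<dots> = 2 *\<^sub>R y (z ((A - B - C) *\<^sub>R v))"
      by (simp add: add)
    also have "\<dots> = 4 *\<^sub>R y (z (y (z v)))"
      by (simp add: add flip: 1)
    also have "\<dots> = (4 * B * C) *\<^sub>R v"
      by (simp add: yz[symmetric] zz yy add mult_ac)
    finally have "((A - B - C)\<^sup>2 - 4 * B * C) *\<^sub>R v = 0"
      by (simp add: algebra_simps)
    then show "v = 0"
      using assms by (simp add: A_def B_def C_def)
  qed
  then show ?thesis
    using linear_injective_0[OF linear_hom_op] by blast
qed

definition nonres_poly :: "int \<Rightarrow> int \<Rightarrow> real poly" where
  "nonres_poly k l = (let X = (\<lambda>j::int. [:- ((of_int j)^4), 2 * (of_int j)\<^sup>2:])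
     in (X (k + l) - X k - X l)^2 - 4 * X k * X l)"

lemma poly_nonres_poly:
  "poly (nonres_poly k l) \<theta> =
    (sq_symbol \<theta> (k + l) - sq_symbol \<theta> k - sq_symbol \<theta> l)\<^sup>2 - 4 * sq_symbol \<theta> k * sq_symbol \<theta> l"
  by (simp add: nonres_poly_def sq_symbol_def Let_def power4_eq_xxxx power2_eq_square algebra_simps)

text \<open>At \<open>\<theta> = 0\<close> the operators are diagonal with eigenvalues $\pm i j^2$, and
  $\pm (k+l)^2 \pm k^2 \pm l^2$ never vanishes on the modes.\<close>

lemma nonres_poly_nonzero:
  assumes "(k, l) \<in> modes"
  shows "nonres_poly k l \<noteq> 0"
proof -
  define a b where "a = real_of_int k" and "b = real_of_int l"
  have nz: "a \<noteq> 0" "b \<noteq> 0" "a + b \<noteq> 0"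
    using assms by (auto simp: modes_def a_def b_def simp flip: of_int_add)
  \<comment> \<open>The expression splits as in Heron's formula; with m = a + b the differences are
    m^2 - a^2 - b^2 = 2ab, m^2 + a^2 - b^2 = 2am and m^2 - a^2 + b^2 = 2bm.\<close>
  have "poly (nonres_poly k l) 0 = 8 * (a * b) * (a * (a + b)) * (b * (a + b)) * ((a + b)\<^sup>2 + a\<^sup>2 + b\<^sup>2)"
    by (simp add: poly_nonres_poly sq_symbol_def a_def b_def power2_eq_square, algebra)
  also have "(a + b)\<^sup>2 + a\<^sup>2 + b\<^sup>2 > 0"
    using nz by (intro add_nonneg_pos) auto
  hence "8 * (a * b) * (a * (a + b)) * (b * (a + b)) * ((a + b)\<^sup>2 + a\<^sup>2 + b\<^sup>2) \<noteq> 0"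
    using nz by auto
  finally show ?thesis by auto
qed

text \<open>The bound 14 makes every diagonal entry at least \<open>28 - 3 \<theta> \<ge> 3 \<theta> + 1\<close> in modulus, while the
  off-diagonal entries of a row add up to \<open>3 \<theta>\<close>.\<close>

definition low_modes :: "(int \<times> int) set" where
  "low_modes = {(k, l) \<in> modes. \<bar>k * l\<bar> < 14 \<or> \<bar>k * (k + l)\<bar> < 14 \<or> \<bar>l * (k + l)\<bar> < 14}"

text \<open>A small product of nonzero integers bounds both factors, so two of |k|, |l|, |k + l| are
  below 14 and the third is below 28.\<close>

lemma finite_low_modes: "finite low_modes"
proof (rule finite_subset)
  have *: "\<bar>a\<bar> < 14 \<and> \<bar>b\<bar> < 14" if "\<bar>a * b\<bar> < 14" "a \<noteq> 0" "b \<noteq> 0" for a b :: int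
  proof -
    have "\<bar>a\<bar> * 1 \<le> \<bar>a\<bar> * \<bar>b\<bar>" "1 * \<bar>b\<bar> \<le> \<bar>a\<bar> * \<bar>b\<bar>"
      using that by (intro mult_mono; linarith)+
    with that(1) show ?thesis unfolding abs_mult by linarith
  qed
  show "low_modes \<subseteq> {-28..28} \<times> {-28..28}"
  proof clarify
    fix k l assume kl: "(k, l) \<in> low_modes"
    then have "k \<noteq> 0" "l \<noteq> 0" "k + l \<noteq> 0"
      by (auto simp: low_modes_def modes_def)
    then have "(\<bar>k\<bar> < 14 \<and> \<bar>l\<bar> < 14) \<or> (\<bar>k\<bar> < 14 \<and> \<bar>k + l\<bar> < 14) \<or> (\<bar>l\<bar> < 14 \<and> \<bar>k + l\<bar> < 14)"
      using kl *[of k l] *[of k "k + l"] *[of l "k + l"] by (auto simp: low_modes_def)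
    then show "k \<in> {-28..28} \<and> l \<in> {-28..28}" by auto
  qed
qed auto

text \<open>The row of a component of largest modulus M already has modulus at least M. Only the
  imaginary parts of the diagonal are estimated, and these do not contain \<epsilon>, so the bound
  holds for every \<epsilon>. The factor 2 compares the maximum of four components with the
  Euclidean norm.\<close>

lemma hom_op_high_modes:
  assumes "(k, l) \<in> modes - low_modes" and \<theta>: "0 < \<theta>" "\<theta> < 9/2"
  shows "norm v \<le> 2 * norm (hom_op \<alpha> \<theta> \<epsilon> k l v)"
proof -
  obtain p q r z where v: "v = (p, q, r, z)" by (cases v)
  define M where "M = Max {cmod p, cmod q, cmod r, cmod z}"
  have le: "cmod p \<le> M" "cmod q \<le> M" "cmod r \<le> M" "cmod z \<le> M"
    by (auto simp: M_def)
  have M_in: "M \<in> {cmod p, cmod q, cmod r, cmod z}"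
    unfolding M_def by (rule Max_in) auto
  have M0: "0 \<le> M" using le(1) norm_ge_zero[of p] by linarith
  define ck cl cm where "ck = lin_symbol \<alpha> \<theta> \<epsilon> k" and "cl = lin_symbol \<alpha> \<theta> \<epsilon> l"
    and "cm = lin_symbol \<alpha> \<theta> \<epsilon> (k + l)"
  define w1 w2 w3 w4 where
    "w1 = (cm - ck - cl) * p - (\<i> * \<theta> * cnj z + \<i> * \<theta> * r + \<i> * \<theta> * q)" and
    "w2 = (cm - ck - cnj cl) * q - (\<i> * \<theta> * cnj r + \<i> * \<theta> * z - \<i> * \<theta> * p)" and
    "w3 = (cm - cnj ck - cl) * r - (\<i> * \<theta> * cnj q - \<i> * \<theta> * p + \<i> * \<theta> * z)" and
    "w4 = (cm - cnj ck - cnj cl) * z - (\<i> * \<theta> * cnj p - \<i> * \<theta> * q - \<i> * \<theta> * r)"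
  have hom: "hom_op \<alpha> \<theta> \<epsilon> k l v = (w1, w2, w3, w4)"
    by (simp add: v hom_op_def op_defs w1_def w2_def w3_def w4_def ck_def cl_def cm_def algebra_simps)
  have "real_of_int 14 \<le> \<bar>of_int (k * l)\<bar>" "real_of_int 14 \<le> \<bar>of_int (k * (k + l))\<bar>"
     "real_of_int 14 \<le> \<bar>of_int (l * (k + l))\<bar>"
    using assms(1) unfolding of_int_abs[symmetric] of_int_le_iff by (auto simp: low_modes_def)
  note big = this
  define a b where "a = real_of_int k" and "b = real_of_int l"
  have prods: "14 \<le> \<bar>a * b\<bar>" "14 \<le> \<bar>a * (a + b)\<bar>" "14 \<le> \<bar>b * (a + b)\<bar>"
    using big by (simp_all add: a_def b_def)
  \<comment> \<open>In three rows the squares cancel up to twice one of the three products that are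
    large outside \<open>low_modes\<close>; in the fourth they all add up.\<close>
  have Im: "Im (cm - ck - cl) = 2 * (a * b) + \<theta>" "Im (cm - ck - cnj cl) = 2 * (b * (a + b)) - \<theta>"
     "Im (cm - cnj ck - cl) = 2 * (a * (a + b)) - \<theta>"
     "Im (cm - cnj ck - cnj cl) = (a + b)\<^sup>2 + a\<^sup>2 + b\<^sup>2 - 3 * \<theta>"
    by (simp_all add: cm_def ck_def cl_def lin_symbol_def a_def b_def power2_eq_square algebra_simps)
  have sqs: "28 \<le> (a + b)\<^sup>2 + a\<^sup>2 + b\<^sup>2"
  proof -
    have "2 * \<bar>a * b\<bar> \<le> a\<^sup>2 + b\<^sup>2"
      using sum_squares_bound[of "\<bar>a\<bar>" "\<bar>b\<bar>"] by (simp add: abs_mult)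
    with prods(1) zero_le_power2[of "a + b"] show ?thesis by linarith
  qed
  have d: "cmod (cm - ck - cl) \<ge> 3 * \<theta> + 1" "cmod (cm - ck - cnj cl) \<ge> 3 * \<theta> + 1"
      "cmod (cm - cnj ck - cl) \<ge> 3 * \<theta> + 1" "cmod (cm - cnj ck - cnj cl) \<ge> 3 * \<theta> + 1"
    using prods \<theta> Im sqs
       abs_Im_le_cmod[of "cm - ck - cl"] abs_Im_le_cmod[of "cm - ck - cnj cl"]
       abs_Im_le_cmod[of "cm - cnj ck - cl"] abs_Im_le_cmod[of "cm - cnj ck - cnj cl"]
    by linarith+
  have diag: "M \<le> cmod (D * x - e)" if "cmod x = M" "cmod D \<ge> 3 * \<theta> + 1" "cmod e \<le> 3 * \<theta> * M" for D x e
  proof -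
    have "(3 * \<theta> + 1) * M \<le> cmod D * cmod x"
      using that M0 by (intro mult_mono) auto
    then show ?thesis
      using norm_triangle_ineq2[of "D * x" e] that(3) by (simp add: norm_mult algebra_simps)
  qed
  have three: "cmod (x + y + z) \<le> 3 * \<theta> * M" if "cmod x \<le> \<theta> * M" "cmod y \<le> \<theta> * M" "cmod z \<le> \<theta> * M" for x y z
    using that norm_triangle_ineq[of "x + y" z] norm_triangle_ineq[of x y] by (simp add: algebra_simps)
  have one: "cmod (\<i> * \<theta> * x) \<le> \<theta> * M" "cmod (- (\<i> * \<theta> * x)) \<le> \<theta> * M"
     if "cmod x \<le> M" for x
    using that \<theta> by (simp_all add: norm_mult)
  have e: "cmod (\<i> * \<theta> * cnj z + \<i> * \<theta> * r + \<i> * \<theta> * q) \<le> 3 * \<theta> * M"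
    "cmod (\<i> * \<theta> * cnj r + \<i> * \<theta> * z + - (\<i> * \<theta> * p)) \<le> 3 * \<theta> * M"
    "cmod (\<i> * \<theta> * cnj q + - (\<i> * \<theta> * p) + \<i> * \<theta> * z) \<le> 3 * \<theta> * M"
    "cmod (\<i> * \<theta> * cnj p + - (\<i> * \<theta> * q) + - (\<i> * \<theta> * r)) \<le> 3 * \<theta> * M"
    using le by (intro three one; simp)+
  have w: "cmod p = M \<Longrightarrow> M \<le> cmod w1" "cmod q = M \<Longrightarrow> M \<le> cmod w2"
    "cmod r = M \<Longrightarrow> M \<le> cmod w3" "cmod z = M \<Longrightarrow> M \<le> cmod w4"
    unfolding w1_def w2_def w3_def w4_def using d e by (intro diag; simp)+
  have le_norm: "cmod w1 \<le> norm (w1, w2, w3, w4)" "cmod w2 \<le> norm (w1, w2, w3, w4)"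
    "cmod w3 \<le> norm (w1, w2, w3, w4)" "cmod w4 \<le> norm (w1, w2, w3, w4)"
    by (simp_all add: norm_Pair real_le_rsqrt)
  have "M \<le> norm (w1, w2, w3, w4)"
  proof -
    consider "cmod p = M" | "cmod q = M" | "cmod r = M" | "cmod z = M"
      using M_in by blast
    then show ?thesis
      by cases (use w le_norm in linarith)+
  qed
  moreover have "norm v \<le> 2 * M"
  proof -
    have "(cmod p)\<^sup>2 \<le> M\<^sup>2" "(cmod q)\<^sup>2 \<le> M\<^sup>2" "(cmod r)\<^sup>2 \<le> M\<^sup>2" "(cmod z)\<^sup>2 \<le> M\<^sup>2"
      using le by (auto intro: power_mono)
    then have "(norm v)\<^sup>2 \<le> (2 * M)\<^sup>2"
      by (simp add: v norm_Pair power_mult_distrib)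
    then show ?thesis by (rule power2_le_imp_le) (use M0 in simp)
  qed
  ultimately show ?thesis by (simp add: hom)
qed

text \<open>In finite dimension injectivity gives a lower bound B at \<epsilon> = 0. The radius B /
  (2c) keeps the scalar \<epsilon>-term below B/2, so half of the lower bound survives.\<close>

lemma hom_op_low_mode:
  assumes "inj (hom_op \<alpha> \<theta> 0 k l)"
  shows "\<exists>e>0. \<exists>B>0. \<forall>\<epsilon>\<in>{0..e}. \<forall>v. norm v \<le> B * norm (hom_op \<alpha> \<theta> \<epsilon> k l v)"
proof -
  obtain B where B: "B > 0" "\<And>v. B * norm v \<le> norm (hom_op \<alpha> \<theta> 0 k l v)"
    using linear_inj_bounded_below_pos[OF linear_hom_op assms] by blast
  define c where "c = \<bar>\<alpha> - 2 * of_int (k * l)\<bar> + 1"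
  have c: "c > 0" by (simp add: c_def)
  have "norm v \<le> (2 / B) * norm (hom_op \<alpha> \<theta> \<epsilon> k l v)" if "\<epsilon> \<in> {0..B / (2 * c)}" for \<epsilon> v
  proof -
    have "\<epsilon> * \<bar>\<alpha> - 2 * of_int (k * l)\<bar> \<le> (B / (2 * c)) * c"
      using that B c by (intro mult_mono) (auto simp: c_def)
    also have "\<dots> = B / 2" using c by simp
    finally have "\<epsilon> * \<bar>\<alpha> - 2 * of_int (k * l)\<bar> * norm v \<le> B / 2 * norm v"
      by (rule mult_right_mono) simp
    moreover have "norm ((\<epsilon> * (\<alpha> - 2 * of_int (k * l))) *\<^sub>R v) = \<epsilon> * \<bar>\<alpha> - 2 * of_int (k * l)\<bar> * norm v"
      using that unfolding norm_scaleR abs_mult by simp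
    ultimately have "B / 2 * norm v \<le> norm (hom_op \<alpha> \<theta> \<epsilon> k l v)"
      using B(2)[of v] norm_diff_ineq[of "hom_op \<alpha> \<theta> 0 k l v" "(\<epsilon> * (\<alpha> - 2 * of_int (k * l))) *\<^sub>R v"]
      unfolding hom_op_eps[of \<alpha> \<theta> \<epsilon> k l v] by linarith
    then show ?thesis using B(1) by (simp add: field_simps)
  qed
  then show ?thesis
    using B(1) c by (intro exI[of _ "B / (2 * c)"] conjI exI[of _ "2 / B"]) auto
qed

lemma hom_op_uniform:
  assumes \<theta>: "0 < \<theta>" "\<theta> < 9/2"
    and inj: "\<And>k l. (k, l) \<in> low_modes \<Longrightarrow> inj (hom_op \<alpha> \<theta> 0 k l)"
  shows "\<exists>e>0. \<exists>B>0. \<forall>\<epsilon>\<in>{0..e}. \<forall>(k, l)\<in>modes. \<forall>v. norm v \<le> B * norm (hom_op \<alpha> \<theta> \<epsilon> k l v)"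
proof -
  have "\<forall>p\<in>low_modes. \<exists>e>0. \<exists>B>0. \<forall>\<epsilon>\<in>{0..e}. \<forall>v. norm v \<le> B * norm (hom_op \<alpha> \<theta> \<epsilon> (fst p) (snd p) v)"
    using hom_op_low_mode inj by auto
  then obtain e B where eB: "\<And>p. p \<in> low_modes \<Longrightarrow> e p > 0" "\<And>p. p \<in> low_modes \<Longrightarrow> B p > 0"
    "\<And>p \<epsilon> v. p \<in> low_modes \<Longrightarrow> \<epsilon> \<in> {0..e p} \<Longrightarrow> norm v \<le> B p * norm (hom_op \<alpha> \<theta> \<epsilon> (fst p) (snd p) v)"
    by metis
  \<comment> \<open>The inserted 1 gives \<open>Min\<close> a nonempty set without exhibiting a low
    mode. In \<open>B0\<close> the 2 is the constant for the remaining modes, and the sum dominates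
    each \<open>B p\<close>.\<close>
  define e0 where "e0 = Min (insert 1 (e ` low_modes))"
  define B0 where "B0 = 2 + sum B low_modes"
  have e0: "e0 > 0" "p \<in> low_modes \<Longrightarrow> e0 \<le> e p" for p
    using eB(1) finite_low_modes by (auto simp: e0_def)
  have Bp: "B p \<le> B0" if "p \<in> low_modes" for p
    using member_le_sum[of p low_modes B] that eB(2) finite_low_modes
    by (force simp: B0_def intro: less_imp_le)
  have B2: "2 \<le> B0" unfolding B0_def using sum_nonneg[of low_modes B] eB(2) by (simp add: less_imp_le)
  have "norm v \<le> B0 * norm (hom_op \<alpha> \<theta> \<epsilon> k l v)" if "\<epsilon> \<in> {0..e0}" "(k, l) \<in> modes" for \<epsilon> k l v
  proof (cases "(k, l) \<in> low_modes")
    case True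
    have "norm v \<le> B (k, l) * norm (hom_op \<alpha> \<theta> \<epsilon> k l v)"
      using eB(3)[OF True, of \<epsilon>] e0(2)[OF True] that by auto
    also have "\<dots> \<le> B0 * norm (hom_op \<alpha> \<theta> \<epsilon> k l v)"
      using Bp[OF True] by (rule mult_right_mono) simp
    finally show ?thesis .
  next
    case False
    then have "norm v \<le> 2 * norm (hom_op \<alpha> \<theta> \<epsilon> k l v)"
      using that hom_op_high_modes[OF _ \<theta>] by auto
    also have "\<dots> \<le> B0 * norm (hom_op \<alpha> \<theta> \<epsilon> k l v)"
      using B2 by (rule mult_right_mono) simp
    finally show ?thesis .
  qed
  then show ?thesis using e0(1) B2 by (intro exI[of _ e0] conjI exI[of _ B0]) auto
qed

text \<open>In a nonzero mode -i times the nonlinearity is -2i\<omega>(2|f|^2 + f^2). The term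
  2|f|^2 is split evenly between a_k cnj a_l and cnj a_k a_l; the quadruple is then fixed by
  \<open>swap_coeffs\<close>, a symmetry which the kernel inherits. Subtracting the means matches
  the exclusion of k + l = 0.\<close>

definition N2_coeffs :: "real \<Rightarrow> coeffs" where
  "N2_coeffs \<omega> = (- 2 * \<i> * \<omega>, - 2 * \<i> * \<omega>, - 2 * \<i> * \<omega>, 0)"

text \<open>Only low modes can be resonant: \<omega> < 3/2 is \<theta> < 9/2, where diagonal
  dominance settles all other pairs.\<close>

definition res_set :: "real set" where
  "res_set = {\<omega>\<in>{1/2<..<3/2}. \<exists>(k, l)\<in>low_modes. poly (nonres_poly k l) (2 * \<omega>\<^sup>2) = 0}"

lemma finite_res_set: "finite res_set"
proof -
  have "finite (\<Union>(k, l)\<in>low_modes. {\<theta>. poly (nonres_poly k l) \<theta> = 0})"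
    using finite_low_modes nonres_poly_nonzero
    by (intro finite_UN_I) (auto intro!: poly_roots_finite simp: low_modes_def)
  then have "finite ((\<lambda>\<omega>. 2 * \<omega>\<^sup>2) -` (\<Union>(k, l)\<in>low_modes. {\<theta>. poly (nonres_poly k l) \<theta> = 0}) \<inter> {1/2<..<3/2::real})"
    by (rule finite_vimage_IntI) (auto simp: inj_on_def power2_eq_iff_nonneg)
  then show ?thesis
    by (rule rev_finite_subset) (auto simp: res_set_def)
qed

text \<open>Injectivity in finite dimension gives a unique solution, and the lower bound applied to
  it bounds the kernel. Uniqueness also yields the swap symmetry, since the right-hand side is
  symmetric; invariance under (k, l) to (-k, -l) holds because the operator sees squares of modes
  only.\<close>

lemma homological_solution:
  assumes "\<omega> \<in> {1/2<..<3/2} - res_set"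
  shows "\<exists>e>0. \<exists>B. \<exists>K :: real \<Rightarrow> int \<Rightarrow> int \<Rightarrow> coeffs. \<forall>\<epsilon>\<in>{0..e}. \<forall>(k, l)\<in>modes.
     hom_op \<alpha> (2 * \<omega>\<^sup>2) \<epsilon> k l (K \<epsilon> k l) = N2_coeffs \<omega> \<and> norm (K \<epsilon> k l) \<le> B \<and>
     K \<epsilon> l k = swap_coeffs (K \<epsilon> k l) \<and> K \<epsilon> (- k) (- l) = K \<epsilon> k l"
proof -
  have \<omega>: "1/2 < \<omega>" "\<omega> < 3/2" using assms by auto
  have "\<omega>\<^sup>2 < (3/2)\<^sup>2" using \<omega> by (intro power_strict_mono) auto
  then have \<theta>: "0 < 2 * \<omega>\<^sup>2" "2 * \<omega>\<^sup>2 < 9/2"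
    using \<omega> by (auto simp: power2_eq_square)
  have "inj (hom_op \<alpha> (2 * \<omega>\<^sup>2) 0 k l)" if "(k, l) \<in> low_modes" for k l
    using assms that by (intro hom_op_0_inj) (auto simp: res_set_def poly_nonres_poly)
  from hom_op_uniform[OF \<theta> this] obtain e B where e: "e > 0" "B > 0"
    and low: "\<And>\<epsilon> k l v. \<epsilon> \<in> {0..e} \<Longrightarrow> (k, l) \<in> modes \<Longrightarrow> norm v \<le> B * norm (hom_op \<alpha> (2 * \<omega>\<^sup>2) \<epsilon> k l v)"
    by blast
  have inj: "inj (hom_op \<alpha> (2 * \<omega>\<^sup>2) \<epsilon> k l)" if "\<epsilon> \<in> {0..e}" "(k, l) \<in> modes" for \<epsilon> k l
    unfolding linear_injective_0[OF linear_hom_op]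
    by (metis low[OF that] norm_zero mult_zero_right norm_le_zero_iff)
  define K where "K = (\<lambda>\<epsilon> k l. inv (hom_op \<alpha> (2 * \<omega>\<^sup>2) \<epsilon> k l) (N2_coeffs \<omega>))"
  have K: "hom_op \<alpha> (2 * \<omega>\<^sup>2) \<epsilon> k l (K \<epsilon> k l) = N2_coeffs \<omega>" if "\<epsilon> \<in> {0..e}" "(k, l) \<in> modes" for \<epsilon> k l
    unfolding K_def by (rule surj_f_inv_f, rule linear_injective_imp_surjective[OF linear_hom_op inj[OF that]]) simp
  have "hom_op \<alpha> (2 * \<omega>\<^sup>2) \<epsilon> k l (K \<epsilon> k l) = N2_coeffs \<omega> \<and> norm (K \<epsilon> k l) \<le> B * norm (N2_coeffs \<omega>) \<and>
     K \<epsilon> l k = swap_coeffs (K \<epsilon> k l) \<and> K \<epsilon> (- k) (- l) = K \<epsilon> k l"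
    if *: "\<epsilon> \<in> {0..e}" "(k, l) \<in> modes" for \<epsilon> k l
  proof (intro conjI)
    have lk: "(l, k) \<in> modes" using * by (auto simp: modes_def)
    show "hom_op \<alpha> (2 * \<omega>\<^sup>2) \<epsilon> k l (K \<epsilon> k l) = N2_coeffs \<omega>" by (rule K[OF *])
    show "norm (K \<epsilon> k l) \<le> B * norm (N2_coeffs \<omega>)"
      using low[OF *, of "K \<epsilon> k l"] by (simp add: K[OF *])
    have "hom_op \<alpha> (2 * \<omega>\<^sup>2) \<epsilon> l k (K \<epsilon> l k) = hom_op \<alpha> (2 * \<omega>\<^sup>2) \<epsilon> l k (swap_coeffs (K \<epsilon> k l))"
      unfolding hom_op_swap K[OF *] K[OF *(1) lk] by (simp add: N2_coeffs_def swap_coeffs_def)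
    then show "K \<epsilon> l k = swap_coeffs (K \<epsilon> k l)"
      using inj[OF *(1) lk] by (simp add: inj_eq)
    show "K \<epsilon> (- k) (- l) = K \<epsilon> k l"
      by (simp add: K_def hom_op_minus)
  qed
  then show ?thesis using e(1) by (intro exI[of _ e] conjI exI[of _ "B * norm (N2_coeffs \<omega>)"] exI[of _ K]) auto
qed

section \<open>Weighted square-summable sequences\<close>

text \<open>The exponent is s/2, so that the Sobolev norm is a plain l2 norm of
  \<open>weight s k * a k\<close> and the Minkowski and Cauchy-Schwarz inequalities for
  \<open>L2_set\<close> apply.\<close>

definition weight :: "real \<Rightarrow> int \<Rightarrow> real" where
  "weight s k = (1 + (of_int k)\<^sup>2) powr (s / 2)"

definition hseq :: "real \<Rightarrow> (int \<Rightarrow> complex) \<Rightarrow> bool" where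
  "hseq s a \<longleftrightarrow> (\<lambda>k. (1 + (of_int k)\<^sup>2) powr s * (cmod (a k))\<^sup>2) summable_on UNIV"

definition hnorm :: "real \<Rightarrow> (int \<Rightarrow> complex) \<Rightarrow> real" where
  "hnorm s a = sqrt (\<Sum>\<^sub>\<infinity>k. (1 + (of_int k)\<^sup>2) powr s * (cmod (a k))\<^sup>2)"

abbreviation L2w :: "real \<Rightarrow> (int \<Rightarrow> complex) \<Rightarrow> int set \<Rightarrow> real" where
  "L2w s a M \<equiv> L2_set (\<lambda>k. weight s k * cmod (a k)) M"

lemma weight_pos [simp]: "weight s k > 0" "weight s k \<ge> 0" "weight s k \<noteq> 0"
proof -
  have "1 + (real_of_int k)\<^sup>2 > 0" by (smt (verit) zero_le_power2)
  then show "weight s k > 0" by (simp add: weight_def)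
  then show "weight s k \<ge> 0" "weight s k \<noteq> 0" by auto
qed

lemma weight_1: "weight 1 k = sqrt (1 + (of_int k)\<^sup>2)"
  by (simp add: weight_def powr_half_sqrt)

lemma weight_mono: "s \<le> t \<Longrightarrow> weight s k \<le> weight t k"
  by (simp add: weight_def powr_mono)

lemma weight_ge_1: "s \<ge> 0 \<Longrightarrow> 1 \<le> weight s k"
  using weight_mono[of 0 s k] by (simp add: weight_def add_nonneg_eq_0_iff)

lemma weight_sq: "(1 + (of_int k)\<^sup>2) powr s * x\<^sup>2 = (weight s k * x)\<^sup>2"
  by (simp add: weight_def power_mult_distrib power2_eq_square[of "_ powr _"] flip: powr_add)

lemma sum_weight_sq:
  "(\<Sum>k\<in>M. (1 + (of_int k)\<^sup>2) powr s * (cmod (a k))\<^sup>2) = (L2w s a M)\<^sup>2"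
  by (simp add: L2_set_def weight_sq sum_nonneg)

lemma hnorm_nonneg [simp]: "hnorm s a \<ge> 0"
  by (simp add: hnorm_def infsum_nonneg)

lemma L2w_le_hnorm:
  assumes "hseq s a"
  shows "L2w s a M \<le> hnorm s a"
proof (cases "finite M")
  case True
  have "(L2w s a M)\<^sup>2 \<le> (\<Sum>\<^sub>\<infinity>k. (1 + (of_int k)\<^sup>2) powr s * (cmod (a k))\<^sup>2)"
    unfolding sum_weight_sq[symmetric] using assms True
    by (intro finite_sum_le_infsum) (auto simp: hseq_def)
  then show ?thesis
    unfolding hnorm_def by (rule real_le_rsqrt)
qed auto

text \<open>Partial sums of nonnegative terms control both summability and the norm, so sums and
  quadratic forms need to be estimated on finite sets of modes only.\<close>

lemma hseqI:
  assumes "\<And>M. finite M \<Longrightarrow> L2w s a M \<le> B"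
  shows "hseq s a" "hnorm s a \<le> B"
proof -
  have B: "0 \<le> B" using assms[of "{}"] by simp
  have sq: "(\<Sum>k\<in>M. (1 + (of_int k)\<^sup>2) powr s * (cmod (a k))\<^sup>2) \<le> B\<^sup>2" if "finite M" for M
    unfolding sum_weight_sq using assms[OF that] by (intro power_mono) auto
  show "hseq s a"
    unfolding hseq_def using sq by (intro nonneg_bdd_above_summable_on bdd_aboveI2[where M = "B\<^sup>2"]) auto
  then have "(\<Sum>\<^sub>\<infinity>k. (1 + (of_int k)\<^sup>2) powr s * (cmod (a k))\<^sup>2) \<le> B\<^sup>2"
    using sq by (intro infsum_le_finite_sums) (auto simp: hseq_def)
  then show "hnorm s a \<le> B"
    unfolding hnorm_def using B by (simp add: real_le_lsqrt)
qed

lemma L2w_add: "L2w s (\<lambda>k. a k + b k) M \<le> L2w s a M + L2w s b M"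
proof -
  have "L2w s (\<lambda>k. a k + b k) M \<le> L2_set (\<lambda>k. weight s k * cmod (a k) + weight s k * cmod (b k)) M"
    by (intro L2_set_mono) (auto simp: norm_triangle_ineq simp flip: distrib_left)
  also have "\<dots> \<le> L2w s a M + L2w s b M" by (rule L2_set_triangle_ineq)
  finally show ?thesis .
qed

lemma hseq_add:
  assumes "hseq s a" "hseq s b"
  shows "hseq s (\<lambda>k. a k + b k)" "hnorm s (\<lambda>k. a k + b k) \<le> hnorm s a + hnorm s b"
proof -
  have *: "L2w s (\<lambda>k. a k + b k) M \<le> hnorm s a + hnorm s b" for M
    using L2w_add[of s a b M] L2w_le_hnorm[OF assms(1), of M] L2w_le_hnorm[OF assms(2), of M] by linarith
  show "hseq s (\<lambda>k. a k + b k)" "hnorm s (\<lambda>k. a k + b k) \<le> hnorm s a + hnorm s b"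
    using hseqI[OF *] by auto
qed

lemma hseq_minus:
  assumes "hseq s a"
  shows "hseq s (\<lambda>k. - a k)" "hnorm s (\<lambda>k. - a k) = hnorm s a"
  using assms by (simp_all add: hseq_def hnorm_def)

lemma hseq_diff:
  assumes "hseq s a" "hseq s b"
  shows "hseq s (\<lambda>k. a k - b k)" "hnorm s (\<lambda>k. a k - b k) \<le> hnorm s a + hnorm s b"
  using hseq_add[OF assms(1) hseq_minus(1)[OF assms(2)]] hseq_minus(2)[OF assms(2)] by auto

lemma hseq_0 [simp]: "hseq s (\<lambda>_. 0)" "hnorm s (\<lambda>_. 0) = 0"
  by (simp_all add: hseq_def hnorm_def)

lemma hnorm_eq_0D:
  assumes "hseq s a" "hnorm s a \<le> 0"
  shows "a k = 0"
proof -
  have "weight s k * cmod (a k) \<le> 0"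
    using L2w_le_hnorm[OF assms(1), of "{k}"] assms(2) by simp
  then show ?thesis using weight_pos(1)[of s k] by (auto simp: mult_le_0_iff)
qed

section \<open>Embedding of the weighted l2 space into l1 for s \<ge> 1\<close>

lemma summable_inverse_sq_int: "(\<lambda>k::int. inverse (1 + (of_int k)\<^sup>2) :: real) summable_on UNIV"
proof -
  have nat: "(\<lambda>n::nat. inverse (1 + (real n)\<^sup>2)) summable_on UNIV"
  proof (rule summable_nonneg_imp_summable_on)
    show "summable (\<lambda>n::nat. inverse (1 + (real n)\<^sup>2))"
    proof (rule summable_comparison_test')
      show "summable (\<lambda>n. inverse ((real n)^2))"
        using inverse_power_summable[of 2, where 'a = real] by simp
      show "norm (inverse (1 + (real n)\<^sup>2)) \<le> inverse ((real n)\<^sup>2)" if "n \<ge> 1" for n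
        using that by (auto intro!: le_imp_inverse_le simp: add_pos_nonneg)
    qed
  qed (auto simp: add_nonneg_nonneg)
  have 1: "(\<lambda>k::int. inverse (1 + (of_int k)\<^sup>2) :: real) summable_on range int"
    by (subst summable_on_reindex) (use nat in \<open>auto simp: o_def\<close>)
  have 2: "(\<lambda>k::int. inverse (1 + (of_int k)\<^sup>2) :: real) summable_on range (\<lambda>n. - int n)"
    by (subst summable_on_reindex) (use nat in \<open>auto simp: o_def inj_on_def\<close>)
  have "range int \<union> range (\<lambda>n. - int n) = UNIV"
    by (auto simp: image_iff) (metis int_cases2)
  then show ?thesis
    using summable_on_union[OF 1 2] by simp
qed

definition emb_const :: real where
  "emb_const = sqrt (\<Sum>\<^sub>\<infinity>k::int. inverse (1 + (of_int k)\<^sup>2))"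

lemma emb_const_nonneg [simp]: "emb_const \<ge> 0"
  by (simp add: emb_const_def infsum_nonneg)

text \<open>Cauchy-Schwarz against 1 / \<open>weight 1 k\<close>, whose squares 1 / (1 + k^2) are
  summable; s \<ge> 1 lets \<open>weight s\<close> dominate \<open>weight 1\<close>.\<close>

lemma sum_cmod_le_L2w:
  assumes "s \<ge> 1"
  shows "(\<Sum>k\<in>M. cmod (a k)) \<le> emb_const * L2w s a M"
proof (cases "finite M")
  case True
  have *: "cmod (a k) \<le> \<bar>inverse (weight 1 k)\<bar> * \<bar>weight s k * cmod (a k)\<bar>" for k
  proof -
    have "cmod (a k) = inverse (weight 1 k) * (weight 1 k * cmod (a k))" by simp
    also have "\<dots> \<le> inverse (weight 1 k) * (weight s k * cmod (a k))"
      using weight_mono[OF assms, of k] by (intro mult_left_mono mult_right_mono) (simp_all add: less_imp_le)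
    finally show ?thesis by (simp add: abs_mult)
  qed
  have "(\<Sum>k\<in>M. cmod (a k)) \<le> (\<Sum>k\<in>M. \<bar>inverse (weight 1 k)\<bar> * \<bar>weight s k * cmod (a k)\<bar>)"
    using * by (intro sum_mono) auto
  also have "\<dots> \<le> L2_set (\<lambda>k. inverse (weight 1 k)) M * L2w s a M"
    by (rule L2_set_mult_ineq)
  also have "\<dots> \<le> emb_const * L2w s a M"
  proof (rule mult_right_mono)
    have "(\<Sum>k\<in>M. (inverse (weight 1 k))\<^sup>2) = (\<Sum>k\<in>M. inverse (1 + (of_int k)\<^sup>2))"
      by (simp add: weight_1 power_inverse add_nonneg_nonneg)
    also have "\<dots> \<le> (\<Sum>\<^sub>\<infinity>k::int. inverse (1 + (of_int k)\<^sup>2))"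
      using True summable_inverse_sq_int by (intro finite_sum_le_infsum) (auto simp: add_nonneg_nonneg)
    finally show "L2_set (\<lambda>k. inverse (weight 1 k)) M \<le> emb_const"
      by (simp add: L2_set_def emb_const_def)
  qed auto
  finally show ?thesis .
qed auto

lemma sum_cmod_le_hnorm:
  assumes "s \<ge> 1" "hseq s a"
  shows "(\<Sum>k\<in>M. cmod (a k)) \<le> emb_const * hnorm s a"
  using sum_cmod_le_L2w[OF assms(1), of a M] L2w_le_hnorm[OF assms(2), of M]
  by (meson emb_const_nonneg mult_left_mono order_trans)

lemma hseq_abs_summable:
  assumes "s \<ge> 1" "hseq s a"
  shows "(\<lambda>k. cmod (a k)) summable_on UNIV"
  using sum_cmod_le_hnorm[OF assms]
  by (intro nonneg_bdd_above_summable_on bdd_aboveI2[where M = "emb_const * hnorm s a"]) auto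

subsection \<open>Convolution\<close>

text \<open>The larger of k^2 and l^2 satisfies 1 + (k+l)^2 \<le> 4 (1 + max). The power s/2 turns 4
  into 2^s, and the sum of both weights covers either case.\<close>

lemma weight_add_le: "s \<ge> 0 \<Longrightarrow> weight s (k + l) \<le> 2 powr s * (weight s k + weight s l)"
proof -
  assume s: "s \<ge> 0"
  have *: "weight s (k + l) \<le> 2 powr s * weight s j"
    if "1 + (of_int (k + l))\<^sup>2 \<le> 4 * (1 + (real_of_int j)\<^sup>2)" for j
  proof -
    have "weight s (k + l) \<le> (4 * (1 + (real_of_int j)\<^sup>2)) powr (s / 2)"
      unfolding weight_def using that s by (intro powr_mono2) auto
    also have "\<dots> = 4 powr (s / 2) * weight s j"
      by (subst powr_mult) (auto simp: weight_def add_nonneg_nonneg)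
    also have "(4::real) powr (s / 2) = (2 powr 2) powr (s / 2)" by simp
    also have "\<dots> = 2 powr s" unfolding powr_powr by simp
    finally show ?thesis .
  qed
  have sq: "(of_int (k + l))\<^sup>2 \<le> 2 * (of_int k)\<^sup>2 + 2 * (real_of_int l)\<^sup>2"
    using sum_squares_bound[of "real_of_int k" "of_int l"] by (simp add: power2_eq_square algebra_simps)
  have gen: "1 + x \<le> 4 * (1 + y)" if "x \<le> 2 * a + 2 * b" "a \<le> y" "b \<le> y" for x a b y :: real
    using that by simp
  show ?thesis
  proof (cases "(of_int k)\<^sup>2 \<le> (real_of_int l)\<^sup>2")
    case True
    then have "weight s (k + l) \<le> 2 powr s * weight s l" by (intro * gen[OF sq]) auto
    then show ?thesis by (simp add: distrib_left add_increasing)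
  next
    case False
    then have "weight s (k + l) \<le> 2 powr s * weight s k" by (intro * gen[OF sq]) auto
    then show ?thesis by (simp add: distrib_left add_increasing2)
  qed
qed

lemma L2_set_sum_le: "finite F \<Longrightarrow> L2_set (\<lambda>m. \<Sum>k\<in>F. g k m) M \<le> (\<Sum>k\<in>F. L2_set (g k) M)"
proof (induction F rule: finite_induct)
  case (insert k F)
  then show ?case
    using L2_set_triangle_ineq[of "g k" "\<lambda>m. \<Sum>k\<in>F. g k m" M] by simp
qed (simp add: L2_set_0')

text \<open>Young's inequality for l1 * l2: Minkowski in m moves the norm inside the sum over k,
  each translate of b costs at most its full norm, and the embedding sums |a k|.\<close>

lemma conv_half_bound:
  assumes s: "s \<ge> 1" and a: "hseq s a" and b: "hseq s b" and fin: "finite F"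
  shows "L2_set (\<lambda>m. \<Sum>k\<in>F. cmod (a k) * (weight s (m - k) * cmod (b (m - k)))) M
    \<le> emb_const * hnorm s a * hnorm s b"
proof -
  have "L2_set (\<lambda>m. \<Sum>k\<in>F. cmod (a k) * (weight s (m - k) * cmod (b (m - k)))) M
    \<le> (\<Sum>k\<in>F. L2_set (\<lambda>m. cmod (a k) * (weight s (m - k) * cmod (b (m - k)))) M)"
    by (rule L2_set_sum_le[OF fin])
  also have "\<dots> = (\<Sum>k\<in>F. cmod (a k) * L2w s b ((\<lambda>m. m - k) ` M))"
    by (simp add: L2_set_right_distrib[symmetric]) (simp add: L2_set_def sum.reindex inj_on_def)
  also have "\<dots> \<le> (\<Sum>k\<in>F. cmod (a k) * hnorm s b)"
    using L2w_le_hnorm[OF b] by (intro sum_mono mult_left_mono) auto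
  also have "\<dots> \<le> (emb_const * hnorm s a) * hnorm s b"
    unfolding sum_distrib_right[symmetric]
    using sum_cmod_le_hnorm[OF s a] by (intro mult_right_mono) auto
  finally show ?thesis .
qed

definition conv_const :: "real \<Rightarrow> real" where
  "conv_const s = 2 powr s * (2 * emb_const)"

lemma conv_const_nonneg [simp]: "conv_const s \<ge> 0"
  by (simp add: conv_const_def)

lemma conv_finite_bound:
  assumes s: "s \<ge> 1" and a: "hseq s a" and b: "hseq s b" and fin: "finite F" "finite M"
  shows "L2_set (\<lambda>m. weight s m * (\<Sum>k\<in>F. cmod (a k) * cmod (b (m - k)))) M
    \<le> conv_const s * hnorm s a * hnorm s b"
proof -
  \<comment> \<open>When the weight falls on the first factor, k is replaced by m - k to exchange
    the roles. The new index set m - F depends on m; \<open>G\<close> contains all of them, so that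
    one finite set serves the whole of M.\<close>
  define G where "G = (\<lambda>(m, k). m - k) ` (M \<times> F)"
  have finG: "finite G" using fin by (simp add: G_def)
  define f where "f m = (\<Sum>k\<in>F. cmod (a k) * (weight s (m - k) * cmod (b (m - k))))" for m
  define g where "g m = (\<Sum>k\<in>G. cmod (b k) * (weight s (m - k) * cmod (a (m - k))))" for m
  have "weight s m * (\<Sum>k\<in>F. cmod (a k) * cmod (b (m - k))) \<le> 2 powr s * (f m + g m)" if m: "m \<in> M" for m
  proof -
    have "weight s m * (\<Sum>k\<in>F. cmod (a k) * cmod (b (m - k)))
      \<le> (\<Sum>k\<in>F. (2 powr s * (weight s k + weight s (m - k))) * (cmod (a k) * cmod (b (m - k))))"
      unfolding sum_distrib_left
      using weight_add_le[of s k "m - k" for k] s by (intro sum_mono mult_right_mono) auto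
    also have "\<dots> = 2 powr s * (f m + (\<Sum>k\<in>F. cmod (b (m - k)) * (weight s k * cmod (a k))))"
      by (simp add: f_def sum_distrib_left distrib_left algebra_simps sum.distrib)
    also have "(\<Sum>k\<in>F. cmod (b (m - k)) * (weight s k * cmod (a k)))
        = (\<Sum>k\<in>(\<lambda>k. m - k) ` F. cmod (b k) * (weight s (m - k) * cmod (a (m - k))))"
      by (subst sum.reindex) (auto simp: inj_on_def)
    also have "\<dots> \<le> g m"
      unfolding g_def using m by (intro sum_mono2 finG) (auto simp: G_def)
    finally show ?thesis by (simp add: mult_left_mono)
  qed
  then have "L2_set (\<lambda>m. weight s m * (\<Sum>k\<in>F. cmod (a k) * cmod (b (m - k)))) M
     \<le> L2_set (\<lambda>m. 2 powr s * (f m + g m)) M"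
    by (intro L2_set_mono) (auto intro!: mult_nonneg_nonneg sum_nonneg)
  also have "\<dots> = 2 powr s * L2_set (\<lambda>m. f m + g m) M"
    by (simp add: L2_set_right_distrib)
  also have "\<dots> \<le> 2 powr s * (L2_set f M + L2_set g M)"
    by (intro mult_left_mono L2_set_triangle_ineq) auto
  also have "\<dots> \<le> 2 powr s * (emb_const * hnorm s a * hnorm s b + emb_const * hnorm s b * hnorm s a)"
    using conv_half_bound[OF s a b fin(1), of M] conv_half_bound[OF s b a finG, of M]
    unfolding f_def g_def by (intro mult_left_mono add_mono) auto
  also have "\<dots> = conv_const s * hnorm s a * hnorm s b"
    by (simp add: conv_const_def algebra_simps)
  finally show ?thesis .
qed

definition abs_conv :: "(int \<Rightarrow> complex) \<Rightarrow> (int \<Rightarrow> complex) \<Rightarrow> int \<Rightarrow> real" where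
  "abs_conv a b m = (\<Sum>\<^sub>\<infinity>k. cmod (a k) * cmod (b (m - k)))"

lemma abs_conv_summable:
  assumes s: "s \<ge> 1" and a: "hseq s a" and b: "hseq s b"
  shows "(\<lambda>k. cmod (a k) * cmod (b (m - k))) summable_on UNIV"
proof (intro nonneg_bdd_above_summable_on bdd_aboveI2)
  fix F :: "int set" assume "F \<in> {F. F \<subseteq> UNIV \<and> finite F}"
  then have "weight s m * (\<Sum>k\<in>F. cmod (a k) * cmod (b (m - k))) \<le> conv_const s * hnorm s a * hnorm s b"
    using conv_finite_bound[OF s a b, of F "{m}"] by (simp add: sum_nonneg)
  moreover have "1 * (\<Sum>k\<in>F. cmod (a k) * cmod (b (m - k))) \<le> weight s m * (\<Sum>k\<in>F. cmod (a k) * cmod (b (m - k)))"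
    using weight_ge_1[of s m] s by (intro mult_right_mono) (auto intro: sum_nonneg)
  ultimately show "(\<Sum>k\<in>F. cmod (a k) * cmod (b (m - k))) \<le> conv_const s * hnorm s a * hnorm s b"
    by linarith
qed auto

text \<open>With M fixed and finite, the left side depends continuously on finitely many inner sums,
  so the bound passes to the limit as F exhausts the integers.\<close>

lemma abs_conv_bound:
  assumes s: "s \<ge> 1" and a: "hseq s a" and b: "hseq s b" and M: "finite M"
  shows "L2_set (\<lambda>m. weight s m * abs_conv a b m) M \<le> conv_const s * hnorm s a * hnorm s b"
proof (rule tendsto_upperbound)
  show "((\<lambda>F. L2_set (\<lambda>m. weight s m * (\<Sum>k\<in>F. cmod (a k) * cmod (b (m - k)))) M)
    \<longlongrightarrow> L2_set (\<lambda>m. weight s m * abs_conv a b m) M) (finite_subsets_at_top UNIV)"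
    unfolding L2_set_def abs_conv_def
    by (intro tendsto_intros infsum_tendsto abs_conv_summable[OF s a b])
  show "\<forall>\<^sub>F F in finite_subsets_at_top UNIV. L2_set (\<lambda>m. weight s m * (\<Sum>k\<in>F. cmod (a k) * cmod (b (m - k)))) M
     \<le> conv_const s * hnorm s a * hnorm s b"
    using conv_finite_bound[OF s a b _ M]
    by (auto simp: eventually_finite_subsets_at_top)
qed auto

section \<open>Fourier coefficients\<close>

text \<open>One period as a finite measure space: bounded measurable functions are integrable, and
  \<open>mean\<close> becomes an ordinary integral.\<close>

definition circ :: "real measure" where
  "circ = restrict_space lborel {0..2*pi}"

lemma space_circ: "space circ = {0..2*pi}"
  by (simp add: circ_def)

lemma measurable_circ: "f \<in> borel_measurable borel \<Longrightarrow> f \<in> borel_measurable circ"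
  unfolding circ_def by (rule measurable_restrict_space1) simp

lemma set_integrable_circ:
  fixes f :: "real \<Rightarrow> 'a :: {banach, second_countable_topology}"
  shows "set_integrable lborel {0..2*pi} f \<longleftrightarrow> integrable circ f"
  unfolding circ_def by (rule set_integrable_eq) simp

lemma mean_circ: "mean u = (\<integral>x. u x \<partial>circ) / (2 * pi)"
  unfolding mean_def circ_def set_lebesgue_integral_def by (subst integral_restrict_space) auto

lemma fourier_circ: "fourier u k = (\<integral>x. u x * cis (- (of_int k * x)) \<partial>circ) / (2 * pi)"
  by (simp add: fourier_def mean_circ)

lemma finite_measure_circ: "finite_measure circ"
  unfolding circ_def by (intro finite_measure_restrict_space finite_measureI) (auto simp: emeasure_restrict_space)

lemma measure_circ: "measure circ (space circ) = 2 * pi"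
  by (simp add: circ_def space_circ measure_restrict_space)

lemma integrable_circ_bounded:
  fixes u :: "real \<Rightarrow> 'a :: {banach, second_countable_topology}"
  assumes "u \<in> borel_measurable circ" "\<And>x. norm (u x) \<le> B"
  shows "integrable circ u"
  using finite_measure.integrable_const_bound[OF finite_measure_circ, of u B] assms by simp

lemma borel_measurable_cis [measurable]: "(\<lambda>x. cis (c * x)) \<in> borel_measurable borel"
  by (intro borel_measurable_continuous_onI continuous_intros)

lemma integrable_circ_mult:
  fixes u g :: "real \<Rightarrow> complex"
  assumes "integrable circ u" "g \<in> borel_measurable borel" "\<And>x. cmod (g x) \<le> B"
  shows "integrable circ (\<lambda>x. u x * g x)"
proof (rule Bochner_Integration.integrable_bound)
  show "integrable circ (\<lambda>x. of_real B * u x)" using assms(1) by simp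
  show "(\<lambda>x. u x * g x) \<in> borel_measurable circ"
    using borel_measurable_integrable[OF assms(1)] measurable_circ[OF assms(2)] by (rule borel_measurable_times)
  have "cmod (u x * g x) \<le> cmod (of_real B * u x)" for x
    using assms(3)[of x] mult_left_mono[of "cmod (g x)" "\<bar>B\<bar>" "cmod (u x)"]
    by (simp add: norm_mult mult.commute)
  then show "AE x in circ. norm (u x * g x) \<le> norm (of_real B * u x)" by simp
qed

lemma integrable_circ_cis:
  fixes u :: "real \<Rightarrow> complex"
  shows "integrable circ u \<Longrightarrow> integrable circ (\<lambda>x. u x * cis (c * x))"
  by (rule integrable_circ_mult[where B = 1]) auto

lemma integrable_circ_cis':
  fixes u :: "real \<Rightarrow> complex"
  shows "integrable circ u \<Longrightarrow> integrable circ (\<lambda>x. u x * cis (- (c * x)))"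
  using integrable_circ_cis[of u "- c"] by simp

lemma fourier_add:
  assumes "integrable circ u" "integrable circ v"
  shows "fourier (\<lambda>x. u x + v x) k = fourier u k + fourier v k"
  using assms by (simp add: fourier_circ distrib_right integrable_circ_cis' add_divide_distrib)

lemma fourier_diff:
  assumes "integrable circ u" "integrable circ v"
  shows "fourier (\<lambda>x. u x - v x) k = fourier u k - fourier v k"
  using assms by (simp add: fourier_circ left_diff_distrib integrable_circ_cis' diff_divide_distrib)

lemma fourier_cmult: "fourier (\<lambda>x. c * u x) k = c * fourier u k"
  by (simp add: fourier_circ mult.assoc)

lemma fourier_cis_shift: "fourier (\<lambda>x. u x * cis (of_int j * x)) k = fourier u (k - j)"
  by (simp add: fourier_circ mult.assoc cis_mult algebra_simps)

lemma fourier_cong_AE: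
  assumes "u \<in> borel_measurable circ" "v \<in> borel_measurable circ" "AE x in circ. u x = v x"
  shows "fourier u k = fourier v k"
proof -
  have "(\<lambda>x. cis (- (of_int k * x))) \<in> borel_measurable circ"
    using measurable_circ[OF borel_measurable_cis[of "- of_int k"]] by simp
  then have "(\<integral>x. u x * cis (- (of_int k * x)) \<partial>circ) = (\<integral>x. v x * cis (- (of_int k * x)) \<partial>circ)"
    using assms by (intro integral_cong_AE) (auto intro!: borel_measurable_times)
  then show ?thesis by (simp add: fourier_circ)
qed

lemma fourier_const: "fourier (\<lambda>x. c) k = (if k = 0 then c else 0)"
proof (cases "k = 0")
  case True
  then show ?thesis by (simp add: fourier_circ measure_circ scaleR_conv_of_real)
next
  case False
  \<comment> \<open>An antiderivative of e^(-ikx); being periodic, it takes equal values at both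
    ends.\<close>
  define F where "F x = \<i> / of_int k * cis (- (of_int k * x))" for x
  have "((\<lambda>z. \<i> / of_int k * exp (- (\<i> * of_int k * z))) has_field_derivative
      exp (- (\<i> * of_int k * of_real x))) (at (of_real x))" for x
    using False by (auto intro!: derivative_eq_intros simp: field_simps)
  from has_vector_derivative_real_field[OF this]
  have "(F has_vector_derivative cis (- (of_int k * x))) (at x within {0..2*pi})" for x
    by (simp add: F_def[abs_def] cis_conv_exp mult_ac)
  then have "(\<integral>x. indicator {0..2*pi} x *\<^sub>R cis (- (of_int k * x)) \<partial>lborel) = F (2 * pi) - F 0"
    by (intro integral_FTC_Icc continuous_intros) auto
  also have "F (2 * pi) = F 0"
    using cis_multiple_2pi[of "- of_int k"] by (simp add: F_def mult_ac)
  finally have "(\<integral>x. cis (- (of_int k * x)) \<partial>circ) = 0"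
    unfolding circ_def by (subst integral_restrict_space) auto
  then show ?thesis using False by (simp add: fourier_circ)
qed

lemma fourier_cis: "fourier (\<lambda>x. c * cis (of_int j * x)) k = (if j = k then c else 0)"
  using fourier_cis_shift[of "\<lambda>_. c" j k] by (auto simp: fourier_const)

lemma integral_norm_le:
  fixes f :: "'a \<Rightarrow> 'b :: {banach, second_countable_topology}"
  assumes "integrable M f" "integrable M g" "\<And>x. norm (f x) \<le> g x"
  shows "norm (integral\<^sup>L M f) \<le> integral\<^sup>L M g"
proof -
  have "norm (integral\<^sup>L M f) \<le> (\<integral>x. norm (f x) \<partial>M)" by (rule integral_norm_bound)
  also have "\<dots> \<le> integral\<^sup>L M g" using assms by (intro Bochner_Integration.integral_mono) auto
  finally show ?thesis .
qed

lemma cmod_fourier_le: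
  assumes "u \<in> borel_measurable circ" "\<And>x. cmod (u x) \<le> B"
  shows "cmod (fourier u k) \<le> B"
proof -
  have u: "integrable circ u" using assms by (rule integrable_circ_bounded)
  have "cmod (\<integral>x. u x * cis (- (of_int k * x)) \<partial>circ) \<le> (\<integral>x. B \<partial>circ)"
    using assms(2) u by (intro integral_norm_le integrable_circ_cis')
      (auto simp: norm_mult finite_measure.integrable_const[OF finite_measure_circ])
  then show ?thesis
    by (simp add: fourier_circ measure_circ norm_divide field_simps)
qed

subsection \<open>Absolutely convergent trigonometric series\<close>

text \<open>A general index set with a frequency map covers both the Fourier series of a function
  and the double series of K, where the pair (k, l) has frequency k + l.\<close>

definition trig_series :: "'a set \<Rightarrow> ('a \<Rightarrow> int) \<Rightarrow> ('a \<Rightarrow> complex) \<Rightarrow> real \<Rightarrow> complex" where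
  "trig_series A \<phi> c x = (\<Sum>\<^sub>\<infinity>p\<in>A. c p * cis (of_int (\<phi> p) * x))"

context
  fixes A :: "'a set" and \<phi> :: "'a \<Rightarrow> int" and c :: "'a \<Rightarrow> complex"
  assumes summable: "(\<lambda>p. cmod (c p)) summable_on A"
begin

lemma trig_series_summable: "(\<lambda>p. cmod (c p * cis (of_int (\<phi> p) * x))) summable_on A"
  using summable by (simp add: norm_mult)

lemma trig_series_uniform_limit:
  "uniform_limit UNIV (\<lambda>F x. \<Sum>p\<in>F. c p * cis (of_int (\<phi> p) * x)) (trig_series A \<phi> c) (finite_subsets_at_top A)"
  unfolding trig_series_def[abs_def]
  using summable by (intro Weierstrass_m_test_general) (auto simp: norm_mult)

lemma continuous_trig_series: "continuous_on UNIV (trig_series A \<phi> c)"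
  by (rule uniform_limit_theorem[OF _ trig_series_uniform_limit])
     (auto intro!: always_eventually continuous_intros)

lemma measurable_trig_series: "trig_series A \<phi> c \<in> borel_measurable borel"
  using continuous_trig_series by (rule borel_measurable_continuous_onI)

lemma trig_series_bound: "cmod (trig_series A \<phi> c x) \<le> (\<Sum>\<^sub>\<infinity>p\<in>A. cmod (c p))"
  using norm_infsum_bound[OF trig_series_summable, of x] by (simp add: trig_series_def norm_mult)

lemma integrable_trig_series: "integrable circ (trig_series A \<phi> c)"
  by (rule integrable_circ_bounded[OF measurable_circ[OF measurable_trig_series] trig_series_bound])

text \<open>Partial sums have the expected coefficients by orthogonality. They converge uniformly,
  and a coefficient is bounded by the supremum of the function, so their coefficients converge
  too.\<close>

lemma fourier_trig_series: "fourier (trig_series A \<phi> c) k = (\<Sum>\<^sub>\<infinity>p\<in>{p\<in>A. \<phi> p = k}. c p)"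
proof -
  have "((\<lambda>p. if \<phi> p = k then c p else 0) has_sum fourier (trig_series A \<phi> c) k) A"
    unfolding has_sum_def
  proof (rule tendstoI)
    fix e :: real assume e: "e > 0"
    have "eventually (\<lambda>F. \<forall>x\<in>UNIV. dist (\<Sum>p\<in>F. c p * cis (of_int (\<phi> p) * x)) (trig_series A \<phi> c x) < e / 2)
        (finite_subsets_at_top A)"
      using e by (intro uniform_limitD[OF trig_series_uniform_limit]) simp
    then show "eventually (\<lambda>F. dist (\<Sum>p\<in>F. if \<phi> p = k then c p else 0) (fourier (trig_series A \<phi> c) k) < e)
        (finite_subsets_at_top A)"
    proof (rule eventually_mono[OF eventually_conj[OF _ eventually_finite_subsets_at_top_weakI]])
      fix F :: "'a set"
      assume "(\<forall>x\<in>UNIV. dist (\<Sum>p\<in>F. c p * cis (of_int (\<phi> p) * x)) (trig_series A \<phi> c x) < e / 2) \<and> finite F"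
      then have close: "\<And>x. cmod ((\<Sum>p\<in>F. c p * cis (of_int (\<phi> p) * x)) - trig_series A \<phi> c x) \<le> e / 2"
        and F: "finite F" by (auto simp: dist_norm less_imp_le)
      have int: "integrable circ (\<lambda>x. c p * cis (of_int (\<phi> p) * x))" for p
        by (rule integrable_circ_cis) (simp add: finite_measure.integrable_const[OF finite_measure_circ])
      have int_sum: "integrable circ (\<lambda>x. \<Sum>p\<in>G. c p * cis (of_int (\<phi> p) * x))" for G
        by (intro Bochner_Integration.integrable_sum int)
      have "fourier (\<lambda>x. \<Sum>p\<in>F. c p * cis (of_int (\<phi> p) * x)) k = (\<Sum>p\<in>F. if \<phi> p = k then c p else 0)"
        using F
      proof (induction F rule: finite_induct)
        case (insert p G)
        then show ?case by (simp add: fourier_add int int_sum fourier_cis)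
      qed (simp add: fourier_const)
      moreover have "cmod (fourier (\<lambda>x. (\<Sum>p\<in>F. c p * cis (of_int (\<phi> p) * x)) - trig_series A \<phi> c x) k) \<le> e / 2"
        using int_sum[of F] integrable_trig_series
        by (intro cmod_fourier_le close borel_measurable_diff borel_measurable_integrable)
      ultimately show "dist (\<Sum>p\<in>F. if \<phi> p = k then c p else 0) (fourier (trig_series A \<phi> c) k) < e"
        using e by (simp add: fourier_diff int_sum integrable_trig_series dist_norm)
    qed auto
  qed
  then have "fourier (trig_series A \<phi> c) k = (\<Sum>\<^sub>\<infinity>p\<in>A. if \<phi> p = k then c p else 0)"
    by (simp add: infsumI)
  also have "\<dots> = (\<Sum>\<^sub>\<infinity>p\<in>{p\<in>A. \<phi> p = k}. c p)"
    by (rule infsum_cong_neutral) auto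
  finally show ?thesis .
qed

lemma trig_series_periodic: "trig_series A \<phi> c (x + 2 * pi) = trig_series A \<phi> c x"
proof -
  have "cis (of_int n * (x + 2 * pi)) = cis (of_int n * x)" for n :: int
    using cis_multiple_2pi[of "of_int n"] by (simp add: distrib_left mult_ac flip: cis_mult)
  then show ?thesis by (simp add: trig_series_def)
qed

end

lemma fourier_trig_series_id:
  assumes "(\<lambda>k. cmod (a k)) summable_on UNIV"
  shows "fourier (trig_series UNIV id a) k = a k"
  using fourier_trig_series[OF assms, of id k] by simp

subsection \<open>Fourier coefficients determine an integrable function\<close>

definition null_coeffs :: "(real \<Rightarrow> complex) \<Rightarrow> bool" where
  "null_coeffs h \<longleftrightarrow> integrable circ h \<and> (\<forall>k. fourier h k = 0)"

text \<open>Multiplication by e^(ix) or e^(-ix) merely shifts coefficients, and a real-linear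
  function of \<open>cis x\<close> is a combination of the two. The induction varies
  \<open>h\<close>, so a product of polynomials is two successive multiplications.\<close>

lemma null_coeffs_polynomial:
  assumes "real_polynomial_function q" "null_coeffs h"
  shows "null_coeffs (\<lambda>x. h x * of_real (q (cis x)))"
  using assms
proof (induction arbitrary: h rule: real_polynomial_function.induct)
  case hyp: (linear q)
  interpret bounded_linear q by (rule hyp(1))
  define A B where "A = (of_real (q 1) - \<i> * of_real (q \<i>)) / 2" and "B = (of_real (q 1) + \<i> * of_real (q \<i>)) / 2"
  have "of_real (q (cis x)) = A * cis x + B * cis (- x)" for x
  proof -
    have "cis x = cos x *\<^sub>R 1 + sin x *\<^sub>R \<i>" by (simp add: complex_eq_iff)
    then have "q (cis x) = cos x * q 1 + sin x * q \<i>" by (metis add scaleR real_scaleR_def)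
    then show ?thesis by (simp add: A_def B_def complex_eq_iff field_simps)
  qed
  define E where "E j = (\<lambda>x. h x * cis (of_int j * x))" for j :: int
  have E: "integrable circ (E j)" "fourier (E j) k = 0" for j k
    using hyp(2) unfolding E_def fourier_cis_shift by (simp_all add: null_coeffs_def integrable_circ_cis)
  have eq: "(\<lambda>x. h x * of_real (q (cis x))) = (\<lambda>x. A * E 1 x + B * E (- 1) x)"
    using \<open>\<And>x. of_real (q (cis x)) = A * cis x + B * cis (- x)\<close>
    by (simp add: E_def fun_eq_iff algebra_simps)
  show ?case
    unfolding eq null_coeffs_def by (simp add: fourier_add fourier_cmult E)
next
  case (const c)
  then show ?case
    using fourier_cmult[of "of_real c" h] by (auto simp: null_coeffs_def mult.commute)
next
  case (add p q)
  from add.IH[OF add.prems] show ?case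
    by (auto simp: null_coeffs_def distrib_left fourier_add)
next
  case (mult p q)
  from mult.IH(2)[OF mult.IH(1)[OF mult.prems]] show ?case by (simp add: mult.assoc)
qed

lemma null_coeffs_integral: "null_coeffs h \<Longrightarrow> (\<integral>x. h x \<partial>circ) = 0"
  using fourier_circ[of h 0] by (simp add: null_coeffs_def)

text \<open>Stone-Weierstrass is used on the circle in the plane: composing with \<open>cis\<close>
  makes every test function periodic. The error is at most e times the L1 norm of
  \<open>h\<close>.\<close>

lemma null_coeffs_continuous:
  assumes h: "null_coeffs h" and g: "continuous_on (sphere 0 1) g"
  shows "(\<integral>x. h x * of_real (g (cis x)) \<partial>circ) = 0"
proof -
  have gm: "(\<lambda>x. complex_of_real (g (cis x))) \<in> borel_measurable borel"
    by (intro borel_measurable_continuous_onI continuous_intros continuous_on_compose2[OF g]) auto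
  have int_h: "integrable circ h" using h by (simp add: null_coeffs_def)
  have "compact (g ` sphere 0 1)" using g by (intro compact_continuous_image) auto
  then have "\<exists>G. \<forall>z\<in>sphere 0 1. \<bar>g z\<bar> \<le> G"
    by (auto dest!: compact_imp_bounded simp: bounded_iff)
  then obtain G where G: "\<And>z. z \<in> sphere 0 1 \<Longrightarrow> \<bar>g z\<bar> \<le> G"
    by blast
  have int_hg: "integrable circ (\<lambda>x. h x * of_real (g (cis x)))"
    using G by (intro integrable_circ_mult[OF int_h gm, of G]) auto
  have "cmod (\<integral>x. h x * of_real (g (cis x)) \<partial>circ) \<le> e * (\<integral>x. cmod (h x) \<partial>circ)" if e: "e > 0" for e
  proof -
    obtain q where q: "real_polynomial_function q" "\<And>z. z \<in> sphere 0 1 \<Longrightarrow> \<bar>g z - q z\<bar> < e"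
      by (rule Stone_Weierstrass_real_polynomial_function[of "sphere 0 1" g e]) (use g e in auto)
    have hq: "null_coeffs (\<lambda>x. h x * of_real (q (cis x)))" using null_coeffs_polynomial q(1) h by blast
    then have int_hq: "integrable circ (\<lambda>x. h x * of_real (q (cis x)))" by (simp add: null_coeffs_def)
    have "(\<integral>x. h x * of_real (g (cis x)) \<partial>circ) = (\<integral>x. h x * of_real (g (cis x)) - h x * of_real (q (cis x)) \<partial>circ)"
      using null_coeffs_integral[OF hq] by (simp add: Bochner_Integration.integral_diff[OF int_hg int_hq])
    also have "cmod \<dots> \<le> (\<integral>x. e * cmod (h x) \<partial>circ)"
    proof (rule integral_norm_le)
      show "cmod (h x * of_real (g (cis x)) - h x * of_real (q (cis x))) \<le> e * cmod (h x)" for x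
      proof -
        have "cmod (h x * of_real (g (cis x)) - h x * of_real (q (cis x))) = cmod (h x) * \<bar>g (cis x) - q (cis x)\<bar>"
          by (simp flip: right_diff_distrib of_real_diff add: norm_mult)
        also have "\<dots> \<le> cmod (h x) * e"
          using q(2)[of "cis x"] by (intro mult_left_mono) auto
        finally show ?thesis by (simp add: mult.commute)
      qed
    qed (use int_h int_hg int_hq in auto)
    finally show ?thesis by simp
  qed
  note bound = this
  define I where "I = (\<integral>x. cmod (h x) \<partial>circ)"
  have I: "I \<ge> 0" by (simp add: I_def)
  have "cmod (\<integral>x. h x * of_real (g (cis x)) \<partial>circ) \<le> 0 + e" if "e > 0" for e
  proof -
    have "e / (I + 1) > 0" using that I by simp
    then have "cmod (\<integral>x. h x * of_real (g (cis x)) \<partial>circ) \<le> e / (I + 1) * I"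
      unfolding I_def by (rule bound)
    also have "\<dots> \<le> e" using that I by (simp add: field_simps)
    finally show ?thesis by simp
  qed
  then have "cmod (\<integral>x. h x * of_real (g (cis x)) \<partial>circ) \<le> 0" by (rule field_le_epsilon)
  then show ?thesis by simp
qed

text \<open>On the circle the part of a period up to a is a closed arc, and the indicator of its
  complement is the limit of continuous functions with values in [0, 1]; dominated convergence
  applies with |h|.\<close>

lemma null_coeffs_ray:
  assumes h: "null_coeffs h"
  shows "(\<integral>x. indicator {a<..} x *\<^sub>R h x \<partial>circ) = 0"
proof -
  have int_h: "integrable circ h" using h by (simp add: null_coeffs_def)
  have hm: "h \<in> borel_measurable circ" using int_h by (rule borel_measurable_integrable)
  have ind: "(\<lambda>x. indicator {a<..} x *\<^sub>R h x) \<in> borel_measurable circ"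
    by (intro borel_measurable_scaleR measurable_circ hm) auto
  have AE_ends: "AE x in circ. x \<noteq> 0 \<and> x \<noteq> 2 * pi"
    unfolding circ_def using AE_lborel_singleton[of 0] AE_lborel_singleton[of "2 * pi"]
    by (subst AE_restrict_space_iff) auto
  consider "a < 0" | "0 \<le> a" "a < 2 * pi" | "2 * pi \<le> a" by linarith
  then show ?thesis
  proof cases
    case 1
    have "(\<integral>x. indicator {a<..} x *\<^sub>R h x \<partial>circ) = (\<integral>x. h x \<partial>circ)"
      using 1 by (intro Bochner_Integration.integral_cong) (auto simp: space_circ)
    then show ?thesis using null_coeffs_integral[OF h] by simp
  next
    case 3
    have "(\<integral>x. indicator {a<..} x *\<^sub>R h x \<partial>circ) = (\<integral>x. 0 \<partial>circ)"
      using 3 by (intro Bochner_Integration.integral_cong) (auto simp: space_circ)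
    then show ?thesis by simp
  next
    case 2
    \<comment> \<open>The cut-off n * dist(z, C), capped at 1, vanishes on the arc and is eventually
      1 off it. At 2 pi the limit is wrong, since \<open>cis (2 * pi)\<close> = 1 lies on the arc,
      and this null set is left out.\<close>
    define C where "C = cis ` {0..a}"
    have "compact C" unfolding C_def by (intro compact_continuous_image continuous_intros) auto
    then have C: "closed C" "C \<noteq> {}" using 2 by (auto simp: compact_imp_closed C_def)
    define g where "g n z = min 1 (real n * infdist z C)" for n z
    have cont: "continuous_on S (g n)" for n S
      unfolding g_def by (intro continuous_intros)
    have g01: "0 \<le> g n z" "g n z \<le> 1" for n z by (simp_all add: g_def infdist_nonneg)
    have lim: "(\<lambda>n. g n (cis x)) \<longlonglongrightarrow> indicator {a<..} x" if x: "x \<in> {0..2*pi}" "x \<noteq> 2 * pi" for x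
    proof (cases "x \<le> a")
      case True
      then have "infdist (cis x) C = 0" using x by (intro infdist_zero) (auto simp: C_def)
      then show ?thesis using True by (simp add: g_def)
    next
      case False
      have "cis x \<notin> C"
      proof
        assume "cis x \<in> C"
        then obtain y where y: "0 \<le> y" "y \<le> a" "cis x = cis y" by (auto simp: C_def)
        then have "cis (x - y) = 1" by (simp add: cis_divide[symmetric])
        then have "cos (x - y) = 1" by (simp add: complex_eq_iff)
        then obtain n :: int where n: "x - y = of_int n * 2 * pi" using cos_one_2pi_int[of "x - y"] by auto
        have "x - y = of_int n * (2 * pi)" using n by simp
        moreover have "0 < x - y" "x - y < 1 * (2 * pi)" using y x False by auto
        ultimately have "0 < of_int n * (2 * pi)" "of_int n * (2 * pi) < 1 * (2 * pi)" by auto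
        then have "0 < real_of_int n" "real_of_int n < 1"
          using pi_gt_zero by (auto simp: zero_less_mult_iff mult_less_cancel_right)
        then have "0 < n" "n < 1" by simp_all
        then show False by simp
      qed
      then have pos: "infdist (cis x) C > 0"
        using C by (simp add: infdist_pos_not_in_closed)
      then obtain N :: nat where N: "1 < real N * infdist (cis x) C" using reals_Archimedean3 by blast
      have "eventually (\<lambda>n. g n (cis x) = 1) sequentially"
        using eventually_ge_at_top[of N]
      proof eventually_elim
        case (elim n)
        have "real N * infdist (cis x) C \<le> real n * infdist (cis x) C"
          using elim pos by (intro mult_right_mono) auto
        then show ?case using N by (simp add: g_def)
      qed
      then show ?thesis using False by (simp add: tendsto_eventually)
    qed
    have "(\<lambda>n. \<integral>x. h x * of_real (g n (cis x)) \<partial>circ) \<longlonglongrightarrow> (\<integral>x. indicator {a<..} x *\<^sub>R h x \<partial>circ)"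
    proof (rule integral_dominated_convergence[where w = "\<lambda>x. cmod (h x)"])
      show "(\<lambda>x. h x * of_real (g n (cis x))) \<in> borel_measurable circ" for n
        by (intro borel_measurable_times hm measurable_circ borel_measurable_continuous_onI continuous_intros
            continuous_on_compose2[OF cont]) auto
      show "AE x in circ. (\<lambda>n. h x * of_real (g n (cis x))) \<longlonglongrightarrow> indicator {a<..} x *\<^sub>R h x"
        using AE_ends AE_space
      proof eventually_elim
        case (elim x)
        then have "(\<lambda>n. h x * of_real (g n (cis x))) \<longlonglongrightarrow> h x * of_real (indicator {a<..} x)"
          by (intro tendsto_intros lim) (auto simp: space_circ)
        then show ?case by (simp add: scaleR_conv_of_real mult.commute)
      qed
      show "AE x in circ. cmod (h x * of_real (g n (cis x))) \<le> cmod (h x)" for n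
        using g01 by (auto simp: norm_mult mult_left_le)
    qed (use int_h ind in auto)
    then show ?thesis
      using null_coeffs_continuous[OF h cont] by (simp add: LIMSEQ_const_iff)
  qed
qed

text \<open>Rays form an intersection-stable generator of the Borel sets, so the integral of h
  vanishes over every Borel set, which forces h = 0 almost everywhere.\<close>

lemma null_coeffs_AE:
  assumes h: "null_coeffs h"
  shows "AE x in circ. h x = 0"
proof -
  define H where "H x = indicator {0..2*pi} x *\<^sub>R h x" for x
  have "integrable circ h" using h by (simp add: null_coeffs_def)
  then have int: "integrable lborel H"
    unfolding circ_def H_def[abs_def] by (subst (asm) integrable_restrict_space) auto
  have set_int: "set_integrable lborel A H" if "A \<in> sets borel" for A
    unfolding set_integrable_def using that int by (intro integrable_mult_indicator) auto
  have ray: "set_lebesgue_integral lborel {a<..} H = 0" for a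
  proof -
    have "(\<integral>x. indicator {a<..} x *\<^sub>R h x \<partial>circ) = set_lebesgue_integral lborel {a<..} H"
      unfolding circ_def set_lebesgue_integral_def H_def
      by (subst integral_restrict_space) (auto simp: mult.commute)
    then show ?thesis using null_coeffs_ray[OF h, of a] by simp
  qed
  have total: "set_lebesgue_integral lborel UNIV H = 0"
  proof -
    \<comment> \<open>H lives on [0, 2 pi], so the ray from -1 captures all of it; complements need
      this total.\<close>
    have "set_lebesgue_integral lborel UNIV H = set_lebesgue_integral lborel {-1<..} H"
      unfolding set_lebesgue_integral_def
      by (intro Bochner_Integration.integral_cong) (auto simp: H_def indicator_def)
    then show ?thesis by (simp add: ray)
  qed
  have "set_lebesgue_integral lborel A H = 0" if "A \<in> sets lborel" for A
  proof -
    have "Int_stable (range (greaterThan :: real \<Rightarrow> real set))"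
      by (auto simp: Int_stable_def lessThan_Int_lessThan)
    moreover have "range (greaterThan :: real \<Rightarrow> real set) \<subseteq> Pow UNIV" by simp
    moreover have sets_eq: "sets borel = sigma_sets UNIV (range (greaterThan :: real \<Rightarrow> real set))"
      by (subst borel_Ioi) (simp add: sets_measure_of)
    then have "A \<in> sigma_sets UNIV (range (greaterThan :: real \<Rightarrow> real set))"
      using that by simp
    ultimately show ?thesis
    proof (induction rule: sigma_sets_induct_disjoint)
      case (basic A)
      then show ?case using ray by auto
    next
      case empty
      then show ?case by (simp add: set_lebesgue_integral_def)
    next
      case (compl A)
      then have A: "A \<in> sets borel" by (simp add: sets_eq)
      have "set_lebesgue_integral lborel (A \<union> (UNIV - A)) H
          = set_lebesgue_integral lborel A H + set_lebesgue_integral lborel (UNIV - A) H"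
        using A by (intro set_integral_Un set_int) auto
      moreover have "A \<union> (UNIV - A) = UNIV" by auto
      ultimately show ?case using total compl.IH by simp
    next
      case (union B)
      then have B: "B i \<in> sets borel" for i by (auto simp: sets_eq)
      have "set_lebesgue_integral lborel (\<Union>i. B i) H = (\<Sum>i. set_lebesgue_integral lborel (B i) H)"
        using B union.hyps(1) by (intro lebesgue_integral_countable_add set_int)
          (auto simp: disjoint_family_on_def)
      then show ?case using union.IH by simp
    qed
  qed
  from sigma_finite_measure.density_zero[OF sigma_finite_lborel int this] have "AE x in lborel. H x = 0" .
  then show ?thesis
    unfolding circ_def by (subst AE_restrict_space_iff) (auto simp: H_def elim: eventually_mono)
qed

text \<open>The reflection x to 2 pi - x maps the period interval onto itself, and periodicity
  combined with evenness makes u invariant under it.\<close>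

lemma fourier_even:
  assumes per: "\<And>x. u (x + 2 * pi) = u x" and even: "\<And>x. u (- x) = u x"
  shows "fourier u (- k) = fourier u k"
proof -
  define F where "F x = indicator {0..2*pi} x *\<^sub>R (u x * cis (of_int k * x))" for x
  have "F (2 * pi + - 1 * x) = indicator {0..2*pi} x *\<^sub>R (u x * cis (- (of_int k * x)))" for x
  proof -
    have "u (2 * pi - x) = u x" using per[of "- x"] even[of x] by (simp add: add.commute)
    moreover have "cis (of_int k * (2 * pi - x)) = cis (- (of_int k * x))"
      using cis_multiple_2pi[of "of_int k"] by (simp add: right_diff_distrib mult_ac flip: cis_divide cis_inverse) (simp add: divide_inverse)
    ultimately show ?thesis by (auto simp: F_def split: split_indicator)
  qed
  then have "(\<integral>x. F x \<partial>lborel) = (\<integral>x. indicator {0..2*pi} x *\<^sub>R (u x * cis (- (of_int k * x))) \<partial>lborel)"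
    using lborel_integral_real_affine[of "- 1" F "2 * pi"] by simp
  then show ?thesis
    by (simp add: fourier_def mean_def set_lebesgue_integral_def F_def)
qed

section \<open>The quadratic transformation\<close>

lemma sobolev_norm_fourier: "sobolev_norm s u = hnorm s (fourier u)"
  by (simp add: sobolev_norm_def hnorm_def)

lemma sobolev_hseq: "u \<in> sobolev s \<Longrightarrow> hseq s (fourier u)"
  by (simp add: sobolev_def hseq_def)

lemma sobolev_measurable: "u \<in> sobolev s \<Longrightarrow> u \<in> borel_measurable borel"
  by (simp add: sobolev_def)

lemma sobolev_integrable_sq:
  assumes "u \<in> sobolev s"
  shows "integrable circ (\<lambda>x. (cmod (u x))\<^sup>2)"
  using assms by (simp add: sobolev_def set_integrable_circ)

lemma sobolev_integrable:
  assumes "u \<in> sobolev s"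
  shows "integrable circ u"
proof (rule Bochner_Integration.integrable_bound)
  show "integrable circ (\<lambda>x. 1 + (cmod (u x))\<^sup>2)"
    using sobolev_integrable_sq[OF assms] finite_measure.integrable_const[OF finite_measure_circ]
    by (intro Bochner_Integration.integrable_add)
  show "u \<in> borel_measurable circ"
    using sobolev_measurable[OF assms] by (rule measurable_circ)
  have "cmod z \<le> 1 + (cmod z)\<^sup>2" for z
  proof -
    have "0 \<le> (cmod z - 1)\<^sup>2" by simp
    then have "2 * cmod z \<le> 1 + (cmod z)\<^sup>2" by (simp add: power2_diff)
    then show ?thesis using norm_ge_zero[of z] by linarith
  qed
  then show "AE x in circ. norm (u x) \<le> norm (1 + (cmod (u x))\<^sup>2)"
    by (simp add: abs_of_nonneg)
qed

lemma sobolev_integrable_mult: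
  assumes "u \<in> sobolev s" "v \<in> borel_measurable borel" "\<And>x. cmod (v x) = cmod (u x)"
  shows "integrable circ (\<lambda>x. u x * v x)"
proof (rule Bochner_Integration.integrable_bound[OF sobolev_integrable_sq[OF assms(1)]])
  show "(\<lambda>x. u x * v x) \<in> borel_measurable circ"
    using measurable_circ[OF sobolev_measurable[OF assms(1)]] measurable_circ[OF assms(2)]
    by (rule borel_measurable_times)
qed (use assms(3) in \<open>auto simp: norm_mult power2_eq_square\<close>)

text \<open>The difference has zero coefficients. Elements of \<open>sobolev\<close> are functions
  and not classes, so the equality is one almost everywhere.\<close>

lemma sobolev_AE_series:
  assumes s: "s \<ge> 1" and u: "u \<in> sobolev s"
  shows "AE x in circ. u x = trig_series UNIV id (fourier u) x"
proof -
  have sum: "(\<lambda>k. cmod (fourier u k)) summable_on UNIV"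
    using hseq_abs_summable[OF s sobolev_hseq[OF u]] .
  have "null_coeffs (\<lambda>x. u x - trig_series UNIV id (fourier u) x)"
    using sobolev_integrable[OF u] integrable_trig_series[OF sum, of id]
    by (simp add: null_coeffs_def fourier_diff fourier_trig_series_id[OF sum])
  then show ?thesis by (auto dest: null_coeffs_AE)
qed

lemma trig_series_sobolev:
  assumes "(\<lambda>p. cmod (c p)) summable_on A" "hseq s (fourier (trig_series A \<phi> c))"
  shows "trig_series A \<phi> c \<in> sobolev s"
proof -
  have m: "trig_series A \<phi> c \<in> borel_measurable borel" by (rule measurable_trig_series[OF assms(1)])
  have "integrable circ (\<lambda>x. (cmod (trig_series A \<phi> c x))\<^sup>2)"
  proof (rule integrable_circ_bounded)
    show "(\<lambda>x. (cmod (trig_series A \<phi> c x))\<^sup>2) \<in> borel_measurable circ"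
      using measurable_circ[OF m] by measurable
    show "norm ((cmod (trig_series A \<phi> c x))\<^sup>2) \<le> (\<Sum>\<^sub>\<infinity>p\<in>A. cmod (c p))\<^sup>2" for x
      using trig_series_bound[OF assms(1), of \<phi> x] by (simp add: power_mono)
  qed
  then show ?thesis
    using assms(2) m trig_series_periodic[OF assms(1)]
    by (simp add: sobolev_def set_integrable_circ hseq_def)
qed

subsection \<open>Even sequences with zero mean\<close>

text \<open>The coefficient sequences of \<open>even_sobolev0\<close>. Evenness is what turns the
  conjugated coefficients at -k into conjugates at k, so that modes k and -k do not couple as
  separate unknowns.\<close>

definition eseq :: "real \<Rightarrow> (int \<Rightarrow> complex) \<Rightarrow> bool" where
  "eseq s a \<longleftrightarrow> hseq s a \<and> a 0 = 0 \<and> (\<forall>k. a (- k) = a k)"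

lemma eseqD:
  assumes "eseq s a"
  shows "hseq s a" "a 0 = 0" "a (- k) = a k"
  using assms by (auto simp: eseq_def)

lemma eseq_add: "eseq s a \<Longrightarrow> eseq s b \<Longrightarrow> eseq s (\<lambda>k. a k + b k)"
  by (simp add: eseq_def hseq_add)

lemma fourier_0: "fourier u 0 = mean u"
  by (simp add: fourier_def)

lemma even_sobolev0_eseq: "u \<in> even_sobolev0 s \<Longrightarrow> eseq s (fourier u)"
  by (auto simp: even_sobolev0_def eseq_def sobolev_hseq fourier_0 sobolev_def intro!: fourier_even)

lemma even_sobolev0_sobolev: "u \<in> even_sobolev0 s \<Longrightarrow> u \<in> sobolev s"
  by (simp add: even_sobolev0_def)

lemma trig_series_id_even:
  assumes "\<And>k. a (- k) = a k"
  shows "trig_series UNIV id a (- x) = trig_series UNIV id a x"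
  unfolding trig_series_def
  by (rule infsum_reindex_bij_witness[of _ uminus uminus]) (auto simp: assms)

lemma trig_series_even_sobolev0:
  assumes s: "s \<ge> 1" and a: "eseq s a"
  shows "trig_series UNIV id a \<in> even_sobolev0 s" "fourier (trig_series UNIV id a) = a"
proof -
  note sum = hseq_abs_summable[OF s eseqD(1)[OF a]]
  show *: "fourier (trig_series UNIV id a) = a"
    by (rule ext) (rule fourier_trig_series_id[OF sum])
  show "trig_series UNIV id a \<in> even_sobolev0 s"
    using trig_series_sobolev[OF sum, of s id] * trig_series_id_even[of a] a fourier_0[of "trig_series UNIV id a"]
    by (simp add: even_sobolev0_def eseq_def)
qed

subsection \<open>Quadratic forms on sequences\<close>

definition pairs :: "int \<Rightarrow> (int \<times> int) set" where
  "pairs m = {p \<in> modes. fst p + snd p = m}"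

text \<open>The polarised form: differences and time derivatives of K(a, a) need two separate
  arguments. It is additive in each argument, but the conjugates prevent complex linearity.\<close>

definition kterm :: "(int \<Rightarrow> int \<Rightarrow> coeffs) \<Rightarrow> (int \<Rightarrow> complex) \<Rightarrow> (int \<Rightarrow> complex) \<Rightarrow> int \<times> int \<Rightarrow> complex" where
  "kterm K a b = (\<lambda>(k, l). case K k l of (p, q, r, z) \<Rightarrow>
     p * a k * b l + q * a k * cnj (b l) + r * cnj (a k) * b l + z * cnj (a k) * cnj (b l))"

definition kform :: "(int \<Rightarrow> int \<Rightarrow> coeffs) \<Rightarrow> (int \<Rightarrow> complex) \<Rightarrow> (int \<Rightarrow> complex) \<Rightarrow> int \<Rightarrow> complex" where
  "kform K a b m = (\<Sum>\<^sub>\<infinity>p\<in>pairs m. kterm K a b p)"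

definition kbound :: "real \<Rightarrow> (int \<Rightarrow> int \<Rightarrow> coeffs) \<Rightarrow> bool" where
  "kbound B K \<longleftrightarrow> B \<ge> 0 \<and> (\<forall>(k, l)\<in>modes. norm (K k l) \<le> B)"

lemma pairs_0: "pairs 0 = {}"
  by (auto simp: pairs_def modes_def)

lemma kform_0: "kform K a b 0 = 0"
  by (simp add: kform_def pairs_0)

lemma pairs_subset: "pairs m \<subseteq> (\<lambda>k. (k, m - k)) ` UNIV"
  by (auto simp: pairs_def image_iff)

lemma kterm_bound:
  assumes "kbound B K" "(k, l) \<in> modes"
  shows "cmod (kterm K a b (k, l)) \<le> 4 * B * (cmod (a k) * cmod (b l))"
proof -
  obtain p q r z where K: "K k l = (p, q, r, z)" by (cases "K k l")
  have "norm (K k l) \<le> B" using assms by (auto simp: kbound_def)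
  moreover have "cmod p \<le> norm (p, q, r, z)" "cmod q \<le> norm (p, q, r, z)"
    "cmod r \<le> norm (p, q, r, z)" "cmod z \<le> norm (p, q, r, z)"
    by (simp_all add: norm_Pair real_le_rsqrt)
  ultimately have le: "cmod p \<le> B" "cmod q \<le> B" "cmod r \<le> B" "cmod z \<le> B"
    using K by auto
  have t: "cmod (x * y * w) \<le> B * (cmod (a k) * cmod (b l))"
    if "cmod x \<le> B" "cmod y = cmod (a k)" "cmod w = cmod (b l)" for x y w
    using that mult_right_mono[of "cmod x" B "cmod (a k) * cmod (b l)"] by (simp add: norm_mult mult.assoc)
  have "kterm K a b (k, l) = p * a k * b l + q * a k * cnj (b l) + r * cnj (a k) * b l + z * cnj (a k) * cnj (b l)"
    by (simp add: kterm_def K)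
  then have "cmod (kterm K a b (k, l)) \<le> cmod (p * a k * b l) + cmod (q * a k * cnj (b l))
      + cmod (r * cnj (a k) * b l) + cmod (z * cnj (a k) * cnj (b l))"
    by (auto intro!: order_trans[OF norm_triangle_ineq] add_mono)
  also have "\<dots> \<le> B * (cmod (a k) * cmod (b l)) + B * (cmod (a k) * cmod (b l))
      + B * (cmod (a k) * cmod (b l)) + B * (cmod (a k) * cmod (b l))"
    using le by (intro add_mono t) auto
  finally show ?thesis by simp
qed

lemma product_summable:
  fixes a b :: "'a \<Rightarrow> complex"
  assumes "(\<lambda>k. cmod (a k)) summable_on UNIV" "(\<lambda>k. cmod (b k)) summable_on UNIV"
  shows "(\<lambda>p. cmod (a (fst p) * b (snd p))) summable_on UNIV"
proof -
  have "(\<lambda>(k, l). cmod (a k) * cmod (b l)) summable_on UNIV \<times> UNIV"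
    using assms
    by (intro summable_on_SigmaI[where g = "\<lambda>k. cmod (a k) * (\<Sum>\<^sub>\<infinity>l. cmod (b l))"])
       (auto intro!: has_sum_cmult_right summable_on_cmult_left)
  then show ?thesis by (simp add: norm_mult case_prod_unfold)
qed

lemma kterm_summable_modes:
  assumes K: "kbound B K" and s: "s \<ge> 1" and a: "hseq s a" and b: "hseq s b"
  shows "(\<lambda>p. cmod (kterm K a b p)) summable_on modes"
proof (rule summable_on_comparison_test)
  have "(\<lambda>(k, l). cmod (a k) * cmod (b l)) summable_on UNIV"
    using product_summable[OF hseq_abs_summable[OF s a] hseq_abs_summable[OF s b]]
    by (simp add: norm_mult case_prod_unfold)
  then have "(\<lambda>(k, l). cmod (a k) * cmod (b l)) summable_on modes"
    by (rule summable_on_subset) auto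
  then show "(\<lambda>p. 4 * B * (case p of (k, l) \<Rightarrow> cmod (a k) * cmod (b l))) summable_on modes"
    by (rule summable_on_cmult_right)
  show "\<And>p. p \<in> modes \<Longrightarrow> cmod (kterm K a b p) \<le> 4 * B * (case p of (k, l) \<Rightarrow> cmod (a k) * cmod (b l))"
    using kterm_bound[OF K] by auto
qed auto

lemma kterm_summable:
  assumes "kbound B K" "s \<ge> 1" "hseq s a" "hseq s b"
  shows "(\<lambda>p. cmod (kterm K a b p)) summable_on pairs m" "kterm K a b summable_on pairs m"
proof -
  show *: "(\<lambda>p. cmod (kterm K a b p)) summable_on pairs m"
    using kterm_summable_modes[OF assms] by (rule summable_on_subset) (auto simp: pairs_def)
  then show "kterm K a b summable_on pairs m" by (rule abs_summable_summable)
qed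

lemma cmod_kform_le:
  assumes K: "kbound B K" and s: "s \<ge> 1" and a: "hseq s a" and b: "hseq s b"
  shows "cmod (kform K a b m) \<le> 4 * B * abs_conv a b m"
proof -
  have B: "B \<ge> 0" using K by (simp add: kbound_def)
  note sum = kterm_summable[OF assms] and conv = abs_conv_summable[OF s a b]
  have "cmod (kform K a b m) \<le> (\<Sum>\<^sub>\<infinity>p\<in>pairs m. cmod (kterm K a b p))"
    unfolding kform_def by (rule norm_infsum_bound[OF sum(1)])
  also have "\<dots> \<le> (\<Sum>\<^sub>\<infinity>p\<in>(\<lambda>k. (k, m - k)) ` UNIV. 4 * B * (cmod (a (fst p)) * cmod (b (snd p))))"
  proof (rule infsum_mono_neutral[OF sum(1)])
    show "(\<lambda>p. 4 * B * (cmod (a (fst p)) * cmod (b (snd p)))) summable_on range (\<lambda>k. (k, m - k))"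
      using conv by (subst summable_on_reindex) (auto simp: inj_on_def o_def intro!: summable_on_cmult_right)
    show "cmod (kterm K a b p) \<le> 4 * B * (cmod (a (fst p)) * cmod (b (snd p)))"
      if "p \<in> pairs m \<inter> range (\<lambda>k. (k, m - k))" for p
      using kterm_bound[OF K, of "fst p" "snd p"] that by (auto simp: pairs_def)
  qed (use B pairs_subset in auto)
  also have "\<dots> = (\<Sum>\<^sub>\<infinity>k. 4 * B * (cmod (a k) * cmod (b (m - k))))"
    by (subst infsum_reindex) (auto simp: inj_on_def o_def)
  also have "\<dots> = 4 * B * abs_conv a b m"
    unfolding abs_conv_def by (rule infsum_cmult_right) (use conv in auto)
  finally show ?thesis .
qed

text \<open>A bounded kernel is dominated by 4B times the convolution of absolute values, for which
  H^s is an algebra.\<close>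

lemma kform_hseq:
  assumes K: "kbound B K" and s: "s \<ge> 1" and a: "hseq s a" and b: "hseq s b"
  shows "hseq s (kform K a b)" "hnorm s (kform K a b) \<le> 4 * B * conv_const s * hnorm s a * hnorm s b"
proof -
  have B: "B \<ge> 0" using K by (simp add: kbound_def)
  have *: "L2w s (kform K a b) M \<le> 4 * B * conv_const s * hnorm s a * hnorm s b" if "finite M" for M
  proof -
    have "L2w s (kform K a b) M \<le> L2_set (\<lambda>m. 4 * B * (weight s m * abs_conv a b m)) M"
      using cmod_kform_le[OF assms] by (intro L2_set_mono) (auto simp: mult.left_commute[of _ "weight s _"] simp flip: mult.assoc intro!: mult_left_mono)
    also have "\<dots> = 4 * B * L2_set (\<lambda>m. weight s m * abs_conv a b m) M"
      using B by (simp add: L2_set_right_distrib)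
    also have "\<dots> \<le> 4 * B * (conv_const s * hnorm s a * hnorm s b)"
      using abs_conv_bound[OF s a b that] B by (intro mult_left_mono) auto
    finally show ?thesis by (simp add: mult_ac)
  qed
  show "hseq s (kform K a b)" "hnorm s (kform K a b) \<le> 4 * B * conv_const s * hnorm s a * hnorm s b"
    using hseqI[OF *] by auto
qed

lemma kform_add_left:
  assumes "kbound B K" "s \<ge> 1" "hseq s a" "hseq s a'" "hseq s b"
  shows "kform K (\<lambda>k. a k + a' k) b m = kform K a b m + kform K a' b m"
proof -
  have "kterm K (\<lambda>k. a k + a' k) b = (\<lambda>p. kterm K a b p + kterm K a' b p)"
    by (auto simp: fun_eq_iff kterm_def algebra_simps split: prod.splits)
  then show ?thesis
    by (simp add: kform_def infsum_add kterm_summable(2)[OF assms(1,2) assms(3,5)] kterm_summable(2)[OF assms(1,2) assms(4,5)])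
qed

lemma kform_add_right:
  assumes "kbound B K" "s \<ge> 1" "hseq s a" "hseq s b" "hseq s b'"
  shows "kform K a (\<lambda>k. b k + b' k) m = kform K a b m + kform K a b' m"
proof -
  have "kterm K a (\<lambda>k. b k + b' k) = (\<lambda>p. kterm K a b p + kterm K a b' p)"
    by (auto simp: fun_eq_iff kterm_def algebra_simps split: prod.splits)
  then show ?thesis
    by (simp add: kform_def infsum_add kterm_summable(2)[OF assms(1,2) assms(3,4)] kterm_summable(2)[OF assms(1,2) assms(3,5)])
qed

lemma kform_diff:
  assumes "kbound B K" "s \<ge> 1" "hseq s a" "hseq s b"
  shows "kform K a a m - kform K b b m = kform K (\<lambda>k. a k - b k) a m + kform K b (\<lambda>k. a k - b k) m"
proof -
  note d = hseq_diff(1)[OF assms(3,4)]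
  show ?thesis
    using kform_add_left[OF assms(1,2) d assms(4) assms(3), of m]
      kform_add_right[OF assms(1,2) assms(4) d assms(4), of m] by simp
qed

definition keven :: "(int \<Rightarrow> int \<Rightarrow> coeffs) \<Rightarrow> bool" where
  "keven K \<longleftrightarrow> (\<forall>(k, l)\<in>modes. K (- k) (- l) = K k l)"

lemma kform_even:
  assumes "keven K" "\<And>k. a (- k) = a k" "\<And>k. b (- k) = b k"
  shows "kform K a b (- m) = kform K a b m"
  unfolding kform_def
  by (rule infsum_reindex_bij_witness[of _ "\<lambda>(k, l). (- k, - l)" "\<lambda>(k, l). (- k, - l)"])
     (use assms in \<open>auto simp: pairs_def modes_def kterm_def keven_def split: prod.splits\<close>)

lemma kform_eseq:
  assumes "kbound B K" "keven K" "s \<ge> 1" "eseq s a" "eseq s b"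
  shows "eseq s (kform K a b)"
  using assms by (simp add: eseq_def kform_hseq kform_even kform_0)

subsection \<open>The nonlinearity\<close>

text \<open>The Cauchy product: almost everywhere u v is the product of two absolutely convergent
  series, hence one double series with frequencies k + l.\<close>

lemma fourier_mult_series:
  assumes a: "(\<lambda>k. cmod (a k)) summable_on UNIV" and b: "(\<lambda>k. cmod (b k)) summable_on UNIV"
    and m: "u \<in> borel_measurable circ" "v \<in> borel_measurable circ"
    and u: "AE x in circ. u x = trig_series UNIV id a x" and v: "AE x in circ. v x = trig_series UNIV id b x"
  shows "fourier (\<lambda>x. u x * v x) j = (\<Sum>\<^sub>\<infinity>p\<in>{p. fst p + snd p = j}. a (fst p) * b (snd p))"
proof -
  define c where "c p = a (fst p) * b (snd p)" for p
  note sum = product_summable[OF a b, folded c_def]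
  have "trig_series UNIV (\<lambda>p. fst p + snd p) c x = trig_series UNIV id a x * trig_series UNIV id b x" for x
  proof -
    have eq: "(\<lambda>p. c p * cis (of_int (fst p + snd p) * x))
        = (\<lambda>(k, l). (a k * cis (of_int k * x)) * (b l * cis (of_int l * x)))"
      by (simp add: fun_eq_iff c_def distrib_right cis_mult[symmetric])
    have "(\<lambda>(k, l). (a k * cis (of_int k * x)) * (b l * cis (of_int l * x))) summable_on UNIV \<times> UNIV"
      using trig_series_summable[OF sum] unfolding eq[symmetric] UNIV_Times_UNIV by (rule abs_summable_summable)
    from infsum_Sigma'_banach[OF this]
    have "trig_series UNIV (\<lambda>p. fst p + snd p) c x
        = (\<Sum>\<^sub>\<infinity>k. \<Sum>\<^sub>\<infinity>l. (a k * cis (of_int k * x)) * (b l * cis (of_int l * x)))"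
      unfolding trig_series_def eq by simp
    also have "\<dots> = trig_series UNIV id a x * trig_series UNIV id b x"
      by (simp add: trig_series_def infsum_cmult_right' infsum_cmult_left')
    finally show ?thesis .
  qed
  then have "fourier (\<lambda>x. u x * v x) j = fourier (trig_series UNIV (\<lambda>p. fst p + snd p) c) j"
    using u v by (intro fourier_cong_AE borel_measurable_times[OF m] measurable_circ[OF measurable_trig_series[OF sum]])
      (auto elim: eventually_elim2)
  then show ?thesis
    by (simp add: fourier_trig_series[OF sum]) (simp add: c_def)
qed

lemma fourier_mult_modes:
  assumes "(\<lambda>k. cmod (a k)) summable_on UNIV" "(\<lambda>k. cmod (b k)) summable_on UNIV"
    "u \<in> borel_measurable circ" "v \<in> borel_measurable circ"
    "AE x in circ. u x = trig_series UNIV id a x" "AE x in circ. v x = trig_series UNIV id b x"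
    and "a 0 = 0" "b 0 = 0" "j \<noteq> 0"
  shows "((\<lambda>p. a (fst p) * b (snd p)) has_sum fourier (\<lambda>x. u x * v x) j) (pairs j)"
proof -
  have "(\<lambda>p. a (fst p) * b (snd p)) summable_on pairs j"
    using summable_on_subset[OF product_summable[OF assms(1,2)], of "pairs j"] by (auto intro: abs_summable_summable)
  moreover have "fourier (\<lambda>x. u x * v x) j = (\<Sum>\<^sub>\<infinity>p\<in>pairs j. a (fst p) * b (snd p))"
    unfolding fourier_mult_series[OF assms(1-6)]
    by (rule infsum_cong_neutral) (use assms(7-9) in \<open>auto simp: pairs_def modes_def\<close>)
  ultimately show ?thesis by simp
qed

text \<open>|u|^2 is expanded in both orders of its factors, which produces the equal entries q and
  r. In mode 0 the left side vanishes by subtraction of the means and the right side because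
  \<open>pairs 0\<close> is empty.\<close>

lemma fourier_N2:
  assumes s: "s \<ge> 1" and u: "u \<in> even_sobolev0 s"
  shows "fourier (\<lambda>x. - \<i> * N2 \<omega> u x) j = kform (\<lambda>_ _. N2_coeffs \<omega>) (fourier u) (fourier u) j"
proof -
  define a where "a = fourier u"
  have us: "u \<in> sobolev s" using u by (rule even_sobolev0_sobolev)
  have a: "eseq s a" unfolding a_def using u by (rule even_sobolev0_eseq)
  note ms = sobolev_measurable[OF us]
  have ms_cnj: "(\<lambda>x. cnj (u x)) \<in> borel_measurable borel"
    using ms by (intro borel_measurable_continuous_on[of cnj]) (auto intro: continuous_intros)
  note mc = measurable_circ[OF ms] measurable_circ[OF ms_cnj]
  define b where "b = (\<lambda>k. cnj (a k))"
  have sum: "(\<lambda>k. cmod (a k)) summable_on UNIV" "(\<lambda>k. cmod (b k)) summable_on UNIV"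
    using hseq_abs_summable[OF s eseqD(1)[OF a]] by (simp_all add: b_def)
  have AEa: "AE x in circ. u x = trig_series UNIV id a x"
    unfolding a_def by (rule sobolev_AE_series[OF s us])
  \<comment> \<open>Conjugation reverses the frequencies, and evenness of the coefficients allows
    them to be reversed back.\<close>
  have "cnj (trig_series UNIV id a x) = trig_series UNIV id b x" for x
    unfolding trig_series_def infsum_cnj[symmetric]
    by (rule infsum_reindex_bij_witness[of _ uminus uminus]) (auto simp: b_def eseqD(3)[OF a] cis_cnj)
  then have AEb: "AE x in circ. cnj (u x) = trig_series UNIV id b x"
    using AEa by (auto elim: eventually_mono)
  have zero: "a 0 = 0" "b 0 = 0" using eseqD(2)[OF a] by (auto simp: b_def)
  define X Y where "X = (\<lambda>x. u x * cnj (u x))" and "Y = (\<lambda>x. u x * u x)"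
  have int: "integrable circ X" "integrable circ Y"
    unfolding X_def Y_def using sobolev_integrable_mult[OF us] ms ms_cnj by auto
  have int_c: "integrable circ (\<lambda>x. c)" for c :: complex
    by (rule finite_measure.integrable_const[OF finite_measure_circ])
  have N2: "N2 \<omega> u x = 2 * \<omega> * (2 * (X x - fourier X 0) + (Y x - fourier Y 0))" for x
    by (simp add: N2_def fourier_0 X_def Y_def complex_norm_square power2_eq_square[of "u _"] del: of_real_power)
  have F: "fourier (\<lambda>x. - \<i> * N2 \<omega> u x) j = - \<i> * (2 * \<omega> * (2 * (fourier X j - (if j = 0 then fourier X 0 else 0))
     + (fourier Y j - (if j = 0 then fourier Y 0 else 0))))"
    unfolding N2 fourier_cmult
    using int int_c by (simp add: fourier_add fourier_diff fourier_cmult fourier_const)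
  show ?thesis
  proof (cases "j = 0")
    case True
    then show ?thesis using F by (simp add: kform_0)
  next
    case False
    have X': "X = (\<lambda>x. cnj (u x) * u x)" by (simp add: X_def mult.commute)
    have "((\<lambda>p. a (fst p) * b (snd p)) has_sum fourier X j) (pairs j)"
      unfolding X_def by (rule fourier_mult_modes[OF sum(1,2) mc(1,2) AEa AEb zero(1,2) False])
    moreover have "((\<lambda>p. b (fst p) * a (snd p)) has_sum fourier X j) (pairs j)"
      unfolding X' by (rule fourier_mult_modes[OF sum(2,1) mc(2,1) AEb AEa zero(2,1) False])
    moreover have "((\<lambda>p. a (fst p) * a (snd p)) has_sum fourier Y j) (pairs j)"
      unfolding Y_def by (rule fourier_mult_modes[OF sum(1,1) mc(1,1) AEa AEa zero(1,1) False])
    ultimately have "((\<lambda>p. (- 2 * \<i> * \<omega>) * (a (fst p) * b (snd p) + b (fst p) * a (snd p) + a (fst p) * a (snd p)))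
        has_sum (- 2 * \<i> * \<omega>) * (fourier X j + fourier X j + fourier Y j)) (pairs j)"
      by (intro has_sum_cmult_right has_sum_add)
    also have "(\<lambda>p. (- 2 * \<i> * \<omega>) * (a (fst p) * b (snd p) + b (fst p) * a (snd p) + a (fst p) * a (snd p)))
        = kterm (\<lambda>_ _. N2_coeffs \<omega>) a a"
      by (auto simp: fun_eq_iff kterm_def N2_coeffs_def b_def algebra_simps)
    finally have "kform (\<lambda>_ _. N2_coeffs \<omega>) a a j = (- 2 * \<i> * \<omega>) * (fourier X j + fourier X j + fourier Y j)"
      unfolding kform_def by (rule infsumI)
    moreover have "fourier (\<lambda>x. - \<i> * N2 \<omega> u x) j = (- 2 * \<i> * \<omega>) * (fourier X j + fourier X j + fourier Y j)"
      unfolding F using False by (simp add: algebra_simps)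
    ultimately show ?thesis by (simp only: a_def)
  qed
qed

lemma kbound_N2: "kbound (norm (N2_coeffs \<omega>)) (\<lambda>_ _. N2_coeffs \<omega>)" and keven_N2: "keven (\<lambda>_ _. N2_coeffs \<omega>)"
  by (auto simp: kbound_def keven_def)

subsection \<open>The normal form transformation\<close>

lemma sobolev_add:
  assumes u: "u \<in> sobolev s" and v: "v \<in> sobolev s"
  shows "(\<lambda>x. u x + v x) \<in> sobolev s" "fourier (\<lambda>x. u x + v x) = (\<lambda>k. fourier u k + fourier v k)"
proof -
  show F: "fourier (\<lambda>x. u x + v x) = (\<lambda>k. fourier u k + fourier v k)"
    using fourier_add[OF sobolev_integrable[OF u] sobolev_integrable[OF v]] by auto
  have m: "(\<lambda>x. u x + v x) \<in> borel_measurable borel"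
    using u v by (auto dest!: sobolev_measurable)
  have "integrable circ (\<lambda>x. (cmod (u x + v x))\<^sup>2)"
  proof (rule Bochner_Integration.integrable_bound)
    show "integrable circ (\<lambda>x. 2 * (cmod (u x))\<^sup>2 + 2 * (cmod (v x))\<^sup>2)"
      using u v by (intro Bochner_Integration.integrable_add integrable_mult_right sobolev_integrable_sq)
    show "(\<lambda>x. (cmod (u x + v x))\<^sup>2) \<in> borel_measurable circ"
      using measurable_circ[OF m] by measurable
    have "(cmod (y + z))\<^sup>2 \<le> 2 * (cmod y)\<^sup>2 + 2 * (cmod z)\<^sup>2" for y z
    proof -
      have "(cmod (y + z))\<^sup>2 \<le> (cmod y + cmod z)\<^sup>2" by (intro power_mono norm_triangle_ineq) auto
      also have "\<dots> \<le> 2 * (cmod y)\<^sup>2 + 2 * (cmod z)\<^sup>2"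
        using sum_squares_bound[of "cmod y" "cmod z"] by (simp add: power2_sum)
      finally show ?thesis .
    qed
    then show "AE x in circ. norm ((cmod (u x + v x))\<^sup>2) \<le> norm (2 * (cmod (u x))\<^sup>2 + 2 * (cmod (v x))\<^sup>2)"
      by simp
  qed
  moreover have "hseq s (fourier (\<lambda>x. u x + v x))"
    unfolding F using u v by (intro hseq_add sobolev_hseq)
  ultimately show "(\<lambda>x. u x + v x) \<in> sobolev s"
    using m u v by (simp add: sobolev_def set_integrable_circ hseq_def)
qed

context
  fixes K :: "int \<Rightarrow> int \<Rightarrow> coeffs" and K1 K2 K3 :: kernel and B s :: real
  assumes K: "\<And>k l. (k, l) \<in> modes \<Longrightarrow> K k l = (K1 k l, K2 k l, K2 l k, K3 k l)"
    and KB: "kbound B K" and KE: "keven K" and s: "s \<ge> 1"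
begin

context
  fixes u :: "real \<Rightarrow> complex"
  assumes u: "u \<in> even_sobolev0 s"
begin

lemma K_coeff_kterm: "p \<in> modes \<Longrightarrow> K_coeff K1 K2 K3 u p = kterm K (fourier u) (fourier u) p"
  using eseqD(3)[OF even_sobolev0_eseq[OF u]] K
  by (cases p) (auto simp: K_coeff_def kterm_def)

lemma K_coeff_summable: "(\<lambda>p. cmod (K_coeff K1 K2 K3 u p)) summable_on modes"
  using kterm_summable_modes[OF KB s] eseqD(1)[OF even_sobolev0_eseq[OF u]]
  by (simp add: K_coeff_kterm cong: summable_on_cong)

lemma K_form_trig_series: "K_form K1 K2 K3 u = trig_series modes (\<lambda>p. fst p + snd p) (K_coeff K1 K2 K3 u)"
  by (auto simp: fun_eq_iff K_form_def trig_series_def case_prod_unfold)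

lemma fourier_K_form: "fourier (K_form K1 K2 K3 u) = kform K (fourier u) (fourier u)"
proof
  fix m
  show "fourier (K_form K1 K2 K3 u) m = kform K (fourier u) (fourier u) m"
    unfolding K_form_trig_series fourier_trig_series[OF K_coeff_summable] kform_def pairs_def
    by (rule infsum_cong) (auto simp: K_coeff_kterm)
qed

lemma normal_form_properties:
  shows "normal_form K1 K2 K3 u \<in> even_sobolev0 s"
    and "fourier (normal_form K1 K2 K3 u) = (\<lambda>m. fourier u m + kform K (fourier u) (fourier u) m)"
proof -
  note us = even_sobolev0_sobolev[OF u] and a = even_sobolev0_eseq[OF u]
  have ks: "K_form K1 K2 K3 u \<in> sobolev s"
    using trig_series_sobolev[OF K_coeff_summable] fourier_K_form kform_hseq(1)[OF KB s eseqD(1)[OF a] eseqD(1)[OF a]]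
    by (simp add: K_form_trig_series)
  have nf: "normal_form K1 K2 K3 u = (\<lambda>x. u x + K_form K1 K2 K3 u x)"
    by (simp add: fun_eq_iff normal_form_def)
  show F: "fourier (normal_form K1 K2 K3 u) = (\<lambda>m. fourier u m + kform K (fourier u) (fourier u) m)"
    unfolding nf sobolev_add(2)[OF us ks] fourier_K_form ..
  have even: "K_form K1 K2 K3 u (- x) = K_form K1 K2 K3 u x" for x
  proof -
    define neg where "neg p = (- fst p, - snd p)" for p :: "int \<times> int"
    have neg: "neg (neg p) = p" "neg p \<in> modes \<longleftrightarrow> p \<in> modes" for p
      by (auto simp: neg_def modes_def)
    show ?thesis
      unfolding K_form_trig_series trig_series_def
    proof (rule infsum_reindex_bij_witness[of _ neg neg])
      fix p assume p: "p \<in> modes"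
      have "K_coeff K1 K2 K3 u (neg p) = K_coeff K1 K2 K3 u p"
        using p KE eseqD(3)[OF a] K_coeff_kterm[of p] K_coeff_kterm[of "neg p"] neg(2)[of p]
        by (auto simp: kterm_def keven_def neg_def split: prod.splits)
      moreover have "cis (of_int (fst (neg p) + snd (neg p)) * x) = cis (of_int (fst p + snd p) * - x)"
        by (rule arg_cong[of _ _ cis]) (simp add: neg_def algebra_simps)
      ultimately show "K_coeff K1 K2 K3 u (neg p) * cis (of_int (fst (neg p) + snd (neg p)) * x)
         = K_coeff K1 K2 K3 u p * cis (of_int (fst p + snd p) * - x)"
        by simp
    qed (simp_all add: neg)
  qed
  have "mean (normal_form K1 K2 K3 u) = 0"
    using F eseqD(2)[OF a] by (simp add: fourier_0[symmetric] kform_0)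
  then show "normal_form K1 K2 K3 u \<in> even_sobolev0 s"
    using sobolev_add(1)[OF us ks] u even by (simp add: even_sobolev0_def nf)
qed

end

end

subsection \<open>Termwise differentiation\<close>

lemma norm_infsum_le_finite:
  fixes f :: "'i \<Rightarrow> 'b :: real_normed_vector"
  assumes "f summable_on A" "\<And>F. finite F \<Longrightarrow> F \<subseteq> A \<Longrightarrow> norm (sum f F) \<le> B"
  shows "norm (infsum f A) \<le> B"
proof (rule tendsto_upperbound)
  show "((\<lambda>F. norm (sum f F)) \<longlongrightarrow> norm (infsum f A)) (finite_subsets_at_top A)"
    by (intro tendsto_norm infsum_tendsto assms(1))
  show "\<forall>\<^sub>F F in finite_subsets_at_top A. norm (sum f F) \<le> B"
    using assms(2) by (intro eventually_finite_subsets_at_top_weakI) auto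
qed auto

text \<open>Differentiability at a single point needs the tails of the differentiated series to be
  small only near that point; the mean value inequality on finite sums does the rest.\<close>

lemma has_vector_derivative_infsum:
  fixes q q' :: "'i \<Rightarrow> real \<Rightarrow> 'b :: banach"
  assumes I: "is_interval I" and t: "t \<in> I"
    and deriv: "\<And>p \<sigma>. p \<in> A \<Longrightarrow> \<sigma> \<in> I \<Longrightarrow> (q p has_vector_derivative q' p \<sigma>) (at \<sigma> within I)"
    and summ: "\<And>\<sigma>. \<sigma> \<in> I \<Longrightarrow> (\<lambda>p. q p \<sigma>) summable_on A"
    and summ': "(\<lambda>p. q' p t) summable_on A"
    and tail: "\<And>e. e > 0 \<Longrightarrow> \<exists>F d. finite F \<and> F \<subseteq> A \<and> d > 0 \<and> (\<forall>\<sigma>\<in>I. \<bar>\<sigma> - t\<bar> < d \<longrightarrow>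
        (\<forall>F'. finite F' \<longrightarrow> F' \<subseteq> A - F \<longrightarrow> norm (\<Sum>p\<in>F'. q' p \<sigma>) \<le> e))"
  shows "((\<lambda>\<sigma>. \<Sum>\<^sub>\<infinity>p\<in>A. q p \<sigma>) has_vector_derivative (\<Sum>\<^sub>\<infinity>p\<in>A. q' p t)) (at t within I)"
  unfolding has_vector_derivative_def has_derivative_within_alt
proof (intro conjI allI impI)
  show "bounded_linear (\<lambda>h. h *\<^sub>R (\<Sum>\<^sub>\<infinity>p\<in>A. q' p t))" by (rule bounded_linear_scaleR_left)
  fix e :: real assume e: "e > 0"
  \<comment> \<open>Three errors share e: the finite part, the difference of the tails, and the tail
    of the derivative at t.\<close>
  then obtain F d1 where F: "finite F" "F \<subseteq> A" and d1: "d1 > 0"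
    and tl: "\<And>\<sigma> F'. \<sigma> \<in> I \<Longrightarrow> \<bar>\<sigma> - t\<bar> < d1 \<Longrightarrow> finite F' \<Longrightarrow> F' \<subseteq> A - F \<Longrightarrow> norm (\<Sum>p\<in>F'. q' p \<sigma>) \<le> e / 3"
    using tail[of "e / 3"] by auto
  have deriv_F: "((\<lambda>\<sigma>. \<Sum>p\<in>F. q p \<sigma>) has_vector_derivative (\<Sum>p\<in>F. q' p t)) (at t within I)"
    using F t by (intro has_vector_derivative_sum deriv) auto
  obtain d2 where d2: "d2 > 0" and fin: "\<And>y. y \<in> I \<Longrightarrow> norm (y - t) < d2 \<Longrightarrow>
      norm ((\<Sum>p\<in>F. q p y) - (\<Sum>p\<in>F. q p t) - (y - t) *\<^sub>R (\<Sum>p\<in>F. q' p t)) \<le> e / 3 * norm (y - t)"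
    using deriv_F[unfolded has_vector_derivative_def has_derivative_within_alt, THEN conjunct2, rule_format, of "e / 3"] e
    by auto
  have split: "infsum g A = sum g F + infsum g (A - F)" if "g summable_on A" for g :: "'i \<Rightarrow> 'b"
  proof -
    have "g summable_on A - F" using that by (rule summable_on_subset_banach) auto
    moreover have "A = F \<union> (A - F)" using F by auto
    ultimately show ?thesis
      using infsum_Un_disjoint[of g F "A - F"] F by simp
  qed
  have T': "norm (\<Sum>\<^sub>\<infinity>p\<in>A - F. q' p t) \<le> e / 3"
    using t d1 by (intro norm_infsum_le_finite tl summable_on_subset_banach[OF summ']) auto
  have T: "norm ((\<Sum>\<^sub>\<infinity>p\<in>A - F. q p y) - (\<Sum>\<^sub>\<infinity>p\<in>A - F. q p t)) \<le> e / 3 * norm (y - t)"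
    if y: "y \<in> I" "norm (y - t) < d1" for y
  proof -
    have sy: "(\<lambda>p. q p y) summable_on A - F" and st: "(\<lambda>p. q p t) summable_on A - F"
      using summ[OF y(1)] summ[OF t] by (auto intro: summable_on_subset_banach)
    have "norm (\<Sum>\<^sub>\<infinity>p\<in>A - F. q p y - q p t) \<le> e / 3 * norm (y - t)"
    proof (rule norm_infsum_le_finite)
      show "(\<lambda>p. q p y - q p t) summable_on A - F"
        using summable_on_add[OF sy, of "\<lambda>p. - q p t"] st by (simp add: summable_on_uminus)
      fix F' assume F': "finite F'" "F' \<subseteq> A - F"
      have "norm ((\<Sum>p\<in>F'. q p y) - (\<Sum>p\<in>F'. q p t)) \<le> e / 3 * norm (y - t)"
      proof (rule differentiable_bound[where S = "I \<inter> ball t d1" and f' = "\<lambda>\<sigma> h. h *\<^sub>R (\<Sum>p\<in>F'. q' p \<sigma>)"])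
        show "convex (I \<inter> ball t d1)"
          using I by (intro convex_Int convex_ball) (simp add: is_interval_convex_1)
        show "((\<lambda>\<sigma>. \<Sum>p\<in>F'. q p \<sigma>) has_derivative (\<lambda>h. h *\<^sub>R (\<Sum>p\<in>F'. q' p \<sigma>))) (at \<sigma> within I \<inter> ball t d1)"
          if "\<sigma> \<in> I \<inter> ball t d1" for \<sigma>
          unfolding has_vector_derivative_def[symmetric]
          by (rule has_vector_derivative_within_subset[of _ _ _ I], rule has_vector_derivative_sum)
             (use that F' in \<open>auto intro!: deriv\<close>)
        show "onorm (\<lambda>h. h *\<^sub>R (\<Sum>p\<in>F'. q' p \<sigma>)) \<le> e / 3" if "\<sigma> \<in> I \<inter> ball t d1" for \<sigma>
        proof (rule onorm_le)
          fix h :: real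
          have "norm (\<Sum>p\<in>F'. q' p \<sigma>) \<le> e / 3"
            using that F' by (intro tl) (auto simp: dist_real_def abs_minus_commute)
          then have "\<bar>h\<bar> * norm (\<Sum>p\<in>F'. q' p \<sigma>) \<le> \<bar>h\<bar> * (e / 3)"
            by (rule mult_left_mono) simp
          then show "norm (h *\<^sub>R (\<Sum>p\<in>F'. q' p \<sigma>)) \<le> e / 3 * norm h" by (simp add: mult.commute)
        qed
      qed (use y t d1 in \<open>auto simp: dist_real_def abs_minus_commute\<close>)
      then show "norm (\<Sum>p\<in>F'. q p y - q p t) \<le> e / 3 * norm (y - t)"
        by (simp add: sum_subtractf)
    qed
    moreover have "(\<Sum>\<^sub>\<infinity>p\<in>A - F. q p y - q p t) = (\<Sum>\<^sub>\<infinity>p\<in>A - F. q p y) - (\<Sum>\<^sub>\<infinity>p\<in>A - F. q p t)"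
      using infsum_add[OF sy, of "\<lambda>p. - q p t"] st by (simp add: summable_on_uminus infsum_uminus)
    ultimately show ?thesis by simp
  qed
  show "\<exists>d>0. \<forall>y\<in>I. norm (y - t) < d \<longrightarrow> norm ((\<Sum>\<^sub>\<infinity>p\<in>A. q p y) - (\<Sum>\<^sub>\<infinity>p\<in>A. q p t) - (y - t) *\<^sub>R (\<Sum>\<^sub>\<infinity>p\<in>A. q' p t)) \<le> e * norm (y - t)"
  proof (intro exI[of _ "min d1 d2"] conjI ballI impI)
    show "min d1 d2 > 0" using d1 d2 by simp
    fix y assume y: "y \<in> I" "norm (y - t) < min d1 d2"
    let ?X = "(\<Sum>p\<in>F. q p y) - (\<Sum>p\<in>F. q p t) - (y - t) *\<^sub>R (\<Sum>p\<in>F. q' p t)"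
    let ?Y = "(\<Sum>\<^sub>\<infinity>p\<in>A - F. q p y) - (\<Sum>\<^sub>\<infinity>p\<in>A - F. q p t)"
    let ?Z = "(y - t) *\<^sub>R (\<Sum>\<^sub>\<infinity>p\<in>A - F. q' p t)"
    have "(\<Sum>\<^sub>\<infinity>p\<in>A. q p y) - (\<Sum>\<^sub>\<infinity>p\<in>A. q p t) - (y - t) *\<^sub>R (\<Sum>\<^sub>\<infinity>p\<in>A. q' p t) = ?X + ?Y - ?Z"
      by (simp add: split[OF summ[OF y(1)]] split[OF summ[OF t]] split[OF summ'] scaleR_add_right)
    also have "norm \<dots> \<le> norm ?X + norm ?Y + norm ?Z"
      using norm_triangle_ineq4[of "?X + ?Y" ?Z] norm_triangle_ineq[of ?X ?Y] by linarith
    also have "norm ?X \<le> e / 3 * norm (y - t)" using y by (intro fin) auto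
    also have "norm ?Y \<le> e / 3 * norm (y - t)" using y by (intro T) auto
    also have "norm ?Z \<le> e / 3 * norm (y - t)"
      using mult_left_mono[OF T', of "norm (y - t)"] by (simp add: mult.commute)
    finally show "norm ((\<Sum>\<^sub>\<infinity>p\<in>A. q p y) - (\<Sum>\<^sub>\<infinity>p\<in>A. q p t) - (y - t) *\<^sub>R (\<Sum>\<^sub>\<infinity>p\<in>A. q' p t)) \<le> e * norm (y - t)"
      by simp
  qed
qed

lemma hseq_tail:
  assumes "hseq s a" "\<eta> > 0"
  shows "\<exists>J. finite J \<and> (\<forall>M. finite M \<longrightarrow> M \<inter> J = {} \<longrightarrow> L2w s a M \<le> \<eta>)"
proof -
  define g where "g k = (1 + (real_of_int k)\<^sup>2) powr s * (cmod (a k))\<^sup>2" for k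
  have g: "g summable_on UNIV" using assms(1) by (simp add: hseq_def g_def[abs_def])
  obtain J where J: "finite J" "dist (sum g J) (infsum g UNIV) \<le> \<eta>\<^sup>2"
    using infsum_finite_approximation[OF g, of "\<eta>\<^sup>2"] assms(2) by auto
  have "L2w s a M \<le> \<eta>" if M: "finite M" "M \<inter> J = {}" for M
  proof -
    have "sum g M + sum g J = sum g (M \<union> J)" using M J by (simp add: sum.union_disjoint)
    also have "\<dots> \<le> infsum g UNIV" using M J g by (intro finite_sum_le_infsum) (auto simp: g_def)
    finally have "sum g M \<le> \<eta>\<^sup>2" using J(2) by (simp add: dist_real_def)
    moreover have "sum g M = (L2w s a M)\<^sup>2" unfolding g_def by (rule sum_weight_sq)
    ultimately have "(L2w s a M)\<^sup>2 \<le> \<eta>\<^sup>2" by simp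
    then show ?thesis by (rule power2_le_imp_le) (use assms(2) in simp)
  qed
  then show ?thesis using J(1) by blast
qed

subsection \<open>The linear part on sequences\<close>

definition lin_seq :: "real \<Rightarrow> real \<Rightarrow> real \<Rightarrow> (int \<Rightarrow> complex) \<Rightarrow> int \<Rightarrow> complex" where
  "lin_seq \<alpha> \<theta> \<epsilon> a k = lin_symbol \<alpha> \<theta> \<epsilon> k * a k - \<i> * \<theta> * cnj (a k)"

lemma fourier_cnj: "fourier (\<lambda>x. cnj (u x)) k = cnj (fourier u (- k))"
proof -
  have "(\<lambda>x. cnj (u x) * cis (- (of_int k * x))) = (\<lambda>x. cnj (u x * cis (- (of_int (- k) * x))))"
    by (simp add: fun_eq_iff cis_cnj)
  then show ?thesis
    using Bochner_Integration.integral_cnj[of circ "\<lambda>x. u x * cis (- (of_int (- k) * x))"]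
    by (simp only: fourier_circ complex_cnj_divide complex_cnj_complex_of_real complex_cnj_mult complex_cnj_numeral)
qed

lemma L_hat_lin_seq:
  assumes "\<And>k. fourier u (- k) = fourier u k"
  shows "L_hat \<alpha> \<omega> \<epsilon> u k = lin_seq \<alpha> (2 * \<omega>\<^sup>2) \<epsilon> (fourier u) k"
proof -
  have sym: "lin_symbol \<alpha> (2 * \<omega>\<^sup>2) \<epsilon> k = - \<epsilon> * (\<alpha> + (of_int k)\<^sup>2) + \<i> * ((of_int k)\<^sup>2 - 2 * \<omega>\<^sup>2)"
    by (simp add: lin_symbol_def complex_eq_iff power2_eq_square)
  show ?thesis
    unfolding L_hat_def Let_def lin_seq_def fourier_cnj assms[of k] sym
    by (simp add: power_mult_distrib algebra_simps)
qed

definition lin_const :: "real \<Rightarrow> real \<Rightarrow> real \<Rightarrow> real" where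
  "lin_const \<alpha> \<theta> \<epsilon> = \<bar>\<epsilon>\<bar> * (\<bar>\<alpha>\<bar> + 1) + 1 + 2 * \<bar>\<theta>\<bar>"

lemma lin_const_nonneg: "lin_const \<alpha> \<theta> \<epsilon> \<ge> 0"
  by (simp add: lin_const_def)

text \<open>The loss of two derivatives in quantitative form: (\<open>weight 1 k\<close>)^2 is 1 +
  k^2.\<close>

lemma cmod_lin_seq_le: "cmod (lin_seq \<alpha> \<theta> \<epsilon> a k) \<le> lin_const \<alpha> \<theta> \<epsilon> * (weight 1 k)\<^sup>2 * cmod (a k)"
proof -
  define x where "x = (real_of_int k)\<^sup>2"
  have x: "x \<ge> 0" by (simp add: x_def)
  have w: "(weight 1 k)\<^sup>2 = 1 + x" by (simp add: weight_1 x_def add_nonneg_nonneg)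
  have f1: "\<bar>\<epsilon>\<bar> * \<bar>\<alpha> + x\<bar> \<le> \<bar>\<epsilon>\<bar> * ((\<bar>\<alpha>\<bar> + 1) * (1 + x))"
  proof (rule mult_left_mono)
    have "\<bar>\<alpha> + x\<bar> \<le> \<bar>\<alpha>\<bar> + x" using x by linarith
    also have "\<dots> \<le> (\<bar>\<alpha>\<bar> + 1) * (1 + x)" using x by (simp add: algebra_simps)
    finally show "\<bar>\<alpha> + x\<bar> \<le> (\<bar>\<alpha>\<bar> + 1) * (1 + x)" .
  qed auto
  have f2: "\<bar>\<theta>\<bar> \<le> \<bar>\<theta>\<bar> * (1 + x)" using x by (simp add: mult_le_cancel_left1)
  have f3: "cmod (lin_symbol \<alpha> \<theta> \<epsilon> k) \<le> \<bar>\<epsilon>\<bar> * \<bar>\<alpha> + x\<bar> + (x + \<bar>\<theta>\<bar>)"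
  proof -
    have "cmod (lin_symbol \<alpha> \<theta> \<epsilon> k) \<le> \<bar>- \<epsilon> * (\<alpha> + x)\<bar> + \<bar>x - \<theta>\<bar>"
      using cmod_le[of "lin_symbol \<alpha> \<theta> \<epsilon> k"] by (simp add: lin_symbol_def x_def)
    moreover have "\<bar>- \<epsilon> * (\<alpha> + x)\<bar> = \<bar>\<epsilon>\<bar> * \<bar>\<alpha> + x\<bar>" by (simp add: abs_mult)
    moreover have "\<bar>x - \<theta>\<bar> \<le> x + \<bar>\<theta>\<bar>" using x by linarith
    ultimately show ?thesis by linarith
  qed
  have arith: "L + T \<le> (E * A + 1 + 2 * T) * (1 + x)"
    if "E * b \<le> E * (A * (1 + x))" "T \<le> T * (1 + x)" "L \<le> E * b + (x + T)" for L T E A b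
  proof -
    have "L + T \<le> E * (A * (1 + x)) + (1 + x) + 2 * (T * (1 + x))" using that by linarith
    also have "\<dots> = (E * A + 1 + 2 * T) * (1 + x)" by (simp only: algebra_simps mult_1)
    finally show ?thesis .
  qed
  have "cmod (lin_symbol \<alpha> \<theta> \<epsilon> k) + \<bar>\<theta>\<bar> \<le> lin_const \<alpha> \<theta> \<epsilon> * (1 + x)"
    unfolding lin_const_def by (rule arith[OF f1 f2 f3])
  then have "(cmod (lin_symbol \<alpha> \<theta> \<epsilon> k) + \<bar>\<theta>\<bar>) * cmod (a k) \<le> lin_const \<alpha> \<theta> \<epsilon> * (1 + x) * cmod (a k)"
    by (rule mult_right_mono) simp
  moreover have "cmod (lin_seq \<alpha> \<theta> \<epsilon> a k) \<le> cmod (lin_symbol \<alpha> \<theta> \<epsilon> k) * cmod (a k) + \<bar>\<theta>\<bar> * cmod (a k)"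
    unfolding lin_seq_def by (rule order_trans[OF norm_triangle_ineq4]) (simp add: norm_mult)
  ultimately show ?thesis unfolding w by (simp add: algebra_simps)
qed

text \<open>On the line \<open>k + l = m\<close> the weights at \<open>k\<close> and \<open>l\<close> are comparable, so two derivatives
  on one factor can be shared between both factors.\<close>

lemma weight_sq_le:
  assumes "k + l = m"
  shows "(weight 1 k)\<^sup>2 \<le> 4 * weight 1 m * (weight 1 k * weight 1 l)"
proof -
  have neg: "weight 1 (- l) = weight 1 l" by (simp add: weight_def)
  have "weight 1 k \<le> 2 * (weight 1 m + weight 1 l)"
    using weight_add_le[of 1 m "- l"] assms neg by auto
  also have "\<dots> \<le> 2 * (weight 1 m * weight 1 l + weight 1 m * weight 1 l)"
    using weight_ge_1[of 1 m] weight_ge_1[of 1 l]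
    by (intro mult_left_mono add_mono) (auto simp: mult_le_cancel_left1 mult_le_cancel_right1)
  also have "\<dots> = 4 * (weight 1 m * weight 1 l)" by simp
  finally show ?thesis
    using mult_left_mono[of "weight 1 k" "4 * (weight 1 m * weight 1 l)" "weight 1 k"]
    by (simp only: power2_eq_square mult_ac weight_pos)
qed

lemma inj_on_pairs:
  assumes "F \<subseteq> pairs m"
  shows "inj_on fst F" "inj_on snd F"
proof -
  have "fst p + snd p = m" if "p \<in> F" for p using assms that by (auto simp: pairs_def)
  then show "inj_on fst F" "inj_on snd F"
    by (auto intro!: inj_onI simp: prod_eq_iff) (metis add_left_cancel add_right_cancel fst_conv snd_conv)+
qed

lemma sum_product_pairs_le:
  fixes f g :: "int \<Rightarrow> real"
  assumes "F \<subseteq> pairs m" "\<And>k. f k \<ge> 0" "\<And>k. g k \<ge> 0"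
  shows "(\<Sum>p\<in>F. f (fst p) * g (snd p)) \<le> L2_set f (fst ` F) * L2_set g (snd ` F)"
proof -
  have "(\<Sum>p\<in>F. f (fst p) * g (snd p)) = (\<Sum>p\<in>F. \<bar>f (fst p)\<bar> * \<bar>g (snd p)\<bar>)"
    using assms by simp
  also have "\<dots> \<le> L2_set (\<lambda>p. f (fst p)) F * L2_set (\<lambda>p. g (snd p)) F"
    by (rule L2_set_mult_ineq)
  also have "\<dots> = L2_set f (fst ` F) * L2_set g (snd ` F)"
    using inj_on_pairs[OF assms(1)] by (simp add: L2_set_def sum.reindex)
  finally show ?thesis .
qed

text \<open>The weight lost to the linear part is shared between both factors, where s \<ge> 1
  absorbs it. Cauchy-Schwarz along k + l = m then leaves norms over the projections of F only, and
  these are small when F avoids finitely many modes. The 8 collects 4 from each of the two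
  slots.\<close>

lemma dterm_bound:
  assumes K: "kbound B K" and s: "s \<ge> 1" and a: "hseq s a" and n: "hseq s n" and F: "F \<subseteq> pairs m" "finite F"
    and a': "\<And>k. a' k = lin_seq \<alpha> \<theta> \<epsilon> a k + n k"
  shows "(\<Sum>p\<in>F. cmod (kterm K a' a p + kterm K a a' p))
    \<le> 4 * B * (8 * lin_const \<alpha> \<theta> \<epsilon> * weight 1 m * hnorm s a + hnorm s n) * (L2w s a (fst ` F) + L2w s a (snd ` F))"
proof -
  define c where "c = lin_const \<alpha> \<theta> \<epsilon>"
  have c: "c \<ge> 0" by (simp add: c_def lin_const_nonneg)
  have B: "B \<ge> 0" using K by (simp add: kbound_def)
  define Y where "Y k = weight s k * cmod (a k)" for k
  have Y: "Y k \<ge> 0" "weight 1 k * cmod (a k) \<le> Y k" "cmod (a k) \<le> Y k" for k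
    using weight_mono[OF s, of k] weight_ge_1[of s k] s by (auto simp: Y_def mult_right_mono mult_le_cancel_right1)
  define Z where "Z k = weight s k * cmod (n k)" for k
  have Z: "Z k \<ge> 0" "cmod (n k) \<le> Z k" for k
    using weight_ge_1[of s k] s by (auto simp: Z_def mult_le_cancel_right1)
  have half: "cmod (a' k) * cmod (a l) \<le> 4 * c * weight 1 m * (Y k * Y l) + Z k * Y l" if "k + l = m" for k l
  proof -
    have "cmod (a' k) \<le> c * (weight 1 k)\<^sup>2 * cmod (a k) + cmod (n k)"
      using norm_triangle_ineq[of "lin_seq \<alpha> \<theta> \<epsilon> a k" "n k"] cmod_lin_seq_le[of \<alpha> \<theta> \<epsilon> a k]
      by (simp add: a' c_def)
    then have "cmod (a' k) * cmod (a l) \<le> (c * (weight 1 k)\<^sup>2 * cmod (a k) + cmod (n k)) * cmod (a l)"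
      by (rule mult_right_mono) simp
    also have "\<dots> = c * ((weight 1 k)\<^sup>2 * (cmod (a k) * cmod (a l))) + cmod (n k) * cmod (a l)"
      by (simp add: algebra_simps)
    also have "\<dots> \<le> c * ((4 * weight 1 m * (weight 1 k * weight 1 l)) * (cmod (a k) * cmod (a l))) + Z k * Y l"
      using c weight_sq_le[OF that] Y Z by (intro add_mono mult_left_mono mult_right_mono mult_mono) auto
    also have "\<dots> = 4 * c * weight 1 m * ((weight 1 k * cmod (a k)) * (weight 1 l * cmod (a l))) + Z k * Y l"
      by (simp add: algebra_simps)
    also have "\<dots> \<le> 4 * c * weight 1 m * (Y k * Y l) + Z k * Y l"
      using c Y by (intro add_right_mono mult_left_mono mult_mono) auto
    finally show ?thesis .
  qed
  have "cmod (kterm K a' a p + kterm K a a' p)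
      \<le> 4 * B * (8 * c * weight 1 m * (Y (fst p) * Y (snd p)) + Z (fst p) * Y (snd p) + Y (fst p) * Z (snd p))"
    if "p \<in> F" for p
  proof -
    obtain k l where p: "p = (k, l)" by (cases p)
    have kl: "(k, l) \<in> modes" "k + l = m" using that F p by (auto simp: pairs_def)
    have "cmod (kterm K a' a p + kterm K a a' p) \<le> 4 * B * (cmod (a' k) * cmod (a l) + cmod (a' l) * cmod (a k))"
      using norm_triangle_ineq[of "kterm K a' a p" "kterm K a a' p"] kterm_bound[OF K kl(1), of a' a] kterm_bound[OF K kl(1), of a a']
      by (simp add: p algebra_simps)
    also have "\<dots> \<le> 4 * B * ((4 * c * weight 1 m * (Y k * Y l) + Z k * Y l) + (4 * c * weight 1 m * (Y l * Y k) + Z l * Y k))"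
      using B kl by (intro mult_left_mono add_mono half) auto
    finally show ?thesis by (simp add: p algebra_simps)
  qed
  then have "(\<Sum>p\<in>F. cmod (kterm K a' a p + kterm K a a' p))
     \<le> (\<Sum>p\<in>F. 4 * B * (8 * c * weight 1 m * (Y (fst p) * Y (snd p)) + Z (fst p) * Y (snd p) + Y (fst p) * Z (snd p)))"
    by (rule sum_mono)
  also have "\<dots> = 4 * B * (8 * c * weight 1 m * (\<Sum>p\<in>F. Y (fst p) * Y (snd p))
      + (\<Sum>p\<in>F. Z (fst p) * Y (snd p)) + (\<Sum>p\<in>F. Y (fst p) * Z (snd p)))"
    by (simp only: sum_distrib_left sum.distrib distrib_left)
  also have "\<dots> \<le> 4 * B * (8 * c * weight 1 m * (L2_set Y (fst ` F) * hnorm s a)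
      + (hnorm s n * L2_set Y (snd ` F)) + (L2_set Y (fst ` F) * hnorm s n))"
  proof -
    have YM: "L2_set Y M \<le> hnorm s a" and ZM: "L2_set Z M \<le> hnorm s n" for M
      using L2w_le_hnorm[OF a] L2w_le_hnorm[OF n] by (simp_all add: Y_def[abs_def] Z_def[abs_def])
    have "(\<Sum>p\<in>F. Y (fst p) * Y (snd p)) \<le> L2_set Y (fst ` F) * hnorm s a"
      by (rule order_trans[OF sum_product_pairs_le[OF F(1) Y(1) Y(1)]]) (intro mult_left_mono YM; simp)
    moreover have "(\<Sum>p\<in>F. Z (fst p) * Y (snd p)) \<le> hnorm s n * L2_set Y (snd ` F)"
      by (rule order_trans[OF sum_product_pairs_le[OF F(1) Z(1) Y(1)]]) (intro mult_right_mono ZM; simp)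
    moreover have "(\<Sum>p\<in>F. Y (fst p) * Z (snd p)) \<le> L2_set Y (fst ` F) * hnorm s n"
      by (rule order_trans[OF sum_product_pairs_le[OF F(1) Y(1) Z(1)]]) (intro mult_left_mono ZM; simp)
    ultimately show ?thesis using B c by (intro mult_left_mono add_mono) auto
  qed
  also have "\<dots> \<le> 4 * B * (8 * c * weight 1 m * hnorm s a + hnorm s n) * (L2_set Y (fst ` F) + L2_set Y (snd ` F))"
  proof -
    have "0 \<le> 8 * c * weight 1 m * hnorm s a * L2_set Y (snd ` F)" using c by simp
    then show ?thesis using B unfolding mult.assoc[of "4 * B"]
      by (intro mult_left_mono) (simp_all add: algebra_simps)
  qed
  finally show ?thesis by (simp add: Y_def[abs_def] c_def)
qed

subsection \<open>The transformed equation\<close>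

lemma kterm_homological:
  assumes "hom_op \<alpha> \<theta> \<epsilon> k l (K k l) = N k l"
  shows "kterm K (lin_seq \<alpha> \<theta> \<epsilon> a) a (k, l) + kterm K a (lin_seq \<alpha> \<theta> \<epsilon> a) (k, l) + kterm N a a (k, l)
    = lin_symbol \<alpha> \<theta> \<epsilon> (k + l) * kterm K a a (k, l) - \<i> * \<theta> * cnj (kterm K a a (k, l))"
proof -
  obtain p q r z where K: "K k l = (p, q, r, z)" by (cases "K k l")
  obtain n1 n2 n3 n4 where N: "N k l = (n1, n2, n3, n4)" by (cases "N k l")
  define ck cl cm where "ck = lin_symbol \<alpha> \<theta> \<epsilon> k" and "cl = lin_symbol \<alpha> \<theta> \<epsilon> l"
    and "cm = lin_symbol \<alpha> \<theta> \<epsilon> (k + l)"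
  have n: "n1 = cm * p - \<i> * \<theta> * cnj z - (ck * p + \<i> * \<theta> * r) - (cl * p + \<i> * \<theta> * q)"
    "n2 = cm * q - \<i> * \<theta> * cnj r - (ck * q + \<i> * \<theta> * z) - (cnj cl * q - \<i> * \<theta> * p)"
    "n3 = cm * r - \<i> * \<theta> * cnj q - (cnj ck * r - \<i> * \<theta> * p) - (cl * r + \<i> * \<theta> * z)"
    "n4 = cm * z - \<i> * \<theta> * cnj p - (cnj ck * z - \<i> * \<theta> * q) - (cnj cl * z - \<i> * \<theta> * r)"
    using assms by (simp_all add: K N hom_op_def op_defs ck_def cl_def cm_def)
  show ?thesis
    unfolding kterm_def prod.case K N lin_seq_def ck_def[symmetric] cl_def[symmetric] cm_def[symmetric] n
    by (simp add: algebra_simps)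
qed

lemma lin_seq_add: "lin_seq \<alpha> \<theta> \<epsilon> (\<lambda>k. a k + b k) k = lin_seq \<alpha> \<theta> \<epsilon> a k + lin_seq \<alpha> \<theta> \<epsilon> b k"
  by (simp add: lin_seq_def algebra_simps)

text \<open>The homological identity replaces the differentiated terms one by one by terms without
  derivatives on the inputs. These are summable for a in H^s, so the unbounded linear part ends up
  outside the sum, acting on the single mode m.\<close>

lemma dterm_has_sum:
  assumes K: "kbound B K" and N: "kbound B' N" and s: "s \<ge> 1" and a: "hseq s a" and n: "hseq s n"
    and hom: "\<And>k l. (k, l) \<in> modes \<Longrightarrow> hom_op \<alpha> \<theta> \<epsilon> k l (K k l) = N k l"
    and a': "a' = (\<lambda>k. lin_seq \<alpha> \<theta> \<epsilon> a k + n k)"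
  shows "((\<lambda>p. kterm K a' a p + kterm K a a' p) has_sum
    (lin_seq \<alpha> \<theta> \<epsilon> (kform K a a) m - kform N a a m + kform K n a m + kform K a n m)) (pairs m)"
proof -
  have eq: "kterm K a' a p + kterm K a a' p = lin_symbol \<alpha> \<theta> \<epsilon> m * kterm K a a p + (- (\<i> * \<theta>)) * cnj (kterm K a a p)
      + (- 1) * kterm N a a p + kterm K n a p + kterm K a n p" if "p \<in> pairs m" for p
  proof -
    obtain k l where p: "p = (k, l)" by (cases p)
    have kl: "(k, l) \<in> modes" "k + l = m" using that by (auto simp: p pairs_def)
    have "kterm K a' a p + kterm K a a' p = kterm K (lin_seq \<alpha> \<theta> \<epsilon> a) a p + kterm K a (lin_seq \<alpha> \<theta> \<epsilon> a) p
        + kterm K n a p + kterm K a n p"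
      by (auto simp: a' p kterm_def algebra_simps split: prod.splits)
    then show ?thesis
      using kterm_homological[where a = a and K = K and N = N and k = k and l = l, OF hom[OF kl(1)]] kl(2)
      by (simp add: p algebra_simps)
  qed
  note has = kterm_summable(2)[THEN has_sum_infsum, folded kform_def]
  have "((\<lambda>p. lin_symbol \<alpha> \<theta> \<epsilon> m * kterm K a a p + (- (\<i> * \<theta>)) * cnj (kterm K a a p)
      + (- 1) * kterm N a a p + kterm K n a p + kterm K a n p) has_sum
     (lin_symbol \<alpha> \<theta> \<epsilon> m * kform K a a m + (- (\<i> * \<theta>)) * cnj (kform K a a m)
      + (- 1) * kform N a a m + kform K n a m + kform K a n m)) (pairs m)"
    by (intro has_sum_add has_sum_cmult_right has_sum_cnj_iff[THEN iffD2] has[OF K s] has[OF N s] a n)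
  also have "lin_symbol \<alpha> \<theta> \<epsilon> m * kform K a a m + (- (\<i> * \<theta>)) * cnj (kform K a a m)
      + (- 1) * kform N a a m + kform K n a m + kform K a n m
      = lin_seq \<alpha> \<theta> \<epsilon> (kform K a a) m - kform N a a m + kform K n a m + kform K a n m"
    by (simp add: lin_seq_def)
  finally show ?thesis
    by (rule has_sum_cong[THEN iffD1, rotated]) (rule eq[symmetric])
qed

lemma kterm_has_vector_derivative:
  assumes "\<And>k. ((\<lambda>\<tau>. a \<tau> k) has_vector_derivative a' k) (at \<sigma> within I)"
  shows "((\<lambda>\<tau>. kterm K (a \<tau>) (a \<tau>) p) has_vector_derivative (kterm K a' (a \<sigma>) p + kterm K (a \<sigma>) a' p)) (at \<sigma> within I)"
proof -
  obtain k l where p: "p = (k, l)" by (cases p)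
  obtain c1 c2 c3 c4 where K: "K k l = (c1, c2, c3, c4)" by (cases "K k l")
  have cnj: "((\<lambda>\<tau>. cnj (a \<tau> k)) has_vector_derivative cnj (a' k)) (at \<sigma> within I)" for k
    by (rule has_vector_derivative_cnj[OF assms])
  have "((\<lambda>\<tau>. c1 * (a \<tau> k * a \<tau> l) + c2 * (a \<tau> k * cnj (a \<tau> l)) + c3 * (cnj (a \<tau> k) * a \<tau> l) + c4 * (cnj (a \<tau> k) * cnj (a \<tau> l)))
    has_vector_derivative (c1 * (a \<sigma> k * a' l + a' k * a \<sigma> l) + c2 * (a \<sigma> k * cnj (a' l) + a' k * cnj (a \<sigma> l))
      + c3 * (cnj (a \<sigma> k) * a' l + cnj (a' k) * a \<sigma> l) + c4 * (cnj (a \<sigma> k) * cnj (a' l) + cnj (a' k) * cnj (a \<sigma> l)))) (at \<sigma> within I)"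
    by (intro has_vector_derivative_add has_vector_derivative_mult_right has_vector_derivative_mult assms cnj)
  then show ?thesis
    by (simp add: p kterm_def K algebra_simps)
qed

lemma kform_has_vector_derivative:
  assumes K: "kbound B K" and N: "kbound B' N" and s: "s \<ge> 1"
    and hom: "\<And>k l. (k, l) \<in> modes \<Longrightarrow> hom_op \<alpha> \<theta> \<epsilon> k l (K k l) = N k l"
    and I: "is_interval I" and t: "t \<in> I"
    and a: "\<And>\<sigma>. \<sigma> \<in> I \<Longrightarrow> hseq s (a \<sigma>)"
    and n: "\<And>\<sigma>. n \<sigma> = kform N (a \<sigma>) (a \<sigma>)"
    and deriv: "\<And>\<sigma> k. \<sigma> \<in> I \<Longrightarrow> ((\<lambda>\<tau>. a \<tau> k) has_vector_derivative (lin_seq \<alpha> \<theta> \<epsilon> (a \<sigma>) k + n \<sigma> k)) (at \<sigma> within I)"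
    and cont: "((\<lambda>\<tau>. hnorm s (\<lambda>k. a \<tau> k - a t k)) \<longlongrightarrow> 0) (at t within I)"
  shows "((\<lambda>\<tau>. kform K (a \<tau>) (a \<tau>) m) has_vector_derivative
     (lin_seq \<alpha> \<theta> \<epsilon> (kform K (a t) (a t)) m - n t m + kform K (n t) (a t) m + kform K (a t) (n t) m)) (at t within I)"
proof -
  define a' where "a' \<sigma> = (\<lambda>k. lin_seq \<alpha> \<theta> \<epsilon> (a \<sigma>) k + n \<sigma> k)" for \<sigma>
  define q' where "q' p \<sigma> = kterm K (a' \<sigma>) (a \<sigma>) p + kterm K (a \<sigma>) (a' \<sigma>) p" for p \<sigma>
  have hn: "hseq s (n \<sigma>)" "hnorm s (n \<sigma>) \<le> 4 * B' * conv_const s * hnorm s (a \<sigma>) * hnorm s (a \<sigma>)" if "\<sigma> \<in> I" for \<sigma>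
    unfolding n using kform_hseq[OF N s a[OF that] a[OF that]] by auto
  have sum': "((\<lambda>p. q' p t) has_sum (lin_seq \<alpha> \<theta> \<epsilon> (kform K (a t) (a t)) m - kform N (a t) (a t) m
      + kform K (n t) (a t) m + kform K (a t) (n t) m)) (pairs m)"
    unfolding q'_def by (rule dterm_has_sum[OF K N s a[OF t] hn(1)[OF t] hom]) (auto simp: a'_def)
  have "((\<lambda>\<sigma>. \<Sum>\<^sub>\<infinity>p\<in>pairs m. kterm K (a \<sigma>) (a \<sigma>) p) has_vector_derivative (\<Sum>\<^sub>\<infinity>p\<in>pairs m. q' p t)) (at t within I)"
  proof (rule has_vector_derivative_infsum[OF I t])
    show "((\<lambda>\<tau>. kterm K (a \<tau>) (a \<tau>) p) has_vector_derivative q' p \<sigma>) (at \<sigma> within I)" if "\<sigma> \<in> I" for p \<sigma>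
      unfolding q'_def a'_def using deriv[OF that] by (rule kterm_has_vector_derivative)
    show "kterm K (a \<sigma>) (a \<sigma>) summable_on pairs m" if "\<sigma> \<in> I" for \<sigma>
      using kterm_summable(2)[OF K s a[OF that] a[OF that]] .
    show "(\<lambda>p. q' p t) summable_on pairs m"
      using sum' by (rule has_sum_imp_summable)
    fix e :: real assume e: "e > 0"
    have B: "B \<ge> 0" "B' \<ge> 0" using K N by (auto simp: kbound_def)
    define r where "r = hnorm s (a t) + 1"
    have r: "r \<ge> 1" by (simp add: r_def)
    define C where "C = 4 * B * (8 * lin_const \<alpha> \<theta> \<epsilon> * weight 1 m * r + 4 * B' * conv_const s * r * r) + 1"
    have C: "C \<ge> 1"
      using B r lin_const_nonneg[of \<alpha> \<theta> \<epsilon>] by (simp add: C_def)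
    \<comment> \<open>Each of the two projection norms will be at most 2\<eta>: \<eta> from the tail
      of \<open>a t\<close> and \<eta> from continuity in H^s. Hence the total is C * 4\<eta> =
      e.\<close>
    define \<eta> where "\<eta> = e / (4 * C)"
    have \<eta>: "\<eta> > 0" using e C by (simp add: \<eta>_def)
    obtain J where J: "finite J" "\<And>M. finite M \<Longrightarrow> M \<inter> J = {} \<Longrightarrow> L2w s (a t) M \<le> \<eta>"
      using hseq_tail[OF a[OF t] \<eta>] by blast
    \<comment> \<open>A pair is removed as soon as one of its entries is in \<open>J\<close>, so
      both projections of a set disjoint from \<open>F\<close> avoid \<open>J\<close>.\<close>
    define F where "F = {p \<in> pairs m. fst p \<in> J \<or> snd p \<in> J}"
    have "F \<subseteq> (\<lambda>k. (k, m - k)) ` J \<union> (\<lambda>l. (m - l, l)) ` J"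
      by (force simp: F_def pairs_def image_iff)
    then have F: "finite F" "F \<subseteq> pairs m" using J(1) by (auto simp: F_def intro: finite_subset)
    have "\<forall>\<^sub>F \<tau> in at t within I. hnorm s (\<lambda>k. a \<tau> k - a t k) < min 1 \<eta>"
      using order_tendstoD(2)[OF cont, of "min 1 \<eta>"] \<eta> by simp
    then obtain d where d: "d > 0" "\<And>\<tau>. \<tau> \<in> I \<Longrightarrow> \<tau> \<noteq> t \<Longrightarrow> dist \<tau> t < d \<Longrightarrow> hnorm s (\<lambda>k. a \<tau> k - a t k) < min 1 \<eta>"
      unfolding eventually_at by blast
    have close: "hnorm s (\<lambda>k. a \<tau> k - a t k) \<le> min 1 \<eta>" if "\<tau> \<in> I" "\<bar>\<tau> - t\<bar> < d" for \<tau>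
    proof (cases "\<tau> = t")
      case False
      then show ?thesis using d(2)[OF that(1)] that(2) by (simp add: dist_real_def less_imp_le)
    qed (use \<eta> in simp)
    have "norm (\<Sum>p\<in>F'. q' p \<sigma>) \<le> e"
      if \<sigma>: "\<sigma> \<in> I" "\<bar>\<sigma> - t\<bar> < d" and F': "finite F'" "F' \<subseteq> pairs m - F" for \<sigma> F'
    proof -
      have hd: "hseq s (\<lambda>k. a \<sigma> k - a t k)" using a[OF \<sigma>(1)] a[OF t] by (rule hseq_diff)
      have "hnorm s (a \<sigma>) \<le> r"
        using hseq_add(2)[OF hd a[OF t]] close[OF \<sigma>] by (simp add: r_def)
      moreover have L2: "L2w s (a \<sigma>) M \<le> 2 * \<eta>" if "finite M" "M \<inter> J = {}" for M
        using L2w_add[of s "\<lambda>k. a \<sigma> k - a t k" "a t" M] L2w_le_hnorm[OF hd, of M] close[OF \<sigma>] J(2)[OF that]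
        by simp
      moreover have "fst ` F' \<inter> J = {}" "snd ` F' \<inter> J = {}"
        using F'(2) by (auto simp: F_def)
      ultimately have *: "hnorm s (a \<sigma>) \<le> r" "L2w s (a \<sigma>) (fst ` F') \<le> 2 * \<eta>" "L2w s (a \<sigma>) (snd ` F') \<le> 2 * \<eta>"
        using F'(1) by auto
      have "hnorm s (n \<sigma>) \<le> 4 * B' * conv_const s * r * r"
        by (rule order_trans[OF hn(2)[OF \<sigma>(1)]]) (use *(1) B r in \<open>intro mult_mono mult_left_mono; simp\<close>)
      then have "4 * B * (8 * lin_const \<alpha> \<theta> \<epsilon> * weight 1 m * hnorm s (a \<sigma>) + hnorm s (n \<sigma>)) \<le> C - 1"
        using B *(1) lin_const_nonneg[of \<alpha> \<theta> \<epsilon>] unfolding C_def add_diff_cancel_right'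
        by (intro mult_left_mono add_mono) auto
      then have C': "4 * B * (8 * lin_const \<alpha> \<theta> \<epsilon> * weight 1 m * hnorm s (a \<sigma>) + hnorm s (n \<sigma>)) \<le> C"
        by simp
      have "norm (\<Sum>p\<in>F'. q' p \<sigma>) \<le> (\<Sum>p\<in>F'. cmod (q' p \<sigma>))" by (rule norm_sum)
      also have "\<dots> \<le> 4 * B * (8 * lin_const \<alpha> \<theta> \<epsilon> * weight 1 m * hnorm s (a \<sigma>) + hnorm s (n \<sigma>))
          * (L2w s (a \<sigma>) (fst ` F') + L2w s (a \<sigma>) (snd ` F'))"
        unfolding q'_def using F' by (intro dterm_bound[OF K s a[OF \<sigma>(1)] hn(1)[OF \<sigma>(1)]]) (auto simp: a'_def)
      also have "\<dots> \<le> C * (2 * \<eta> + 2 * \<eta>)"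
        using C C' * by (intro mult_mono add_mono) auto
      also have "\<dots> = e" using C by (simp add: \<eta>_def)
      finally show ?thesis .
    qed
    then show "\<exists>F d. finite F \<and> F \<subseteq> pairs m \<and> d > 0 \<and> (\<forall>\<sigma>\<in>I. \<bar>\<sigma> - t\<bar> < d \<longrightarrow>
        (\<forall>F'. finite F' \<longrightarrow> F' \<subseteq> pairs m - F \<longrightarrow> norm (\<Sum>p\<in>F'. q' p \<sigma>) \<le> e))"
      using F d(1) by blast
  qed
  then show ?thesis
    unfolding kform_def[symmetric] infsumI[OF sum'] n[symmetric] .
qed

subsection \<open>The normal form map and its remainder on coefficients\<close>

definition nf_seq :: "(int \<Rightarrow> int \<Rightarrow> coeffs) \<Rightarrow> (int \<Rightarrow> complex) \<Rightarrow> int \<Rightarrow> complex" where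
  "nf_seq K a m = a m + kform K a a m"

definition rem_seq :: "(int \<Rightarrow> int \<Rightarrow> coeffs) \<Rightarrow> (int \<Rightarrow> int \<Rightarrow> coeffs) \<Rightarrow> (int \<Rightarrow> complex) \<Rightarrow> int \<Rightarrow> complex" where
  "rem_seq K N a m = kform K (kform N a a) a m + kform K a (kform N a a) m"

context
  fixes K N :: "int \<Rightarrow> int \<Rightarrow> coeffs" and B B' s D E \<rho> :: real
  assumes KB: "kbound B K" and NB: "kbound B' N" and s: "s \<ge> 1"
    and D: "D = 4 * B * conv_const s" and E: "E = 4 * B' * conv_const s"
    and \<rho>: "\<rho> = 1 / (4 * (D + 1))"
begin

text \<open>\<rho> is chosen so that on the ball of radius \<rho> the quadratic form has Lipschitz
  constant 1/4 + 1/4 = 1/2; D + 1 avoids a zero denominator.\<close>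

lemma nf_consts: "D \<ge> 0" "E \<ge> 0" "\<rho> > 0" "D * \<rho> \<le> 1 / 4"
proof -
  show 1: "D \<ge> 0" "E \<ge> 0" using KB NB by (auto simp: D E kbound_def)
  show "\<rho> > 0" "D * \<rho> \<le> 1 / 4" using 1 by (auto simp: \<rho> field_simps)
qed

lemma kform_K: "hseq s a \<Longrightarrow> hseq s b \<Longrightarrow> hseq s (kform K a b)"
  "hseq s a \<Longrightarrow> hseq s b \<Longrightarrow> hnorm s (kform K a b) \<le> D * hnorm s a * hnorm s b"
  using kform_hseq[OF KB s] by (auto simp: D)

lemma kform_N: "hseq s a \<Longrightarrow> hseq s b \<Longrightarrow> hseq s (kform N a b)"
  "hseq s a \<Longrightarrow> hseq s b \<Longrightarrow> hnorm s (kform N a b) \<le> E * hnorm s a * hnorm s b"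
  using kform_hseq[OF NB s] by (auto simp: E)

lemma D_small:
  assumes "hnorm s a < \<rho>"
  shows "D * hnorm s a \<le> 1 / 4"
  using mult_left_mono[of "hnorm s a" \<rho> D] assms nf_consts by linarith

lemma nf_seq_hseq:
  assumes a: "hseq s a"
  shows "hseq s (nf_seq K a)"
  unfolding nf_seq_def[abs_def] using a by (intro hseq_add kform_K)

lemma nf_seq_upper:
  assumes a: "hseq s a" and small: "hnorm s a < \<rho>"
  shows "hnorm s (nf_seq K a) < 2 * \<rho>"
proof -
  have "hnorm s (nf_seq K a) \<le> hnorm s a + D * hnorm s a * hnorm s a"
    unfolding nf_seq_def[abs_def] using hseq_add(2)[OF a kform_K(1)[OF a a]] kform_K(2)[OF a a] by linarith
  also have "D * hnorm s a * hnorm s a \<le> 1 / 4 * hnorm s a"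
    using D_small[OF small] by (rule mult_right_mono) simp
  finally show ?thesis using small hnorm_nonneg[of s a] by linarith
qed

text \<open>The quadratic part is at most a quarter of \<open>a\<close>. This lets a bound in terms
  of f be restated in terms of g.\<close>

lemma nf_seq_lower:
  assumes a: "hseq s a" and small: "hnorm s a < \<rho>"
  shows "hnorm s a \<le> 2 * hnorm s (nf_seq K a)"
proof -
  have eq: "(\<lambda>m. nf_seq K a m - kform K a a m) = a" by (simp add: nf_seq_def)
  have "hnorm s a \<le> hnorm s (nf_seq K a) + D * hnorm s a * hnorm s a"
    using hseq_diff(2)[OF nf_seq_hseq[OF a] kform_K(1)[OF a a], unfolded eq] kform_K(2)[OF a a] by linarith
  also have "D * hnorm s a * hnorm s a \<le> 1 / 4 * hnorm s a"
    using D_small[OF small] by (rule mult_right_mono) simp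
  finally show ?thesis using hnorm_nonneg[of s a] by linarith
qed

lemma kform_diff_bound:
  assumes a: "hseq s a" "hnorm s a < \<rho>" and b: "hseq s b" "hnorm s b < \<rho>"
  shows "hnorm s (\<lambda>m. kform K a a m - kform K b b m) \<le> 1 / 2 * hnorm s (\<lambda>k. a k - b k)"
proof -
  define d where "d = (\<lambda>k. a k - b k)"
  have d: "hseq s d" unfolding d_def using a b by (intro hseq_diff)
  have "hnorm s (\<lambda>m. kform K a a m - kform K b b m) \<le> hnorm s (kform K d a) + hnorm s (kform K b d)"
    unfolding kform_diff[OF KB s a(1) b(1)] d_def[symmetric]
    using hseq_add(2)[OF kform_K(1)[OF d a(1)] kform_K(1)[OF b(1) d]] .
  also have "\<dots> \<le> D * hnorm s a * hnorm s d + D * hnorm s b * hnorm s d"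
    using kform_K(2)[OF d a(1)] kform_K(2)[OF b(1) d] by (simp add: mult_ac)
  also have "\<dots> \<le> 1 / 4 * hnorm s d + 1 / 4 * hnorm s d"
    using D_small[OF a(2)] D_small[OF b(2)] by (intro add_mono mult_right_mono) auto
  finally show ?thesis by (simp add: d_def)
qed

text \<open>Lipschitz continuity of the transformation carries continuity in time from f over to
  g.\<close>

lemma nf_seq_diff_bound:
  assumes a: "hseq s a" "hnorm s a < \<rho>" and b: "hseq s b" "hnorm s b < \<rho>"
  shows "hnorm s (\<lambda>k. nf_seq K a k - nf_seq K b k) \<le> 2 * hnorm s (\<lambda>k. a k - b k)"
proof -
  have eq: "(\<lambda>k. nf_seq K a k - nf_seq K b k) = (\<lambda>k. (a k - b k) + (kform K a a k - kform K b b k))"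
    by (simp add: nf_seq_def fun_eq_iff)
  show ?thesis
    unfolding eq using hseq_add(2)[OF hseq_diff(1)[OF a(1) b(1)] hseq_diff(1)[OF kform_K(1)[OF a(1) a(1)] kform_K(1)[OF b(1) b(1)]]]
      kform_diff_bound[OF a b] hnorm_nonneg[of s "\<lambda>k. a k - b k"] by linarith
qed

text \<open>If the images agree, the difference of the arguments equals minus the difference of the
  quadratic parts, whose norm is at most half as large.\<close>

lemma nf_seq_inj:
  assumes a: "hseq s a" "hnorm s a < \<rho>" and b: "hseq s b" "hnorm s b < \<rho>" and eq: "nf_seq K a = nf_seq K b"
  shows "a = b"
proof
  fix k
  have "a k - b k = - (kform K a a k - kform K b b k)" for k
    using fun_cong[OF eq, of k] by (simp add: nf_seq_def algebra_simps)
  then have "hnorm s (\<lambda>k. a k - b k) = hnorm s (\<lambda>k. kform K a a k - kform K b b k)"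
    using hseq_minus(2)[OF hseq_diff(1)[OF kform_K(1)[OF a(1) a(1)] kform_K(1)[OF b(1) b(1)]]] by simp
  then have "hnorm s (\<lambda>k. a k - b k) \<le> 0"
    using kform_diff_bound[OF a b] hnorm_nonneg[of s "\<lambda>k. a k - b k"] by linarith
  then show "a k = b k" using hnorm_eq_0D[OF hseq_diff(1)[OF a(1) b(1)]] by (metis eq_iff_diff_eq_0)
qed

lemma rem_seq_bound:
  assumes a: "hseq s a"
  shows "hnorm s (rem_seq K N a) \<le> 2 * D * E * hnorm s a ^ 3"
proof -
  note n = kform_N[OF a a]
  have "hnorm s (rem_seq K N a) \<le> D * hnorm s (kform N a a) * hnorm s a + D * hnorm s a * hnorm s (kform N a a)"
    unfolding rem_seq_def[abs_def]
    using hseq_add(2)[OF kform_K(1)[OF n(1) a] kform_K(1)[OF a n(1)]] kform_K(2)[OF n(1) a] kform_K(2)[OF a n(1)]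
    by linarith
  also have "\<dots> = 2 * D * hnorm s a * hnorm s (kform N a a)" by simp
  also have "\<dots> \<le> 2 * D * hnorm s a * (E * hnorm s a * hnorm s a)"
    using n(2) nf_consts by (intro mult_left_mono) auto
  finally show ?thesis by (simp add: power3_eq_cube mult_ac)
qed

lemma rem_seq_eseq:
  assumes "keven K" "keven N" "eseq s a"
  shows "eseq s (rem_seq K N a)"
  unfolding rem_seq_def[abs_def] using assms
  by (intro eseq_add kform_eseq[OF KB] kform_eseq[OF NB] s)

end

section \<open>From sequences back to functions and to the equation in time\<close>

lemma normal_form_transforms:
  assumes K: "\<And>k l. (k, l) \<in> modes \<Longrightarrow> K k l = (K1 k l, K2 k l, K2 l k, K3 k l)"
    and KB: "kbound B K" and KE: "keven K" and s: "s \<ge> 1"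
    and hom: "\<And>k l. (k, l) \<in> modes \<Longrightarrow> hom_op \<alpha> (2 * \<omega>\<^sup>2) \<epsilon> k l (K k l) = N2_coeffs \<omega>"
    and D: "D = 4 * B * conv_const s" and E: "E = 4 * norm (N2_coeffs \<omega>) * conv_const s"
    and \<rho>: "\<rho> = 1 / (4 * (D + 1))" and \<Phi>: "\<Phi> = normal_form K1 K2 K3"
  shows "(\<forall>u\<in>even_sobolev0 s.
             (\<lambda>p. cmod (K_coeff K1 K2 K3 u p)) summable_on modes \<and>
             \<Phi> u \<in> even_sobolev0 s \<and>
             (sobolev_norm s u < \<rho> \<longrightarrow> sobolev_norm s (\<Phi> u) < 2 * \<rho>)) \<and>
          (\<exists>R :: (real \<Rightarrow> complex) \<Rightarrow> real \<Rightarrow> complex.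
             (\<forall>v\<in>even_sobolev0 s. sobolev_norm s v < 2 * \<rho> \<longrightarrow>
                R v \<in> even_sobolev0 s \<and> sobolev_norm s (R v) \<le> (16 * D * E) * sobolev_norm s v ^ 3) \<and>
             (\<forall>I f. is_interval I \<longrightarrow>
                solves \<alpha> \<omega> \<epsilon> (\<lambda>u x. - \<i> * N2 \<omega> u x) s I f \<longrightarrow>
                (\<forall>t\<in>I. sobolev_norm s (f t) < \<rho>) \<longrightarrow>
                solves \<alpha> \<omega> \<epsilon> R s I (\<lambda>t. \<Phi> (f t))))"
proof -
  define N where "N = (\<lambda>(_::int) (_::int). N2_coeffs \<omega>)"
  have NB: "kbound (norm (N2_coeffs \<omega>)) N" and NE: "keven N"
    unfolding N_def by (rule kbound_N2, rule keven_N2)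
  note ctx = KB NB s D E \<rho>
  have hom: "hom_op \<alpha> (2 * \<omega>\<^sup>2) \<epsilon> k l (K k l) = N k l" if "(k, l) \<in> modes" for k l
    using hom[OF that] by (simp add: N_def)
  define nf where "nf = nf_seq K"
  define rm where "rm = rem_seq K N"
  have \<Phi>_in: "\<Phi> u \<in> even_sobolev0 s" if "u \<in> even_sobolev0 s" for u
    unfolding \<Phi> by (rule normal_form_properties(1)[OF K KB KE s that])
  have \<Phi>_hat: "fourier (\<Phi> u) = nf (fourier u)" if "u \<in> even_sobolev0 s" for u
    unfolding \<Phi> nf_def nf_seq_def[abs_def] by (rule normal_form_properties(2)[OF K KB KE s that])
  define P where "P v a \<longleftrightarrow> eseq s a \<and> hnorm s a < \<rho> \<and> nf a = fourier v" for v a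
  have P_unique: "a = b" if "P v a" "P v b" for v a b
  proof (rule nf_seq_inj[OF ctx])
    show "hseq s a" "hnorm s a < \<rho>" "hseq s b" "hnorm s b < \<rho>" "nf_seq K a = nf_seq K b"
      using that unfolding P_def eseq_def nf_def by simp_all
  qed
  \<comment> \<open>The remainder must depend on g alone. Injectivity on the small ball makes the
    chosen preimage unique; off the image of the ball the value 0 satisfies the cubic bound
    trivially, so no surjectivity has to be shown.\<close>
  define r where "r v = (if \<exists>a. P v a then rm (SOME a. P v a) else (\<lambda>_. 0))" for v
  have r_eq: "r v = rm a" if "P v a" for v a
  proof -
    have "P v (SOME a. P v a)" using someI[of "P v", OF that] .
    then have "(SOME a. P v a) = a" using that by (rule P_unique)
    then show ?thesis using that unfolding r_def by auto
  qed
  have r_eseq: "eseq s (r v)" for v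
  proof (cases "\<exists>a. P v a")
    case True
    then obtain a where a: "P v a" ..
    then show ?thesis
      unfolding r_eq[OF a] rm_def using KE NE by (intro rem_seq_eseq[OF ctx]) (auto simp: P_def)
  qed (simp add: r_def eseq_def)
  have r_bound: "hnorm s (r v) \<le> (16 * D * E) * hnorm s (fourier v) ^ 3" for v
  proof (cases "\<exists>a. P v a")
    case True
    then obtain a where a: "P v a" ..
    then have a': "hseq s a" "hnorm s a < \<rho>" "nf a = fourier v" by (auto simp: P_def eseq_def)
    have "hnorm s (r v) \<le> 2 * D * E * hnorm s a ^ 3"
      unfolding r_eq[OF a] rm_def by (rule rem_seq_bound[OF ctx a'(1)])
    \<comment> \<open>Passing from the preimage to g costs 2^3 = 8, which gives 16 D E.\<close>
    also have "\<dots> \<le> 2 * D * E * (2 * hnorm s (fourier v)) ^ 3"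
      using nf_seq_lower[OF ctx a'(1,2)] a'(3) nf_consts[OF ctx]
      by (intro mult_left_mono power_mono) (auto simp: nf_def)
    finally show ?thesis by (simp add: power_mult_distrib)
  next
    case False
    then show ?thesis using nf_consts[OF ctx] by (simp add: r_def)
  qed
  define R where "R v = trig_series UNIV id (r v)" for v
  have R: "R v \<in> even_sobolev0 s" "fourier (R v) = r v" for v
    unfolding R_def by (rule trig_series_even_sobolev0[OF s r_eseq])+
  show ?thesis
  proof (intro conjI ballI impI exI[of _ R] allI)
    fix u assume u: "u \<in> even_sobolev0 s"
    show "(\<lambda>p. cmod (K_coeff K1 K2 K3 u p)) summable_on modes"
      by (rule K_coeff_summable[OF K KB KE s u])
    show "\<Phi> u \<in> even_sobolev0 s" by (rule \<Phi>_in[OF u])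
    assume "sobolev_norm s u < \<rho>"
    then show "sobolev_norm s (\<Phi> u) < 2 * \<rho>"
      unfolding sobolev_norm_fourier \<Phi>_hat[OF u] nf_def
      by (intro nf_seq_upper[OF ctx] eseqD(1)[OF even_sobolev0_eseq[OF u]])
  next
    fix v
    show "R v \<in> even_sobolev0 s" by (rule R)
    show "sobolev_norm s (R v) \<le> (16 * D * E) * sobolev_norm s v ^ 3"
      unfolding sobolev_norm_fourier R using r_bound .
  next
    fix I :: "real set" and f
    assume I: "is_interval I" and sol: "solves \<alpha> \<omega> \<epsilon> (\<lambda>u x. - \<i> * N2 \<omega> u x) s I f"
      and small: "\<forall>t\<in>I. sobolev_norm s (f t) < \<rho>"
    define a where "a t = fourier (f t)" for t
    have f: "f t \<in> even_sobolev0 s" if "t \<in> I" for t using sol that by (simp add: solves_def)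
    have a: "eseq s (a t)" "hseq s (a t)" "hnorm s (a t) < \<rho>" if "t \<in> I" for t
      using even_sobolev0_eseq[OF f[OF that]] small that by (auto simp: a_def eseq_def sobolev_norm_fourier)
    have int: "integrable circ (f t)" "integrable circ (\<Phi> (f t))" if "t \<in> I" for t
      using f[OF that] \<Phi>_in[OF f[OF that]] by (auto intro!: sobolev_integrable even_sobolev0_sobolev)
    have fourier_diff': "fourier (\<lambda>x. u x - v x) = (\<lambda>k. fourier u k - fourier v k)"
      if "integrable circ u" "integrable circ v" for u v
      using fourier_diff[OF that] by auto
    have diff_f: "sobolev_norm s (\<lambda>x. f \<tau> x - f t x) = hnorm s (\<lambda>k. a \<tau> k - a t k)" if "\<tau> \<in> I" "t \<in> I" for \<tau> t
      using fourier_diff'[OF int(1)[OF that(1)] int(1)[OF that(2)]] by (simp add: sobolev_norm_fourier a_def)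
    have diff_\<Phi>: "sobolev_norm s (\<lambda>x. \<Phi> (f \<tau>) x - \<Phi> (f t) x) = hnorm s (\<lambda>k. nf (a \<tau>) k - nf (a t) k)"
      if "\<tau> \<in> I" "t \<in> I" for \<tau> t
      using fourier_diff'[OF int(2)[OF that(1)] int(2)[OF that(2)]]
      by (simp add: sobolev_norm_fourier a_def \<Phi>_hat[OF f[OF that(1)]] \<Phi>_hat[OF f[OF that(2)]])
    have in_I: "\<forall>\<^sub>F \<tau> in at t within I. \<tau> \<in> I" for t
      by (auto simp: eventually_at intro: exI[of _ 1])
    have cont: "((\<lambda>\<tau>. hnorm s (\<lambda>k. a \<tau> k - a t k)) \<longlongrightarrow> 0) (at t within I)" if t: "t \<in> I" for t
    proof -
      have "((\<lambda>\<tau>. sobolev_norm s (\<lambda>x. f \<tau> x - f t x)) \<longlongrightarrow> 0) (at t within I)"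
        using sol t by (simp add: solves_def)
      then show ?thesis
        by (rule Lim_transform_eventually) (use in_I[of t] in \<open>auto elim!: eventually_mono simp: diff_f t\<close>)
    qed
    define n where "n t = kform N (a t) (a t)" for t
    have deriv: "((\<lambda>\<tau>. a \<tau> k) has_vector_derivative (lin_seq \<alpha> (2 * \<omega>\<^sup>2) \<epsilon> (a t) k + n t k)) (at t within I)"
      if t: "t \<in> I" for t k
    proof -
      have "L_hat \<alpha> \<omega> \<epsilon> (f t) k = lin_seq \<alpha> (2 * \<omega>\<^sup>2) \<epsilon> (a t) k"
        unfolding a_def using eseqD(3)[OF a(1)[OF t]] by (intro L_hat_lin_seq) (simp add: a_def)
      moreover have "fourier (\<lambda>x. - \<i> * N2 \<omega> (f t) x) k = n t k"
        using fourier_N2[OF s f[OF t]] by (simp add: n_def a_def N_def)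
      moreover have "((\<lambda>\<tau>. fourier (f \<tau>) k) has_vector_derivative
          (L_hat \<alpha> \<omega> \<epsilon> (f t) k + fourier (\<lambda>x. - \<i> * N2 \<omega> (f t) x) k)) (at t within I)"
        using sol t unfolding solves_def by blast
      ultimately show ?thesis by (simp add: a_def)
    qed
    show "solves \<alpha> \<omega> \<epsilon> R s I (\<lambda>t. \<Phi> (f t))"
      unfolding solves_def
    proof (intro conjI ballI allI)
      fix t assume t: "t \<in> I"
      show \<Phi>_t: "\<Phi> (f t) \<in> even_sobolev0 s" by (rule \<Phi>_in[OF f[OF t]])
      show "((\<lambda>\<tau>. sobolev_norm s (\<lambda>x. \<Phi> (f \<tau>) x - \<Phi> (f t) x)) \<longlongrightarrow> 0) (at t within I)"
      proof (rule Lim_null_comparison)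
        show "\<forall>\<^sub>F \<tau> in at t within I. norm (sobolev_norm s (\<lambda>x. \<Phi> (f \<tau>) x - \<Phi> (f t) x)) \<le> 2 * hnorm s (\<lambda>k. a \<tau> k - a t k)"
          using in_I[of t]
        proof eventually_elim
          case (elim \<tau>)
          then show ?case
            using nf_seq_diff_bound[OF ctx a(2,3)[OF elim] a(2,3)[OF t]] by (simp add: diff_\<Phi> t nf_def)
        qed
        show "((\<lambda>\<tau>. 2 * hnorm s (\<lambda>k. a \<tau> k - a t k)) \<longlongrightarrow> 0) (at t within I)"
          using tendsto_mult_right_zero[OF cont[OF t]] .
      qed
      fix m
      \<comment> \<open>Along a small solution the selected preimage is f itself, so R evaluated at
        g is the remainder produced by the differentiation.\<close>
      have "P (\<Phi> (f t)) (a t)"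
        using a[OF t] by (simp add: P_def \<Phi>_hat[OF f[OF t]] a_def)
      then have R_hat: "fourier (R (\<Phi> (f t))) m = kform K (n t) (a t) m + kform K (a t) (n t) m"
        by (simp add: R r_eq rm_def rem_seq_def n_def)
      have "fourier (\<Phi> (f t)) (- k) = fourier (\<Phi> (f t)) k" for k
        using eseqD(3)[OF even_sobolev0_eseq[OF \<Phi>_t]] .
      then have L: "L_hat \<alpha> \<omega> \<epsilon> (\<Phi> (f t)) m
          = lin_seq \<alpha> (2 * \<omega>\<^sup>2) \<epsilon> (a t) m + lin_seq \<alpha> (2 * \<omega>\<^sup>2) \<epsilon> (kform K (a t) (a t)) m"
        by (simp add: L_hat_lin_seq \<Phi>_hat[OF f[OF t]] nf_def nf_seq_def[abs_def] a_def lin_seq_add)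
      have "((\<lambda>\<tau>. kform K (a \<tau>) (a \<tau>) m) has_vector_derivative
        (lin_seq \<alpha> (2 * \<omega>\<^sup>2) \<epsilon> (kform K (a t) (a t)) m - n t m + kform K (n t) (a t) m + kform K (a t) (n t) m)) (at t within I)"
        by (rule kform_has_vector_derivative[OF KB NB s hom I t a(2) n_def deriv cont[OF t]])
      from has_vector_derivative_add[OF deriv[OF t, of m] this]
      have "((\<lambda>\<tau>. a \<tau> m + kform K (a \<tau>) (a \<tau>) m) has_vector_derivative
          (L_hat \<alpha> \<omega> \<epsilon> (\<Phi> (f t)) m + fourier (R (\<Phi> (f t))) m)) (at t within I)"
        by (simp add: L R_hat algebra_simps)
      then show "((\<lambda>\<tau>. fourier (\<Phi> (f \<tau>)) m) has_vector_derivative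
          (L_hat \<alpha> \<omega> \<epsilon> (\<Phi> (f t)) m + fourier (R (\<Phi> (f t))) m)) (at t within I)"
        by (rule has_vector_derivative_transform[OF t, rotated])
           (simp add: \<Phi>_hat[OF f] nf_def nf_seq_def a_def)
    qed
  qed
qed

theorem lemma2p2:
  fixes \<alpha> :: real
  assumes "\<alpha> > 0"
  shows "\<exists>S. finite S \<and> S \<subseteq> {1/2<..<3/2::real} \<and>
    (\<forall>\<omega>\<in>{1/2<..<3/2} - S. \<exists>\<epsilon>\<^sub>0>0. \<exists>K1 K2 K3 :: real \<Rightarrow> kernel.
       (\<forall>\<epsilon>\<in>{0..\<epsilon>\<^sub>0}. \<forall>(k, l)\<in>modes. K1 \<epsilon> k l = K1 \<epsilon> l k \<and> K3 \<epsilon> k l = K3 \<epsilon> l k) \<and>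
       (\<forall>s\<ge>1. \<exists>\<rho>>0. \<exists>\<delta>>0. \<exists>C. \<forall>\<epsilon>\<in>{0..\<epsilon>\<^sub>0}.
          let \<Phi> = normal_form (K1 \<epsilon>) (K2 \<epsilon>) (K3 \<epsilon>) in
          (\<forall>u\<in>even_sobolev0 s.
             (\<lambda>p. cmod (K_coeff (K1 \<epsilon>) (K2 \<epsilon>) (K3 \<epsilon>) u p)) summable_on modes \<and>
             \<Phi> u \<in> even_sobolev0 s \<and>
             (sobolev_norm s u < \<rho> \<longrightarrow> sobolev_norm s (\<Phi> u) < \<delta>)) \<and>
          (\<exists>R :: (real \<Rightarrow> complex) \<Rightarrow> real \<Rightarrow> complex.
             (\<forall>v\<in>even_sobolev0 s. sobolev_norm s v < \<delta> \<longrightarrow>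
                R v \<in> even_sobolev0 s \<and> sobolev_norm s (R v) \<le> C * sobolev_norm s v ^ 3) \<and>
             (\<forall>I f. is_interval I \<longrightarrow>
                solves \<alpha> \<omega> \<epsilon> (\<lambda>u x. - \<i> * N2 \<omega> u x) s I f \<longrightarrow>
                (\<forall>t\<in>I. sobolev_norm s (f t) < \<rho>) \<longrightarrow>
                solves \<alpha> \<omega> \<epsilon> R s I (\<lambda>t. \<Phi> (f t))))))"
proof (intro exI[of _ res_set] conjI ballI)
  show "finite res_set" by (rule finite_res_set)
  show "res_set \<subseteq> {1/2<..<3/2}" by (auto simp: res_set_def)
  fix \<omega> :: real assume "\<omega> \<in> {1/2<..<3/2} - res_set"
  from homological_solution[OF this, of \<alpha>] obtain e B K where e: "e > 0"
    and sol: "\<And>\<epsilon> k l. \<epsilon> \<in> {0..e} \<Longrightarrow> (k, l) \<in> modes \<Longrightarrow>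
       hom_op \<alpha> (2 * \<omega>\<^sup>2) \<epsilon> k l (K \<epsilon> k l) = N2_coeffs \<omega> \<and> norm (K \<epsilon> k l) \<le> B \<and>
       K \<epsilon> l k = swap_coeffs (K \<epsilon> k l) \<and> K \<epsilon> (- k) (- l) = K \<epsilon> k l"
    by blast
  define K1 K2 K3 :: "real \<Rightarrow> kernel" where "K1 \<epsilon> k l = fst (K \<epsilon> k l)" and "K2 \<epsilon> k l = fst (snd (K \<epsilon> k l))"
    and "K3 \<epsilon> k l = snd (snd (snd (K \<epsilon> k l)))" for \<epsilon> k l
  have swap: "K \<epsilon> l k = swap_coeffs (K \<epsilon> k l)" if "\<epsilon> \<in> {0..e}" "(k, l) \<in> modes" for \<epsilon> k l
    using sol[OF that] by simp
  have K: "K \<epsilon> k l = (K1 \<epsilon> k l, K2 \<epsilon> k l, K2 \<epsilon> l k, K3 \<epsilon> k l)" if "\<epsilon> \<in> {0..e}" "(k, l) \<in> modes" for \<epsilon> k l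
    by (cases "K \<epsilon> k l") (simp add: K1_def K2_def K3_def swap[OF that] swap_coeffs_def)
  \<comment> \<open>\<open>B\<close> comes only as an upper bound for norms; \<open>kbound\<close>
    also asks for a nonnegative constant.\<close>
  have KB: "kbound (max 0 B) (K \<epsilon>)" if "\<epsilon> \<in> {0..e}" for \<epsilon>
    using sol[OF that] by (auto simp: kbound_def le_max_iff_disj)
  have KE: "keven (K \<epsilon>)" if "\<epsilon> \<in> {0..e}" for \<epsilon>
    using sol[OF that] by (auto simp: keven_def)
  show "\<exists>\<epsilon>\<^sub>0>0. \<exists>K1 K2 K3 :: real \<Rightarrow> kernel.
       (\<forall>\<epsilon>\<in>{0..\<epsilon>\<^sub>0}. \<forall>(k, l)\<in>modes. K1 \<epsilon> k l = K1 \<epsilon> l k \<and> K3 \<epsilon> k l = K3 \<epsilon> l k) \<and>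
       (\<forall>s\<ge>1. \<exists>\<rho>>0. \<exists>\<delta>>0. \<exists>C. \<forall>\<epsilon>\<in>{0..\<epsilon>\<^sub>0}.
          let \<Phi> = normal_form (K1 \<epsilon>) (K2 \<epsilon>) (K3 \<epsilon>) in
          (\<forall>u\<in>even_sobolev0 s.
             (\<lambda>p. cmod (K_coeff (K1 \<epsilon>) (K2 \<epsilon>) (K3 \<epsilon>) u p)) summable_on modes \<and>
             \<Phi> u \<in> even_sobolev0 s \<and>
             (sobolev_norm s u < \<rho> \<longrightarrow> sobolev_norm s (\<Phi> u) < \<delta>)) \<and>
          (\<exists>R :: (real \<Rightarrow> complex) \<Rightarrow> real \<Rightarrow> complex.
             (\<forall>v\<in>even_sobolev0 s. sobolev_norm s v < \<delta> \<longrightarrow>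
                R v \<in> even_sobolev0 s \<and> sobolev_norm s (R v) \<le> C * sobolev_norm s v ^ 3) \<and>
             (\<forall>I f. is_interval I \<longrightarrow>
                solves \<alpha> \<omega> \<epsilon> (\<lambda>u x. - \<i> * N2 \<omega> u x) s I f \<longrightarrow>
                (\<forall>t\<in>I. sobolev_norm s (f t) < \<rho>) \<longrightarrow>
                solves \<alpha> \<omega> \<epsilon> R s I (\<lambda>t. \<Phi> (f t)))))"
  proof (rule exI[of _ e], rule conjI[OF e], rule exI[of _ K1], rule exI[of _ K2], rule exI[of _ K3],
      rule conjI[rotated], rule allI, rule impI)
    show "\<forall>\<epsilon>\<in>{0..e}. \<forall>(k, l)\<in>modes. K1 \<epsilon> k l = K1 \<epsilon> l k \<and> K3 \<epsilon> k l = K3 \<epsilon> l k"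
    proof (intro ballI)
      fix \<epsilon> and p :: "int \<times> int" assume "\<epsilon> \<in> {0..e}" "p \<in> modes"
      then have "K \<epsilon> (snd p) (fst p) = swap_coeffs (K \<epsilon> (fst p) (snd p))" using swap[of \<epsilon> "fst p" "snd p"] by simp
      then show "case p of (k, l) \<Rightarrow> K1 \<epsilon> k l = K1 \<epsilon> l k \<and> K3 \<epsilon> k l = K3 \<epsilon> l k"
        by (simp add: K1_def K3_def swap_coeffs_def case_prod_unfold)
    qed
    fix s :: real assume s: "s \<ge> 1"
    \<comment> \<open>The kernels and the range of \<epsilon> are fixed before s; radii and
      constants depend on s through \<open>conv_const s\<close> and are the same for all
      \<epsilon>.\<close>
    define D where "D = 4 * max 0 B * conv_const s"
    define E where "E = 4 * norm (N2_coeffs \<omega>) * conv_const s"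
    define \<rho> where "\<rho> = 1 / (4 * (D + 1))"
    have \<rho>: "\<rho> > 0" "2 * \<rho> > 0" by (simp_all add: \<rho>_def D_def add_nonneg_pos)
    {
      fix \<epsilon> assume \<epsilon>: "\<epsilon> \<in> {0..e}"
      note normal_form_transforms[OF K[OF \<epsilon>] KB[OF \<epsilon>] KE[OF \<epsilon>] s conjunct1[OF sol[OF \<epsilon>]] D_def E_def \<rho>_def refl]
    }
    note transforms = this
    show "\<exists>\<rho>>0. \<exists>\<delta>>0. \<exists>C. \<forall>\<epsilon>\<in>{0..e}.
          let \<Phi> = normal_form (K1 \<epsilon>) (K2 \<epsilon>) (K3 \<epsilon>) in
          (\<forall>u\<in>even_sobolev0 s.
             (\<lambda>p. cmod (K_coeff (K1 \<epsilon>) (K2 \<epsilon>) (K3 \<epsilon>) u p)) summable_on modes \<and>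
             \<Phi> u \<in> even_sobolev0 s \<and>
             (sobolev_norm s u < \<rho> \<longrightarrow> sobolev_norm s (\<Phi> u) < \<delta>)) \<and>
          (\<exists>R :: (real \<Rightarrow> complex) \<Rightarrow> real \<Rightarrow> complex.
             (\<forall>v\<in>even_sobolev0 s. sobolev_norm s v < \<delta> \<longrightarrow>
                R v \<in> even_sobolev0 s \<and> sobolev_norm s (R v) \<le> C * sobolev_norm s v ^ 3) \<and>
             (\<forall>I f. is_interval I \<longrightarrow>
                solves \<alpha> \<omega> \<epsilon> (\<lambda>u x. - \<i> * N2 \<omega> u x) s I f \<longrightarrow>
                (\<forall>t\<in>I. sobolev_norm s (f t) < \<rho>) \<longrightarrow>
                solves \<alpha> \<omega> \<epsilon> R s I (\<lambda>t. \<Phi> (f t))))"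
      unfolding Let_def
      by (rule exI[of _ \<rho>], rule conjI[OF \<rho>(1)], rule exI[of _ "2 * \<rho>"], rule conjI[OF \<rho>(2)],
          rule exI[of _ "16 * D * E"], rule ballI, rule transforms)
  qed
qed

end
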